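(* Let $K$ be a star-shaped simplicial sphere of dimension $n-1$ on the vertex set $[m]=\{1,\dots,m\}$, let $\lambda\colon[m]\to\mathbb{Z}_2^n$ be a map such that $\lambda(i_1),\dots,\lambda(i_\ell)$ are linearly independent in $\mathbb{Z}_2^n$ whenever $\{i_1,\dots,i_\ell\}\in K$, let $\Lambda=(\lambda(1)\;\cdots\;\lambda(m))$ be the corresponding $n\times m$ matrix over $\mathbb{Z}_2$, and let $M(K,\lambda)=\mathbb{R}\mathcal{Z}_K/\ker\Lambda$ be the associated real topological toric manifold. Let $G$ be $\mathbb{Q}$ or $\mathbb{Z}_q=\mathbb{Z}/q\mathbb{Z}$ for a positive odd integer $q$. Then for every $p$ there is an additive isomorphism $$H^p(M(K,\lambda);G)\;\cong\;\bigoplus_{\substack{\omega\subseteq[m]\\ \varphi^{-1}(\omega)\in\operatorname{row}\Lambda}}\widetilde{H}^{p-1}(K_\omega;G).$$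
   Context: A simplicial complex $K$ on $[m]$ is a collection of subsets of $[m]$ closed under taking subsets and containing all singletons $\{i\}$, $i\in[m]$. It is a simplicial sphere of dimension $n-1$ if its geometric realization $|K|$ is homeomorphic to $S^{n-1}$; it is star-shaped if there are an embedding of $|K|$ into $\mathbb{R}^n$ and a point $p\in\mathbb{R}^n$ such that every ray from $p$ meets $|K|$ exactly once. The real moment-angle complex is $\mathbb{R}\mathcal{Z}_K=\bigcup_{\sigma\in K}\{(x_1,\dots,x_m)\in[0,1]^m : x_i\in\{0,1\}\text{ when } i\notin\sigma\}$. The group $\mathbb{Z}_2^m$ acts on it, the $i$-th coordinate vector acting by the reflection $x_i\mapsto 1-x_i$ in the $i$-th coordinate. The subgroup $\ker\Lambda\cong\mathbb{Z}_2^{m-n}$ of $\mathbb{Z}_2^m$ (the kernel of $\Lambda\colon\mathbb{Z}_2^m\to\mathbb{Z}_2^n$) acts freely on $\mathbb{R}\mathcal{Z}_K$, and $M(K,\lambda)$ denotes the orbit space. $\operatorname{row}\Lambda\subseteq\mathbb{Z}_2^m$ is the row space of $\Lambda$. The bijection $\varphi\colon\mathbb{Z}_2^m\to 2^{[m]}$ sends $v$ to the set of $i$ such that the $i$-th entry of $v$ is nonzero. $K_\omega=\{\sigma\in K:\sigma\subseteq\omega\}$ is the full subcomplex of $K$ on $\omega$. $\widetilde{H}^{*}$ is reduced simplicial cohomology, with the convention $\widetilde{H}^{-1}(K_\varnothing;G)=G$ (where $K_\varnothing=\{\varnothing\}$), the other reduced groups of $K_\varnothing$ being zero. *)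

theory Defs
  imports
    "HOL-Homology.Homology"
    "HOL-Algebra.Group_Action"
    "HOL-Library.Z2"
    "Jordan_Normal_Form.VS_Connect"
    "Jordan_Normal_Form.Matrix_Kernel"
begin

text \<open>The explicit membership of the empty simplex matters only for \<open>m = 0\<close>.\<close>

definition simplicial_complex_on :: "nat \<Rightarrow> nat set set \<Rightarrow> bool" where
  "simplicial_complex_on m K \<longleftrightarrow>
     K \<subseteq> Pow {1..m} \<and> {} \<in> K \<and> (\<forall>\<sigma>\<in>K. \<forall>\<tau>. \<tau> \<subseteq> \<sigma> \<longrightarrow> \<tau> \<in> K) \<and> (\<forall>i\<in>{1..m}. {i} \<in> K)"

definition full_subcomplex :: "nat set set \<Rightarrow> nat set \<Rightarrow> nat set set" where
  "full_subcomplex K \<omega> = {\<sigma> \<in> K. \<sigma> \<subseteq> \<omega>}"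

text \<open>Points are given by their barycentric coordinates.\<close>

definition geometric_realization :: "nat \<Rightarrow> nat set set \<Rightarrow> (nat \<Rightarrow> real) topology" where
  "geometric_realization m K = subtopology (powertop_real {1..m})
     {x. (\<forall>i\<in>{1..m}. 0 \<le> x i) \<and> (\<Sum>i=1..m. x i) = 1 \<and> {i \<in> {1..m}. x i \<noteq> 0} \<in> K}"

text \<open>The sphere \<open>S\<^sup>n\<^sup>-\<^sup>1\<close> in \<open>\<real>\<^sup>n\<close>, with \<open>S\<^sup>-\<^sup>1\<close> empty.\<close>

definition unit_sphere :: "nat \<Rightarrow> (nat \<Rightarrow> real) topology" where
  "unit_sphere n = subtopology (Euclidean_space n) {x. (\<Sum>i<n. (x i)\<^sup>2) = 1}"

lemma unit_sphere_0: "topspace (unit_sphere 0) = {}"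
  by (simp add: unit_sphere_def)

lemma unit_sphere_Suc: "unit_sphere (Suc n) = nsphere n"
  by (simp add: unit_sphere_def nsphere_def lessThan_Suc_atMost)

definition simplicial_sphere :: "nat \<Rightarrow> nat \<Rightarrow> nat set set \<Rightarrow> bool" where
  "simplicial_sphere n m K \<longleftrightarrow>
     simplicial_complex_on m K \<and> geometric_realization m K homeomorphic_space unit_sphere n"

text \<open>The embedding is an arbitrary topological one; rays are closed, i.e. contain \<open>p\<close>.\<close>

definition star_shaped :: "nat \<Rightarrow> nat \<Rightarrow> nat set set \<Rightarrow> bool" where
  "star_shaped n m K \<longleftrightarrow>
     (\<exists>f. embedding_map (geometric_realization m K) (Euclidean_space n) f \<and>
       (\<exists>p \<in> topspace (Euclidean_space n).
          \<forall>v \<in> topspace (Euclidean_space n). v \<noteq> (\<lambda>i. 0) \<longrightarrow>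
            (\<exists>!y. y \<in> f ` topspace (geometric_realization m K) \<and>
                  (\<exists>t\<ge>0. y = (\<lambda>i. p i + t * v i)))))"

text \<open>
  Vectors over \<open>\<int>\<^sub>2\<close> are of type \<^typ>\<open>bit vec\<close>, whose entries are numbered from \<open>0\<close>.
  As vertices are numbered from \<open>1\<close>, vertex \<open>i\<close> belongs to entry \<open>i - 1\<close>.
\<close>

definition lin_indpt_family :: "nat \<Rightarrow> (nat \<Rightarrow> bit vec) \<Rightarrow> nat set \<Rightarrow> bool" where
  "lin_indpt_family n lam \<sigma> \<longleftrightarrow>
     inj_on lam \<sigma> \<and> \<not> LinearCombinations.module.lin_dep class_ring (module_vec TYPE(bit) n) (lam ` \<sigma>)"

definition char_matrix :: "nat \<Rightarrow> nat \<Rightarrow> (nat \<Rightarrow> bit vec) \<Rightarrow> bit mat" where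
  "char_matrix n m lam = mat_of_cols n (map lam [1..<Suc m])"

definition vec_support :: "bit vec \<Rightarrow> nat set" where
  "vec_support v = {i \<in> {1..dim_vec v}. vec_index v (i - 1) \<noteq> 0}"

definition real_moment_angle :: "nat \<Rightarrow> nat set set \<Rightarrow> (nat \<Rightarrow> real) topology" where
  "real_moment_angle m K = subtopology (powertop_real {1..m})
     (\<Union>\<sigma>\<in>K. {x. (\<forall>i\<in>{1..m}. x i \<in> {0..1}) \<and> (\<forall>i\<in>{1..m}. i \<notin> \<sigma> \<longrightarrow> x i \<in> {0, 1})})"

definition reflect :: "nat \<Rightarrow> bit vec \<Rightarrow> (nat \<Rightarrow> real) \<Rightarrow> (nat \<Rightarrow> real)" where
  "reflect m g x = (\<lambda>i\<in>{1..m}. if i \<in> vec_support g then 1 - x i else x i)"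

definition quotient_topology :: "'a topology \<Rightarrow> ('a \<Rightarrow> 'b) \<Rightarrow> 'b topology" where
  "quotient_topology X q =
     topology (\<lambda>U. U \<subseteq> q ` topspace X \<and> openin X {x \<in> topspace X. q x \<in> U})"

lemma openin_quotient_topology:
  "openin (quotient_topology X q) U \<longleftrightarrow>
     U \<subseteq> q ` topspace X \<and> openin X {x \<in> topspace X. q x \<in> U}"
proof -
  have "openin X {x \<in> topspace X. q x \<in> S \<inter> T}"
    if "openin X {x \<in> topspace X. q x \<in> S}" "openin X {x \<in> topspace X. q x \<in> T}" for S T
  proof -
    have "{x \<in> topspace X. q x \<in> S \<inter> T} = {x \<in> topspace X. q x \<in> S} \<inter> {x \<in> topspace X. q x \<in> T}"
      by blast
    then show ?thesis using that by auto
  qed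
  moreover have "openin X {x \<in> topspace X. q x \<in> \<Union>\<K>}"
    if "\<forall>S\<in>\<K>. openin X {x \<in> topspace X. q x \<in> S}" for \<K>
  proof -
    have "{x \<in> topspace X. q x \<in> \<Union>\<K>} = (\<Union>S\<in>\<K>. {x \<in> topspace X. q x \<in> S})"
      by blast
    then show ?thesis using that by auto
  qed
  ultimately have "istopology (\<lambda>U. U \<subseteq> q ` topspace X \<and> openin X {x \<in> topspace X. q x \<in> U})"
    unfolding istopology_def by blast
  then show ?thesis
    by (simp add: quotient_topology_def)
qed

lemma topspace_quotient_topology: "topspace (quotient_topology X q) = q ` topspace X"
proof (rule antisym)
  show "topspace (quotient_topology X q) \<subseteq> q ` topspace X"
    using openin_topspace[of "quotient_topology X q"] by (simp only: openin_quotient_topology)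
  have "{x \<in> topspace X. q x \<in> q ` topspace X} = topspace X" by blast
  then have "openin (quotient_topology X q) (q ` topspace X)"
    by (simp add: openin_quotient_topology)
  then show "q ` topspace X \<subseteq> topspace (quotient_topology X q)"
    by (rule openin_subset)
qed

lemma quotient_map_quotient_topology: "quotient_map X (quotient_topology X q) q"
  by (auto simp: quotient_map_def topspace_quotient_topology openin_quotient_topology)

definition kernel_group :: "nat \<Rightarrow> nat \<Rightarrow> (nat \<Rightarrow> bit vec) \<Rightarrow> bit vec monoid" where
  "kernel_group n m lam =
     (monoid_vec TYPE(bit) m)\<lparr>carrier := mat_kernel (char_matrix n m lam)\<rparr>"

definition real_toric_manifold ::
    "nat \<Rightarrow> nat \<Rightarrow> nat set set \<Rightarrow> (nat \<Rightarrow> bit vec) \<Rightarrow> (nat \<Rightarrow> real) set topology" where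
  "real_toric_manifold n m K lam =
     quotient_topology (real_moment_angle m K) (orbit (kernel_group n m lam) (reflect m))"

definition row_subsets :: "nat \<Rightarrow> nat \<Rightarrow> (nat \<Rightarrow> bit vec) \<Rightarrow> nat set set" where
  "row_subsets n m lam =
     {\<omega>. \<omega> \<subseteq> {1..m} \<and>
         inv_into (carrier_vec m) vec_support \<omega> \<in>
           vec_space.row_space m (char_matrix n m lam)}"

lemma bij_betw_vec_support: "bij_betw vec_support (carrier_vec m) (Pow {1..m})"
proof (rule bij_betw_imageI)
  show "inj_on vec_support (carrier_vec m)"
  proof (rule inj_onI)
    fix u v :: "bit vec"
    assume uv: "u \<in> carrier_vec m" "v \<in> carrier_vec m" and eq: "vec_support u = vec_support v"
    have "vec_index u j = vec_index v j" if "j < m" for j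
    proof -
      have "Suc j \<in> vec_support u \<longleftrightarrow> Suc j \<in> vec_support v" using eq by simp
      then have "vec_index u j \<noteq> 0 \<longleftrightarrow> vec_index v j \<noteq> 0"
        using uv that by (auto simp: vec_support_def)
      then show ?thesis by (cases "vec_index u j"; cases "vec_index v j") auto
    qed
    then show "u = v" using uv by (intro eq_vecI) auto
  qed
  show "vec_support ` carrier_vec m = Pow {1..m}"
  proof (intro equalityI subsetI)
    fix \<omega> assume "\<omega> \<in> vec_support ` carrier_vec m"
    then show "\<omega> \<in> Pow {1..m}" by (auto simp: vec_support_def)
  next
    fix \<omega> assume \<omega>: "\<omega> \<in> Pow {1..m}"
    let ?v = "vec m (\<lambda>j. if Suc j \<in> \<omega> then 1 else 0) :: bit vec"
    have "i \<in> \<omega> \<longleftrightarrow> i \<in> vec_support ?v" for i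
    proof (cases i)
      case 0
      then show ?thesis using \<omega> by (auto simp: vec_support_def)
    next
      case (Suc j)
      then show ?thesis using \<omega> by (auto simp: vec_support_def split: if_splits)
    qed
    then have "\<omega> = vec_support ?v" by blast
    then show "\<omega> \<in> vec_support ` carrier_vec m" by (metis image_eqI vec_carrier)
  qed
qed

text \<open>
  A chain complex is given by its groups \<open>C p\<close> and its boundary maps
  \<open>d p\<close> from \<open>C p\<close> to \<open>C (p - 1)\<close>, for all integers \<open>p\<close>.
\<close>

definition hom_group ::
    "('a, 'b) monoid_scheme \<Rightarrow> ('c, 'd) monoid_scheme \<Rightarrow> ('a \<Rightarrow> 'c) monoid" where
  "hom_group A G =
     \<lparr>carrier = hom A G \<inter> extensional (carrier A),
      monoid.mult = (\<lambda>f g. \<lambda>a\<in>carrier A. f a \<otimes>\<^bsub>G\<^esub> g a),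
      one = (\<lambda>a\<in>carrier A. \<one>\<^bsub>G\<^esub>)\<rparr>"

definition coboundary ::
    "(int \<Rightarrow> 'a monoid) \<Rightarrow> (int \<Rightarrow> 'a \<Rightarrow> 'a) \<Rightarrow> int \<Rightarrow> ('a \<Rightarrow> 'g) \<Rightarrow> ('a \<Rightarrow> 'g)" where
  "coboundary C d p f = (\<lambda>c\<in>carrier (C (p + 1)). f (d (p + 1) c))"

definition cocycle_group ::
    "(int \<Rightarrow> 'a monoid) \<Rightarrow> (int \<Rightarrow> 'a \<Rightarrow> 'a) \<Rightarrow> 'g monoid \<Rightarrow> int \<Rightarrow> ('a \<Rightarrow> 'g) monoid" where
  "cocycle_group C d G p =
     (hom_group (C p) G)
       \<lparr>carrier := Coset.kernel (hom_group (C p) G) (hom_group (C (p + 1)) G) (coboundary C d p)\<rparr>"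

definition cohomology_group ::
    "(int \<Rightarrow> 'a monoid) \<Rightarrow> (int \<Rightarrow> 'a \<Rightarrow> 'a) \<Rightarrow> 'g monoid \<Rightarrow> int \<Rightarrow> ('a \<Rightarrow> 'g) set monoid" where
  "cohomology_group C d G p =
     cocycle_group C d G p Mod (coboundary C d (p - 1) ` carrier (hom_group (C (p - 1)) G))"

definition singular_chain_groups :: "'a topology \<Rightarrow> int \<Rightarrow> 'a chain monoid" where
  "singular_chain_groups X p = (if p < 0 then free_Abelian_group {} else chain_group (nat p) X)"

definition singular_cohomology ::
    "int \<Rightarrow> 'a topology \<Rightarrow> 'g monoid \<Rightarrow> ('a chain \<Rightarrow> 'g) set monoid" where
  "singular_cohomology p X G =
     cohomology_group (singular_chain_groups X) (\<lambda>p. chain_boundary (nat p)) G p"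

text \<open>
  The augmented simplicial chain complex: simplices carry the orientation given by the order
  of the vertices, and the empty simplex generates the chains of degree \<open>-1\<close>.
\<close>

definition simplicial_chain_groups :: "nat set set \<Rightarrow> int \<Rightarrow> (nat set \<Rightarrow>\<^sub>0 int) monoid" where
  "simplicial_chain_groups K p =
     free_Abelian_group {\<sigma> \<in> K. finite \<sigma> \<and> int (card \<sigma>) = p + 1}"

definition simplicial_boundary :: "(nat set \<Rightarrow>\<^sub>0 int) \<Rightarrow> (nat set \<Rightarrow>\<^sub>0 int)" where
  "simplicial_boundary =
     frag_extend (\<lambda>\<sigma>. \<Sum>v\<in>\<sigma>. frag_cmul ((-1) ^ card {u \<in> \<sigma>. u < v}) (frag_of (\<sigma> - {v})))"

definition reduced_simplicial_cohomology ::
    "int \<Rightarrow> nat set set \<Rightarrow> 'g monoid \<Rightarrow> ((nat set \<Rightarrow>\<^sub>0 int) \<Rightarrow> 'g) set monoid" where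
  "reduced_simplicial_cohomology p K G =
     cohomology_group (simplicial_chain_groups K) (\<lambda>_. simplicial_boundary) G p"

definition rat_group :: "rat monoid" where
  "rat_group = \<lparr>carrier = UNIV, monoid.mult = (+), one = 0\<rparr>"

end

theory Submission
  imports Defs
begin

text \<open>
  The cube \<open>[0,1]\<^sup>m\<close> is a cell complex whose cells are permuted by \<open>\<int>\<^sub>2\<^sup>m\<close>, and \<open>\<Gamma> = ker \<Lambda>\<close> acts freely
  on the cells lying in \<open>\<real>\<Z>\<^sub>K\<close>, because a nonempty element of \<open>\<Gamma>\<close> is never a simplex of \<open>K\<close>. The
  complex of \<open>\<Gamma>\<close>-orbits of cells is chain homotopy equivalent to the singular complex of the
  quotient \<open>M\<close>: a cell has an open star neighbourhood in \<open>M\<close> that is contractible, which gives a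
  chain map by acyclic carriers, and Mayer--Vietoris for unions of such neighbourhoods shows that it
  is a quasi-isomorphism of free complexes.

  A subset \<open>\<omega>\<close> of \<open>[m]\<close> is a character of \<open>\<int>\<^sub>2\<^sup>m\<close>. Sending a simplex \<open>\<sigma>\<close> of \<open>K\<^sub>\<omega>\<close> to the sum over all
  cells parallel to \<open>\<sigma>\<close>, weighted by \<open>\<omega>\<close>, is a chain map to the orbit complex up to sign and a
  shift of the degree. It vanishes unless \<open>\<omega>\<close> is trivial on \<open>\<Gamma>\<close>, that is, unless \<open>\<omega>\<close> lies in
  the row space of \<open>\<Lambda>\<close>, and up to powers of \<open>2\<close> these maps decompose the orbit complex. As \<open>2\<close> acts
  invertibly on \<open>G\<close>, the decomposition is one of the cohomology with coefficients in \<open>G\<close>.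
\<close>

section \<open>Acyclic free complexes\<close>

text \<open>An isomorphism on homology alone would require universal coefficients before it said
  anything about cohomology with values in G. The comparison is therefore carried to an honest chain
  homotopy equivalence, obtained from a contraction of a mapping cone; Hom(-, G) preserves such an
  equivalence, and the homotopies later yield the primitives of cocycles explicitly. A simplex with
  p vertices spans the free directions of p-dimensional cells, and the empty simplex corresponds to
  the vertices of the cube. This is the source of the shift from p to p - 1 and of reduced
  cohomology. The power of 2 in degree p is 2^(m-p), the number of cells parallel to a given p-cell;
  it comes from orthogonality of characters, in each of the two variables. All maps between chains
  are integral, and division by this power takes place only on the values of cochains. The row space
  enters as the annihilator of the kernel under the pairing that sends two sets to the parity of
  their intersection; that these are exactly the characters trivial on the kernel follows from
  counting.\<close>

lemma frag_additive_eqI: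
  assumes "Poly_Mapping.keys c \<subseteq> S"
    and f: "\<And>x y. f (x - y) = f x - (f y :: 'b::ab_group_add)"
    and g: "\<And>x y. g (x - y) = g x - g y"
    and eq: "\<And>x. x \<in> S \<Longrightarrow> f (frag_of x) = g (frag_of x)"
  shows "f c = g c"
  using assms(1)
proof (induction rule: frag_induction)
  case zero
  show ?case using f[of 0 0] g[of 0 0] by simp
qed (auto simp: f g eq)

lemma keys_frag_extend_subset:
  assumes "Poly_Mapping.keys c \<subseteq> S" "\<And>x. x \<in> S \<Longrightarrow> Poly_Mapping.keys (f x) \<subseteq> T"
  shows "Poly_Mapping.keys (frag_extend f c) \<subseteq> T"
  using keys_frag_extend[of f c] assms by blast

lemma keys_diff_subset:
  "Poly_Mapping.keys a \<subseteq> S \<Longrightarrow> Poly_Mapping.keys b \<subseteq> S \<Longrightarrow> Poly_Mapping.keys (a - b :: 'a \<Rightarrow>\<^sub>0 int) \<subseteq> S"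
  using keys_diff[of a b] by blast

lemma keys_add_subset:
  "Poly_Mapping.keys a \<subseteq> S \<Longrightarrow> Poly_Mapping.keys b \<subseteq> S \<Longrightarrow> Poly_Mapping.keys (a + b :: 'a \<Rightarrow>\<^sub>0 int) \<subseteq> S"
  using keys_add[of a b] by blast

text \<open>If \<open>s\<close> is already a right inverse of the boundary on cycles of degree p,
  then b - s(bd b) is a cycle for every basis element b of degree p + 1, and any chain bounded by it
  may serve as s(b). Freeness is what allows the choice on basis elements. Acyclicity is unreduced:
  in degree 0 every chain is a cycle and must bound. There the truncated index p - 1 does no harm
  because \<open>bd 0\<close> vanishes.\<close>

lemma acyclic_free_complex_contraction:
  fixes B :: "nat \<Rightarrow> 'b set" and bd :: "nat \<Rightarrow> ('b \<Rightarrow>\<^sub>0 int) \<Rightarrow> ('b \<Rightarrow>\<^sub>0 int)"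
  assumes diff: "\<And>p x y. bd p (x - y) = bd p x - bd p y"
    and bd0: "\<And>x. bd 0 x = 0"
    and bd: "\<And>p b. b \<in> B (Suc p) \<Longrightarrow> Poly_Mapping.keys (bd (Suc p) (frag_of b)) \<subseteq> B p"
    and bdbd: "\<And>p b. b \<in> B (Suc p) \<Longrightarrow> bd p (bd (Suc p) (frag_of b)) = 0"
    and acyclic: "\<And>p y. Poly_Mapping.keys y \<subseteq> B p \<Longrightarrow> bd p y = 0 \<Longrightarrow>
                     \<exists>z. Poly_Mapping.keys z \<subseteq> B (Suc p) \<and> bd (Suc p) z = y"
  obtains s :: "nat \<Rightarrow> 'b \<Rightarrow> ('b \<Rightarrow>\<^sub>0 int)"
    where "\<And>p b. b \<in> B p \<Longrightarrow> Poly_Mapping.keys (s p b) \<subseteq> B (Suc p)"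
      and "\<And>p x. Poly_Mapping.keys x \<subseteq> B p \<Longrightarrow>
             bd (Suc p) (frag_extend (s p) x) + frag_extend (s (p - 1)) (bd p x) = x"
proof -
  let ?carr = "\<lambda>p f. \<forall>b\<in>B p. Poly_Mapping.keys (f b :: 'b \<Rightarrow>\<^sub>0 int) \<subseteq> B (Suc p)"
  \<comment> \<open>The invariant of the recursion: \<open>f\<close> splits the boundary on cycles
    of degree p. The relation \<open>?R\<close> below is the homotopy identity that ties consecutive
    degrees together.\<close>
  let ?J = "\<lambda>p f. ?carr p f \<and>
      (\<forall>y. Poly_Mapping.keys y \<subseteq> B p \<and> bd p y = 0 \<longrightarrow> bd (Suc p) (frag_extend f y) = y)"
  let ?R = "\<lambda>p f f'. \<forall>b\<in>B (Suc p). bd (Suc (Suc p)) (f' b) = frag_of b - frag_extend f (bd (Suc p) (frag_of b))"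
  have base: "\<exists>f. ?J 0 f \<and> True"
  proof -
    have "\<forall>b\<in>B 0. \<exists>z. Poly_Mapping.keys z \<subseteq> B (Suc 0) \<and> bd (Suc 0) z = frag_of b"
      using acyclic[of _ 0] bd0 by simp
    then obtain f where f: "\<And>b. b \<in> B 0 \<Longrightarrow> Poly_Mapping.keys (f b) \<subseteq> B (Suc 0) \<and> bd (Suc 0) (f b) = frag_of b"
      by metis
    have "bd (Suc 0) (frag_extend f y) = y" if "Poly_Mapping.keys y \<subseteq> B 0" for y
      using that by (rule frag_additive_eqI[where f = "\<lambda>y. bd (Suc 0) (frag_extend f y)" and g = "\<lambda>y. y"]) (auto simp: frag_extend_diff diff f)
    then show ?thesis using f by (intro exI[of _ f]) auto
  qed
  have step: "\<exists>f'. ?J (Suc p) f' \<and> ?R p f f'" if J: "?J p f" for p f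
  proof -
    have "\<forall>b\<in>B (Suc p). \<exists>z. Poly_Mapping.keys z \<subseteq> B (Suc (Suc p)) \<and>
            bd (Suc (Suc p)) z = frag_of b - frag_extend f (bd (Suc p) (frag_of b))"
    proof
      fix b assume b: "b \<in> B (Suc p)"
      have y: "Poly_Mapping.keys (bd (Suc p) (frag_of b)) \<subseteq> B p" "bd p (bd (Suc p) (frag_of b)) = 0"
        using bd[OF b] bdbd[OF b] .
      show "\<exists>z. Poly_Mapping.keys z \<subseteq> B (Suc (Suc p)) \<and>
            bd (Suc (Suc p)) z = frag_of b - frag_extend f (bd (Suc p) (frag_of b))"
      proof (rule acyclic)
        show "Poly_Mapping.keys (frag_of b - frag_extend f (bd (Suc p) (frag_of b))) \<subseteq> B (Suc p)"
          using J y b by (intro keys_diff_subset keys_frag_extend_subset[OF y(1)]) auto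
        show "bd (Suc p) (frag_of b - frag_extend f (bd (Suc p) (frag_of b))) = 0"
          using J y by (simp add: diff)
      qed
    qed
    then obtain f' where f': "\<And>b. b \<in> B (Suc p) \<Longrightarrow> Poly_Mapping.keys (f' b) \<subseteq> B (Suc (Suc p)) \<and>
            bd (Suc (Suc p)) (f' b) = frag_of b - frag_extend f (bd (Suc p) (frag_of b))"
      by metis
    have "bd (Suc (Suc p)) (frag_extend f' y) = y - frag_extend f (bd (Suc p) y)"
      if "Poly_Mapping.keys y \<subseteq> B (Suc p)" for y
      using that by (rule frag_additive_eqI[where f = "\<lambda>y. bd (Suc (Suc p)) (frag_extend f' y)" and g = "\<lambda>y. y - frag_extend f (bd (Suc p) y)"]) (auto simp: frag_extend_diff diff f')
    then show ?thesis using f' by (intro exI[of _ f']) auto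
  qed
  have "\<exists>s. \<forall>p. ?J p (s p) \<and> ?R p (s p) (s (Suc p))"
  proof (rule dependent_nat_choice)
    show "\<exists>f. ?J 0 f" using base by blast
    show "\<exists>f'. ?J (Suc p) f' \<and> ?R p f f'" if "?J p f" for f p using step[OF that] .
  qed
  then obtain s where s: "\<And>p. ?J p (s p)" "\<And>p. ?R p (s p) (s (Suc p))" by blast
  show thesis
  proof
    show "Poly_Mapping.keys (s p b) \<subseteq> B (Suc p)" if "b \<in> B p" for p b
      using s(1) that by blast
    show "bd (Suc p) (frag_extend (s p) x) + frag_extend (s (p - 1)) (bd p x) = x"
      if x: "Poly_Mapping.keys x \<subseteq> B p" for p x
    proof (cases p)
      case 0
      then show ?thesis using s(1)[of 0] x bd0 by simp
    next
      case (Suc q)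
      have "bd (Suc p) (frag_extend (s p) x) = x - frag_extend (s q) (bd p x)"
        using x by (rule frag_additive_eqI[where f = "\<lambda>y. bd (Suc p) (frag_extend (s p) y)" and g = "\<lambda>y. y - frag_extend (s q) (bd p y)"]) (use s(2)[of q] in \<open>auto simp: frag_extend_diff diff Suc\<close>)
      then show ?thesis by (simp add: Suc)
    qed
  qed
qed

text \<open>The homotopies are read off a contraction of the mapping cone of \<open>\<Phi>\<close>.\<close>

lemma acyclic_mapping_cone_homotopy_inverse:
  fixes C :: "nat \<Rightarrow> 'c set" and bdC :: "nat \<Rightarrow> ('c \<Rightarrow>\<^sub>0 int) \<Rightarrow> ('c \<Rightarrow>\<^sub>0 int)"
    and E :: "nat \<Rightarrow> 'e set" and bdE :: "('e \<Rightarrow>\<^sub>0 int) \<Rightarrow> ('e \<Rightarrow>\<^sub>0 int)"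
    and \<Phi> :: "('e \<Rightarrow>\<^sub>0 int) \<Rightarrow> ('c \<Rightarrow>\<^sub>0 int)"
  assumes diffC: "\<And>p x y. bdC p (x - y) = bdC p x - bdC p y"
    and diffE: "\<And>x y. bdE (x - y) = bdE x - bdE y"
    and diffP: "\<And>x y. \<Phi> (x - y) = \<Phi> x - \<Phi> y"
    and bdC0: "\<And>x. bdC 0 x = 0"
    and bdE0: "\<And>x. Poly_Mapping.keys x \<subseteq> E 0 \<Longrightarrow> bdE x = 0"
    and bdC: "\<And>p x. Poly_Mapping.keys x \<subseteq> C (Suc p) \<Longrightarrow> Poly_Mapping.keys (bdC (Suc p) x) \<subseteq> C p"
    and bdE: "\<And>p x. Poly_Mapping.keys x \<subseteq> E (Suc p) \<Longrightarrow> Poly_Mapping.keys (bdE x) \<subseteq> E p"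
    and Phi: "\<And>p x. Poly_Mapping.keys x \<subseteq> E p \<Longrightarrow> Poly_Mapping.keys (\<Phi> x) \<subseteq> C p"
    and bdbdC: "\<And>p x. Poly_Mapping.keys x \<subseteq> C (Suc p) \<Longrightarrow> bdC p (bdC (Suc p) x) = 0"
    and bdbdE: "\<And>p x. Poly_Mapping.keys x \<subseteq> E (Suc p) \<Longrightarrow> bdE (bdE x) = 0"
    and bdPhi: "\<And>p x. Poly_Mapping.keys x \<subseteq> E p \<Longrightarrow> bdC p (\<Phi> x) = \<Phi> (bdE x)"
    and ac0: "\<And>c. Poly_Mapping.keys c \<subseteq> C 0 \<Longrightarrow>
         \<exists>d' c'. Poly_Mapping.keys d' \<subseteq> E 0 \<and> Poly_Mapping.keys c' \<subseteq> C 1 \<and> c = \<Phi> d' + bdC 1 c'"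
    and acS: "\<And>p c d. Poly_Mapping.keys c \<subseteq> C (Suc p) \<Longrightarrow> Poly_Mapping.keys d \<subseteq> E p \<Longrightarrow>
          bdE d = 0 \<Longrightarrow> bdC (Suc p) c = \<Phi> d \<Longrightarrow>
         \<exists>d' c'. Poly_Mapping.keys d' \<subseteq> E (Suc p) \<and> Poly_Mapping.keys c' \<subseteq> C (Suc (Suc p)) \<and>
            d = bdE d' \<and> c = \<Phi> d' + bdC (Suc (Suc p)) c'"
  obtains \<psi> :: "nat \<Rightarrow> 'c \<Rightarrow> ('e \<Rightarrow>\<^sub>0 int)" and h :: "nat \<Rightarrow> 'c \<Rightarrow> ('c \<Rightarrow>\<^sub>0 int)"
    and k :: "nat \<Rightarrow> 'e \<Rightarrow> ('e \<Rightarrow>\<^sub>0 int)"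
  where "\<And>p x. Poly_Mapping.keys x \<subseteq> C p \<Longrightarrow> Poly_Mapping.keys (frag_extend (\<psi> p) x) \<subseteq> E p"
    and "\<And>p x. Poly_Mapping.keys x \<subseteq> C p \<Longrightarrow> Poly_Mapping.keys (frag_extend (h p) x) \<subseteq> C (Suc p)"
    and "\<And>p x. Poly_Mapping.keys x \<subseteq> E p \<Longrightarrow> Poly_Mapping.keys (frag_extend (k p) x) \<subseteq> E (Suc p)"
    and "\<And>p x. Poly_Mapping.keys x \<subseteq> C p \<Longrightarrow>
          bdE (frag_extend (\<psi> p) x) = frag_extend (\<psi> (p - 1)) (bdC p x)"
    and "\<And>p x. Poly_Mapping.keys x \<subseteq> C p \<Longrightarrow>
          bdC (Suc p) (frag_extend (h p) x) + frag_extend (h (p - 1)) (bdC p x) = x - \<Phi> (frag_extend (\<psi> p) x)"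
    and "\<And>p x. Poly_Mapping.keys x \<subseteq> E p \<Longrightarrow>
          bdE (frag_extend (k p) x) + frag_extend (k (p - 1)) (bdE x) = x - frag_extend (\<psi> p) (\<Phi> x)"
proof -
  define inL :: "('c \<Rightarrow>\<^sub>0 int) \<Rightarrow> ('c + 'e \<Rightarrow>\<^sub>0 int)" where "inL = frag_extend (frag_of \<circ> Inl)"
  define inR :: "('e \<Rightarrow>\<^sub>0 int) \<Rightarrow> ('c + 'e \<Rightarrow>\<^sub>0 int)" where "inR = frag_extend (frag_of \<circ> Inr)"
  define prL :: "('c + 'e \<Rightarrow>\<^sub>0 int) \<Rightarrow> ('c \<Rightarrow>\<^sub>0 int)" where "prL = frag_extend (case_sum frag_of (\<lambda>_. 0))"
  define prR :: "('c + 'e \<Rightarrow>\<^sub>0 int) \<Rightarrow> ('e \<Rightarrow>\<^sub>0 int)" where "prR = frag_extend (case_sum (\<lambda>_. 0) frag_of)"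
  have dif: "inL (x - y) = inL x - inL y" "inR (x' - y') = inR x' - inR y'"
    "prL (a - b) = prL a - prL b" "prR (a - b) = prR a - prR b" for x y x' y' a b
    by (simp_all add: inL_def inR_def prL_def prR_def frag_extend_diff)
  have zer [simp]: "inL 0 = 0" "inR 0 = 0" "prL 0 = 0" "prR 0 = 0"
    by (simp_all add: inL_def inR_def prL_def prR_def)
  have neg [simp]: "prL (- a) = - prL a" "prR (- a) = - prR a" "inR (- y) = - inR y" for a y
    by (simp_all add: inR_def prL_def prR_def frag_extend_minus)
  have addi: "prL (a + b) = prL a + prL b" "prR (a + b) = prR a + prR b" for a b
    by (simp_all add: prL_def prR_def frag_extend_add)
  have prin [simp]: "prL (inL x) = x" "prR (inR y) = y" "prR (inL x) = 0" "prL (inR y) = 0" for x y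
    subgoal by (rule frag_additive_eqI[OF subset_UNIV, where f = "\<lambda>y. prL (inL y)" and g = "\<lambda>y. y"]) (auto simp: dif, simp add: inL_def prL_def)
    subgoal by (rule frag_additive_eqI[OF subset_UNIV, where f = "\<lambda>y. prR (inR y)" and g = "\<lambda>y. y"]) (auto simp: dif, simp add: inR_def prR_def)
    subgoal by (rule frag_additive_eqI[OF subset_UNIV, where f = "\<lambda>y. prR (inL y)" and g = "\<lambda>y. 0"]) (auto simp: dif, simp add: inL_def prR_def)
    subgoal by (rule frag_additive_eqI[OF subset_UNIV, where f = "\<lambda>y. prL (inR y)" and g = "\<lambda>y. 0"]) (auto simp: dif, simp add: inR_def prL_def)
    done
  have split: "z = inL (prL z) + inR (prR z)" for z
  proof (rule frag_additive_eqI[OF subset_UNIV, where f = "\<lambda>z. z" and g = "\<lambda>z. inL (prL z) + inR (prR z)"])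
    show "frag_of w = inL (prL (frag_of w)) + inR (prR (frag_of w))" for w
      by (cases w) (simp_all add: inL_def inR_def prL_def prR_def)
  qed (auto simp: dif)
  \<comment> \<open>The cone in degree p has the summand C in degree p and the summand E in degree p
    - 1; the latter is absent for p = 0.\<close>
  define B where "B p = Inl ` C p \<union> (if p = 0 then {} else Inr ` E (p - 1))" for p
  have kin: "Poly_Mapping.keys (inL x) \<subseteq> S \<longleftrightarrow> Inl ` Poly_Mapping.keys x \<subseteq> S" for x S
  proof -
    have "Poly_Mapping.keys (inL x) = Inl ` Poly_Mapping.keys x"
    proof
      show "Poly_Mapping.keys (inL x) \<subseteq> Inl ` Poly_Mapping.keys x"
        unfolding inL_def by (rule keys_frag_extend_subset[OF order_refl]) auto
      have "Poly_Mapping.keys (prL (inL x)) \<subseteq> Inl -` Poly_Mapping.keys (inL x)"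
        unfolding prL_def by (rule keys_frag_extend_subset[OF order_refl]) (auto split: sum.splits)
      then show "Inl ` Poly_Mapping.keys x \<subseteq> Poly_Mapping.keys (inL x)" by auto
    qed
    then show ?thesis by simp
  qed
  have kinR: "Poly_Mapping.keys (inR x) \<subseteq> S" if "Inr ` Poly_Mapping.keys x \<subseteq> S" for x S
    unfolding inR_def by (rule keys_frag_extend_subset[OF order_refl]) (use that in auto)
  have prLB: "Poly_Mapping.keys (prL z) \<subseteq> C p" if "Poly_Mapping.keys z \<subseteq> B p" for z p
    unfolding prL_def
    by (rule keys_frag_extend_subset[OF that]) (auto simp: B_def split: if_splits)
  have prRB: "Poly_Mapping.keys (prR z) \<subseteq> (if p = 0 then {} else E (p - 1))"
    if "Poly_Mapping.keys z \<subseteq> B p" for z p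
    unfolding prR_def
    by (rule keys_frag_extend_subset[OF that]) (auto simp: B_def split: if_splits)
  \<comment> \<open>The minus sign on the E-component makes the square of the cone boundary vanish,
    given that \<Phi> is a chain map.\<close>
  define bd where "bd p z = inL (bdC p (prL z) + (if p = 0 then 0 else \<Phi> (prR z)))
                           - inR (if p = 0 then 0 else bdE (prR z))" for p z
  have zeroE [simp]: "bdE 0 = 0" and zeroP [simp]: "\<Phi> 0 = 0" and zeroC [simp]: "bdC p 0 = 0" for p
    using diffE[of 0 0] diffP[of 0 0] diffC[of p 0 0] by simp_all
  have inLadd: "inL (x + y) = inL x + inL y" for x y by (simp add: inL_def frag_extend_add)
  have "\<exists>s. (\<forall>p b. b \<in> B p \<longrightarrow> Poly_Mapping.keys (s p b) \<subseteq> B (Suc p)) \<and>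
      (\<forall>p x. Poly_Mapping.keys x \<subseteq> B p \<longrightarrow>
             bd (Suc p) (frag_extend (s p) x) + frag_extend (s (p - 1)) (bd p x) = x)"
  proof (rule acyclic_free_complex_contraction[of bd B])
    show "bd p (x - y) = bd p x - bd p y" for p x y
      by (simp add: bd_def dif diffC diffE diffP inLadd)
    show "bd 0 x = 0" for x by (simp add: bd_def bdC0)
    fix p
    have all: "Poly_Mapping.keys (bd (Suc p) z) \<subseteq> B p \<and> bd p (bd (Suc p) z) = 0"
      if z: "Poly_Mapping.keys z \<subseteq> B (Suc p)" for z
    proof -
      have L: "Poly_Mapping.keys (prL z) \<subseteq> C (Suc p)" and R: "Poly_Mapping.keys (prR z) \<subseteq> E p"
        using prLB[OF z] prRB[OF z] by auto
      have 1: "Poly_Mapping.keys (bdC (Suc p) (prL z) + \<Phi> (prR z)) \<subseteq> C p"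
        by (intro keys_add_subset bdC Phi L R)
      have 2: "Inr ` Poly_Mapping.keys (bdE (prR z)) \<subseteq> B p"
        using bdE0[of "prR z"] bdE[of "prR z" "p - 1"] R by (cases p) (auto simp: B_def)
      have "bd p (bd (Suc p) z) = 0"
      proof (cases p)
        case 0 then show ?thesis by (simp add: bd_def bdC0)
      next
        case (Suc q)
        have "bdC p (bdC (Suc p) (prL z) + \<Phi> (prR z)) = bdC p (bdC (Suc p) (prL z)) - bdC p (- \<Phi> (prR z))"
          by (subst diffC[symmetric]) simp
        also have "bdC p (- \<Phi> (prR z)) = - bdC p (\<Phi> (prR z))" using diffC[of p 0] by simp
        finally have "bdC p (bdC (Suc p) (prL z) + \<Phi> (prR z)) = \<Phi> (bdE (prR z))"
          using bdbdC[OF L] bdPhi[OF R] by simp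
        moreover have "\<Phi> (- x) = - \<Phi> x" "bdE (- y) = - bdE y" for x y
          using diffP[of 0] diffE[of 0] by simp_all
        moreover have "bdE (bdE (prR z)) = 0" using bdbdE[of "prR z" q] R Suc by simp
        ultimately show ?thesis by (simp add: bd_def dif Suc)
      qed
      moreover have "Poly_Mapping.keys (bd (Suc p) z) \<subseteq> B p"
        unfolding bd_def using 1 2
        by (intro keys_diff_subset kinR) (auto simp: kin B_def)
      ultimately show ?thesis by blast
    qed
    show "Poly_Mapping.keys (bd (Suc p) (frag_of b)) \<subseteq> B p" "bd p (bd (Suc p) (frag_of b)) = 0"
      if "b \<in> B (Suc p)" for b
      using all[of "frag_of b"] that by auto
    show "\<exists>z. Poly_Mapping.keys z \<subseteq> B (Suc p) \<and> bd (Suc p) z = y"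
      if y: "Poly_Mapping.keys y \<subseteq> B p" "bd p y = 0" for y
    proof -
      have L: "Poly_Mapping.keys (prL y) \<subseteq> C p" by (rule prLB[OF y(1)])
      \<comment> \<open>A cycle (c, e) of the cone satisfies bd c = -\<Phi> e, whereas
        \<open>acS\<close> is phrased without the sign; it is therefore applied to -e.\<close>
      have "\<exists>d' c'. Poly_Mapping.keys d' \<subseteq> E p \<and> Poly_Mapping.keys c' \<subseteq> C (Suc p) \<and>
          - prR y = bdE d' \<and> prL y = \<Phi> d' + bdC (Suc p) c'"
      proof (cases p)
        case 0
        have pr0: "prR y = 0" using prRB[OF y(1)] 0 by simp
        have "Poly_Mapping.keys (prL y) \<subseteq> C 0" using L 0 by simp
        from ac0[OF this] obtain d' c' where dc: "Poly_Mapping.keys d' \<subseteq> E 0" "Poly_Mapping.keys c' \<subseteq> C 1"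
          "prL y = \<Phi> d' + bdC 1 c'" by (elim exE conjE)
        have "- prR y = bdE d'" using bdE0[OF dc(1)] pr0 by simp
        with dc show ?thesis unfolding 0 One_nat_def by (intro exI[of _ d'] exI[of _ c'] conjI)
      next
        case (Suc q)
        have R: "Poly_Mapping.keys (- prR y) \<subseteq> E q" using prRB[OF y(1)] Suc by simp
        have "prL (bd p y) = 0" "prR (bd p y) = 0" using y(2) by simp_all
        then have "bdC p (prL y) + \<Phi> (prR y) = 0" "bdE (prR y) = 0"
          by (simp_all add: bd_def dif Suc)
        moreover have mm: "\<Phi> (- prR y) = - \<Phi> (prR y)" "bdE (- prR y) = - bdE (prR y)"
          using diffP[of 0 "prR y"] diffE[of 0 "prR y"] by simp_all
        ultimately have 1: "bdC (Suc q) (prL y) = \<Phi> (- prR y)" and 2: "bdE (- prR y) = 0"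
          unfolding mm by (simp_all only: Suc eq_neg_iff_add_eq_0 minus_zero)
        have L': "Poly_Mapping.keys (prL y) \<subseteq> C (Suc q)" using L Suc by simp
        show ?thesis using acS[OF L' R 2 1] unfolding Suc .
      qed
      then obtain d' c' where *: "Poly_Mapping.keys d' \<subseteq> E p" "Poly_Mapping.keys c' \<subseteq> C (Suc p)"
         "- prR y = bdE d'" "prL y = \<Phi> d' + bdC (Suc p) c'" by blast
      have prs: "prL (inL c' + inR d') = c'" "prR (inL c' + inR d') = d'" by (simp_all add: addi)
      have "bd (Suc p) (inL c' + inR d') = inL (prL y) + inR (prR y)"
        unfolding bd_def prs using *(3)[symmetric] *(4) dif(2)[of 0 "prR y"] by (simp add: add.commute)
      moreover have "Poly_Mapping.keys (inL c' + inR d') \<subseteq> B (Suc p)"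
        using * by (intro keys_add_subset kinR) (auto simp: kin B_def)
      ultimately show ?thesis using split[of y] by metis
    qed
  qed blast
  then obtain s where s: "\<And>p b. b \<in> B p \<Longrightarrow> Poly_Mapping.keys (s p b) \<subseteq> B (Suc p)"
      and sbd: "\<And>p x. Poly_Mapping.keys x \<subseteq> B p \<Longrightarrow>
             bd (Suc p) (frag_extend (s p) x) + frag_extend (s (p - 1)) (bd p x) = x" by blast
  \<comment> \<open>These are matrix entries of the contraction: from C to E the homotopy inverse,
    from C to C and from E to E the two homotopies. The sign in \<open>k\<close> cancels the one in
    \<open>bd\<close>.\<close>
  define \<psi> where "\<psi> p c = prR (s p (Inl c))" for p c
  define h where "h p c = prL (s p (Inl c))" for p c
  define k where "k p e = - prR (s (Suc p) (Inr e))" for p e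
  have sL: "frag_extend (s p) (inL x) = inL (frag_extend (h p) x) + inR (frag_extend (\<psi> p) x)" for p x
  proof (rule frag_additive_eqI[OF subset_UNIV, where f = "\<lambda>y. frag_extend (s p) (inL y)" and g = "\<lambda>y. inL (frag_extend (h p) y) + inR (frag_extend (\<psi> p) y)"])
    show "frag_extend (s p) (inL (frag_of c)) = inL (frag_extend (h p) (frag_of c)) + inR (frag_extend (\<psi> p) (frag_of c))" for c
    proof -
      have "frag_extend (s p) (inL (frag_of c)) = s p (Inl c)" by (simp add: inL_def)
      then show ?thesis using split[of "s p (Inl c)"] by (simp add: h_def \<psi>_def)
    qed
  qed (auto simp: dif frag_extend_diff)
  have sR: "prR (frag_extend (s (Suc p)) (inR x)) = - frag_extend (k p) x" for p x
    by (rule frag_additive_eqI[OF subset_UNIV, where f = "\<lambda>y. prR (frag_extend (s (Suc p)) (inR y))" and g = "\<lambda>y. - frag_extend (k p) y"]) (auto simp: dif frag_extend_diff k_def inR_def)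
  have LB: "Poly_Mapping.keys (inL x) \<subseteq> B p" if "Poly_Mapping.keys x \<subseteq> C p" for x p
    using that by (auto simp: kin B_def)
  have RB: "Poly_Mapping.keys (inR x) \<subseteq> B (Suc p)" if "Poly_Mapping.keys x \<subseteq> E p" for x p
    using that by (intro kinR) (auto simp: B_def)
  have sB: "Poly_Mapping.keys (frag_extend (s p) x) \<subseteq> B (Suc p)" if "Poly_Mapping.keys x \<subseteq> B p" for x p
    using that s by (rule keys_frag_extend_subset)
  show thesis
  proof
    fix p
    show "Poly_Mapping.keys (frag_extend (\<psi> p) x) \<subseteq> E p" if "Poly_Mapping.keys x \<subseteq> C p" for x
      using prRB[OF sB[OF LB[OF that]]] by (simp add: sL addi)
    show "Poly_Mapping.keys (frag_extend (h p) x) \<subseteq> C (Suc p)" if "Poly_Mapping.keys x \<subseteq> C p" for x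
      using prLB[OF sB[OF LB[OF that]]] by (simp add: sL addi)
    show "Poly_Mapping.keys (frag_extend (k p) x) \<subseteq> E (Suc p)" if "Poly_Mapping.keys x \<subseteq> E p" for x
      using prRB[OF sB[OF RB[OF that]]] by (simp add: sR)
    have main: "inL (bdC (Suc p) (frag_extend (h p) x) + \<Phi> (frag_extend (\<psi> p) x)) - inR (bdE (frag_extend (\<psi> p) x))
      + (inL (frag_extend (h (p-1)) (bdC p x)) + inR (frag_extend (\<psi> (p-1)) (bdC p x))) = inL x"
      if "Poly_Mapping.keys x \<subseteq> C p" for x
    proof -
      have "bd p (inL x) = inL (bdC p x)" by (cases p) (simp_all add: bd_def)
      moreover have "bd (Suc p) (inL y + inR z) = inL (bdC (Suc p) y + \<Phi> z) - inR (bdE z)" for y z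
        by (simp add: bd_def addi)
      ultimately show ?thesis using sbd[OF LB[OF that]] by (simp only: sL)
    qed
    show "bdE (frag_extend (\<psi> p) x) = frag_extend (\<psi> (p - 1)) (bdC p x)" if "Poly_Mapping.keys x \<subseteq> C p" for x
      using arg_cong[OF main[OF that], of prR] by (simp only: addi dif prin) simp
    show "bdC (Suc p) (frag_extend (h p) x) + frag_extend (h (p - 1)) (bdC p x) = x - \<Phi> (frag_extend (\<psi> p) x)"
      if "Poly_Mapping.keys x \<subseteq> C p" for x
      using arg_cong[OF main[OF that], of prL] by (simp only: addi dif prin) (simp add: algebra_simps)
    show "bdE (frag_extend (k p) x) + frag_extend (k (p - 1)) (bdE x) = x - frag_extend (\<psi> p) (\<Phi> x)"
      if x: "Poly_Mapping.keys x \<subseteq> E p" for x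
    proof -
      have "prR (bd (Suc (Suc p)) (frag_extend (s (Suc p)) (inR x)) + frag_extend (s p) (bd (Suc p) (inR x))) = x"
        using sbd[OF RB[OF x]] by simp
      moreover have bdR: "bd (Suc p) (inR x) = inL (\<Phi> x) - inR (bdE x)" by (simp add: bd_def)
      ultimately have "- bdE (- frag_extend (k p) x) + (frag_extend (\<psi> p) (\<Phi> x) - prR (frag_extend (s p) (inR (bdE x)))) = x"
        by (simp add: addi bdR sR sL dif frag_extend_diff bd_def[of "Suc (Suc p)"])
      \<comment> \<open>For p = 0 the index p - 1 is truncated to 0, which is harmless since the
        boundary of x is then zero.\<close>
      moreover have "prR (frag_extend (s p) (inR (bdE x))) = - frag_extend (k (p - 1)) (bdE x)"
      proof (cases p)
        case 0
        then have "bdE x = 0" using bdE0[of x] x by simp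
        then show ?thesis by (simp only: zer frag_extend_0 minus_zero)
      next
        case (Suc q)
        then show ?thesis using sR[of q "bdE x"] by simp
      qed
      moreover have "bdE (- frag_extend (k p) x) = - bdE (frag_extend (k p) x)"
        using diffE[of 0 "frag_extend (k p) x"] by simp
      ultimately have "bdE (frag_extend (k p) x) + (frag_extend (\<psi> p) (\<Phi> x) + frag_extend (k (p - 1)) (bdE x)) = x"
        by (simp only: minus_minus diff_minus_eq_add)
      then show ?thesis by (metis add.assoc add.commute add_diff_cancel_left')
    qed
  qed
qed

section \<open>Singular chains\<close>

text \<open>The target is the free abelian group on one generator instead of the integers, so that
  the augmentation is itself a \<open>frag_extend\<close> and inherits its algebra.\<close>

definition augmentation :: "('a \<Rightarrow>\<^sub>0 int) \<Rightarrow> (unit \<Rightarrow>\<^sub>0 int)" where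
  "augmentation = frag_extend (\<lambda>_. frag_of ())"

lemma augmentation_simps [simp]:
  "augmentation 0 = 0" "augmentation (frag_of x) = frag_of ()"
  "augmentation (a - b) = augmentation a - augmentation b"
  "augmentation (a + b) = augmentation a + augmentation b"
  "augmentation (- a) = - augmentation a"
  "augmentation (frag_cmul n a) = frag_cmul n (augmentation a)"
  by (simp_all add: augmentation_def frag_extend_diff frag_extend_add frag_extend_minus frag_extend_cmul)

lemma augmentation_chain_boundary: "augmentation (chain_boundary (Suc 0) c) = 0"
proof (rule frag_additive_eqI[OF subset_UNIV,
    where f = "\<lambda>c. augmentation (chain_boundary (Suc 0) c)" and g = "\<lambda>_. 0"])
qed (auto simp: chain_boundary_diff chain_boundary_of)

lemma unit_frag_eq: "(x :: unit \<Rightarrow>\<^sub>0 int) = frag_cmul (Poly_Mapping.lookup x ()) (frag_of ())"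
  by (rule poly_mapping_eqI) (simp add: lookup_single)

lemma singular_chain_Int:
  assumes "singular_chain p (subtopology X U) c" "singular_chain p (subtopology X V) c"
  shows "singular_chain p (subtopology X (U \<inter> V)) c"
  using assms by (auto simp: singular_chain_subtopology)

text \<open>Iterated subdivision makes every simplex small enough to lie in U or in V, so the
  subdivided chain splits. The natural homotopy h from subdivision to the identity stays inside any
  subspace; hence h(bd c) = h(u) + h(v) splits as well and corrects the two summands, while h(c)
  accounts for the boundary term. The last hypothesis covers degree 0, where p - 1 is
  truncated.\<close>

lemma singular_chain_Un_decompose:
  assumes U: "openin X U" and V: "openin X V"
    and c: "singular_chain p (subtopology X (U \<union> V)) c"
    and bd: "chain_boundary p c = u + v"
    and u: "singular_chain (p - Suc 0) (subtopology X U) u"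
    and v: "singular_chain (p - Suc 0) (subtopology X V) v"
    and uv0: "p = 0 \<Longrightarrow> u = 0 \<and> v = 0"
  obtains a b e where "singular_chain p (subtopology X U) a" "singular_chain p (subtopology X V) b"
    "singular_chain (Suc p) (subtopology X (U \<union> V)) e" "c = a + b + chain_boundary (Suc p) e"
proof -
  let ?Y = "subtopology X (U \<union> V)"
  have opn: "openin ?Y W" if "W \<in> {U, V}" for W
    using that U V by (auto simp: openin_subtopology)
  have top: "topspace ?Y \<subseteq> \<Union>{U, V}" by auto
  obtain n where n: "\<And>m f. n \<le> m \<Longrightarrow> f \<in> Poly_Mapping.keys ((singular_subdivision p ^^ m) c) \<Longrightarrow>
      \<exists>W\<in>{U, V}. f \<in> standard_simplex p \<rightarrow> W"
    using sufficient_iterated_singular_subdivision_exists[OF opn top c] by metis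
  let ?c = "(singular_subdivision p ^^ n) c"
  have c': "singular_chain p ?Y ?c"
    by (induction n) (auto simp: singular_chain_singular_subdivision c)
  have "Poly_Mapping.keys ?c \<subseteq> singular_simplex_set p (subtopology X U) \<union> singular_simplex_set p (subtopology X V)"
  proof
    fix f assume f: "f \<in> Poly_Mapping.keys ?c"
    then have "singular_simplex p ?Y f" using c' by (auto simp: singular_chain_def)
    moreover obtain W where W: "W \<in> {U, V}" "f \<in> standard_simplex p \<rightarrow> W" using n[OF order_refl f] by blast
    ultimately have "singular_simplex p (subtopology X W) f"
      by (auto simp: singular_simplex_subtopology)
    with W show "f \<in> singular_simplex_set p (subtopology X U) \<union> singular_simplex_set p (subtopology X V)" by blast
  qed
  then obtain a b where ab: "singular_chain p (subtopology X U) a" "singular_chain p (subtopology X V) b" "a + b = ?c"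
    unfolding singular_chain_def using frag_split by metis
  obtain h where h: "\<And>p. h p 0 = (0 :: 'a chain)"
        "\<And>p c1 c2. h p (c1-c2) = h p c1 - h p c2"
        "\<And>p X c. singular_chain p X c \<Longrightarrow> singular_chain (Suc p) X (h p c)"
        "\<And>p X c. singular_chain p X c
                 \<Longrightarrow> chain_boundary (Suc p) (h p c) + h (p - Suc 0) (chain_boundary p c)
                   = (singular_subdivision p ^^ n) c - c"
    using chain_homotopic_iterated_singular_subdivision by blast
  have hminus: "h p (- c) = - h p c" for p c using h(2)[of p 0 c] h(1) by simp
  let ?q = "p - Suc 0"
  have hadd: "h ?q (u + v) = h ?q u + h ?q v" using h(2)[of ?q u "- v"] by (simp add: hminus)
  have hu: "singular_chain p (subtopology X U) (h ?q u)" "singular_chain p (subtopology X V) (h ?q v)"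
  proof -
    show "singular_chain p (subtopology X U) (h ?q u)" "singular_chain p (subtopology X V) (h ?q v)"
      using h(3)[OF u] h(3)[OF v] h(1) uv0 by (cases p; simp)+
  qed
  show thesis
  proof
    show "singular_chain p (subtopology X U) (a - h ?q u)" "singular_chain p (subtopology X V) (b - h ?q v)"
      using ab hu by (simp_all add: singular_chain_diff)
    show "singular_chain (Suc p) (subtopology X (U \<union> V)) (- h p c)"
      using h(3)[OF c] by (simp add: singular_chain_minus)
    have "c = ?c - (chain_boundary (Suc p) (h p c) + h ?q (chain_boundary p c))"
      using h(4)[OF c] by simp
    also have "\<dots> = (a + b) - (chain_boundary (Suc p) (h p c) + (h ?q u + h ?q v))"
      by (simp add: ab bd hadd)
    also have "\<dots> = a - h ?q u + (b - h ?q v) + chain_boundary (Suc p) (- h p c)"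
      by (simp add: chain_boundary_minus)
    finally show "c = a - h ?q u + (b - h ?q v) + chain_boundary (Suc p) (- h p c)" .
  qed
qed

text \<open>The contraction makes c homologous to its image under a constant map, a cycle in a
  one-point space. Such a cycle bounds in positive degree; in degree 0 it is a single simplex
  multiplied by the augmentation of c.\<close>

lemma contractible_space_imp_homologous:
  assumes X: "contractible_space X" and c: "singular_chain p X c" "chain_boundary p c = 0"
    and p: "p = 0 \<Longrightarrow> augmentation c = 0"
  obtains e where "singular_chain (Suc p) X e" "chain_boundary (Suc p) e = c"
proof -
  obtain a where hom: "homotopic_with (\<lambda>x. True) X X id (\<lambda>x. a)"
    using X by (auto simp: contractible_space_def)
  have cyc: "singular_relcycle p X {} c" using c by (simp add: singular_cycle)
  show thesis
  proof (cases "c = 0")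
    case True
    then show thesis using that[of 0] by simp
  next
    case False
    then have "topspace X \<noteq> {}" using c(1) singular_chain_empty by blast
    then have a: "a \<in> topspace X"
      using homotopic_with_imp_continuous_maps[OF hom] by (auto simp: continuous_map_def)
    let ?k = "chain_map p (\<lambda>x. a) c"
    have "homotopic_with (\<lambda>h. h \<in> {} \<rightarrow> {}) X X id (\<lambda>x. a)" using hom by simp
    from homotopic_imp_homologous_rel_chain_maps[OF this cyc]
    have 1: "singular_relboundary p X {} (c - ?k)"
      using chain_map_ident[OF c(1)] by (simp add: homologous_rel_def)
    let ?A = "subtopology X {a}"
    have tA: "topspace ?A = {a}" using a by auto
    have "continuous_map X ?A (\<lambda>x. a)" using a by (auto simp: continuous_map_in_subtopology)
    then have k: "singular_relcycle p ?A {} ?k"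
      using singular_relcycle_chain_map[OF cyc] by fastforce
    have "singular_relboundary p ?A {} ?k"
    proof (cases "p = 0")
      case True
      have "?k = frag_cmul (Poly_Mapping.lookup (augmentation c) ()) (frag_of (restrict (\<lambda>x. a) (standard_simplex 0)))"
        unfolding True
        by (rule frag_additive_eqI[OF subset_UNIV, where f = "chain_map 0 (\<lambda>x. a)" and
              g = "\<lambda>c. frag_cmul (Poly_Mapping.lookup (augmentation c) ()) (frag_of (restrict (\<lambda>x. a) (standard_simplex 0)))"])
          (auto simp: chain_map_diff lookup_minus frag_cmul_diff_distrib simplex_map_def o_def)
      then show ?thesis using p[OF True] by simp
    next
      case False
      then show ?thesis using singular_boundary_eq_cycle_singleton[OF tA] k by simp
    qed
    then have "singular_relboundary p X {} ?k"
      using singular_boundary_mono[of "{a}" UNIV p X] by (simp add: subtopology_UNIV)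
    from singular_relboundary_add[OF 1 this] have "singular_relboundary p X {} c" by simp
    then show thesis using that by (auto simp: singular_boundary)
  qed
qed

section \<open>Cells of the cube\<close>

text \<open>On the cell \<open>(\<sigma>, \<epsilon>)\<close> the coordinates in \<open>\<sigma>\<close> are free, those in \<open>\<epsilon>\<close> are \<open>1\<close> and the others are \<open>0\<close>.\<close>

type_synonym cell = "nat set \<times> nat set"

text \<open>This is the sign occurring in \<open>simplicial_boundary\<close>, so that the boundaries
  of cubes and of simplices can be compared term by term.\<close>

definition position_sign :: "nat set \<Rightarrow> nat \<Rightarrow> int" where
  "position_sign \<sigma> i = (-1) ^ card {u \<in> \<sigma>. u < i}"

lemma position_sign_sq [simp]: "position_sign \<sigma> i * position_sign \<sigma> i = 1"
  by (simp add: position_sign_def flip: power_mult_distrib)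

text \<open>Removing the smaller index shifts the position of the larger one by one; removing the
  larger index leaves the position of the smaller one alone.\<close>

lemma position_sign_swap:
  assumes "finite \<sigma>" "i \<in> \<sigma>" "j \<in> \<sigma>" "i \<noteq> j"
  shows "position_sign \<sigma> i * position_sign (\<sigma> - {i}) j = - (position_sign \<sigma> j * position_sign (\<sigma> - {j}) i)"
proof -
  have *: "position_sign \<sigma> i * position_sign (\<sigma> - {i}) j = - (position_sign \<sigma> j * position_sign (\<sigma> - {j}) i)"
    if "i < j" "i \<in> \<sigma>" for i j
  proof -
    have "{u \<in> \<sigma>. u < j} = insert i {u \<in> \<sigma> - {i}. u < j}" using that by auto
    then have "card {u \<in> \<sigma>. u < j} = Suc (card {u \<in> \<sigma> - {i}. u < j})" using assms(1) by simp
    moreover have "{u \<in> \<sigma> - {j}. u < i} = {u \<in> \<sigma>. u < i}" using that by auto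
    ultimately show ?thesis by (simp add: position_sign_def)
  qed
  show ?thesis using *[of i j] *[of j i] assms by (cases "i < j") auto
qed

lemma self_negative_frag_0: "(x :: 'a \<Rightarrow>\<^sub>0 int) = - x \<Longrightarrow> x = 0"
proof (rule poly_mapping_eqI)
  fix k assume "x = - x"
  then have "Poly_Mapping.lookup x k = - Poly_Mapping.lookup x k" by (metis lookup_uminus)
  then show "Poly_Mapping.lookup x k = Poly_Mapping.lookup 0 k" by simp
qed

text \<open>Exchanging i and j reverses every sign, so the sum is its own negative, and free groups
  have no 2-torsion. That the boundary squares to zero is an instance of this both for cubes and for
  simplices.\<close>

lemma alternating_double_sum_0:
  fixes F :: "nat \<Rightarrow> nat \<Rightarrow> ('a \<Rightarrow>\<^sub>0 int)"
  assumes "finite \<sigma>" and sym: "\<And>i j. i \<in> \<sigma> \<Longrightarrow> j \<in> \<sigma> \<Longrightarrow> i \<noteq> j \<Longrightarrow> F i j = F j i"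
  shows "(\<Sum>i\<in>\<sigma>. frag_cmul (position_sign \<sigma> i) (\<Sum>j\<in>\<sigma> - {i}. frag_cmul (position_sign (\<sigma> - {i}) j) (F i j))) = 0"
    (is "?S = 0")
proof (rule self_negative_frag_0)
  let ?t = "\<lambda>i j. frag_cmul (position_sign \<sigma> i * position_sign (\<sigma> - {i}) j) (F i j)"
  have S: "?S = (\<Sum>i\<in>\<sigma>. \<Sum>j\<in>\<sigma>. if i = j then 0 else ?t i j)"
  proof (rule sum.cong[OF refl])
    fix i assume "i \<in> \<sigma>"
    have "(\<Sum>j\<in>\<sigma>. if i = j then 0 else ?t i j) = (\<Sum>j\<in>\<sigma> - {i}. ?t i j)"
      using assms(1) by (intro sum.mono_neutral_cong_right) auto
    then show "frag_cmul (position_sign \<sigma> i) (\<Sum>j\<in>\<sigma> - {i}. frag_cmul (position_sign (\<sigma> - {i}) j) (F i j))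
       = (\<Sum>j\<in>\<sigma>. if i = j then 0 else ?t i j)" by (simp add: frag_cmul_sum)
  qed
  also have "\<dots> = (\<Sum>j\<in>\<sigma>. \<Sum>i\<in>\<sigma>. if i = j then 0 else ?t i j)" by (rule sum.swap)
  also have "\<dots> = (\<Sum>j\<in>\<sigma>. \<Sum>i\<in>\<sigma>. - (if j = i then 0 else ?t j i))"
  proof (intro sum.cong refl)
    fix i j assume "i \<in> \<sigma>" "j \<in> \<sigma>"
    then show "(if i = j then 0 else ?t i j) = - (if j = i then 0 else ?t j i)"
      using position_sign_swap[OF assms(1), of i j] sym[of i j] by simp
  qed
  also have "\<dots> = - ?S" unfolding S by (simp only: sum_negf)
  finally show "?S = - ?S" .
qed

lemma frag_cmul_diff: "frag_cmul n (a - b) = frag_cmul n a - frag_cmul n b"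
  by (rule poly_mapping_eqI) (simp add: lookup_minus right_diff_distrib)

text \<open>The cellular boundary of a product of intervals: in each free direction, the facet at
  coordinate 1 minus the facet at coordinate 0.\<close>

definition cube_boundary :: "(cell \<Rightarrow>\<^sub>0 int) \<Rightarrow> (cell \<Rightarrow>\<^sub>0 int)" where
  "cube_boundary = frag_extend (\<lambda>(\<sigma>, \<epsilon>). \<Sum>i\<in>\<sigma>. frag_cmul (position_sign \<sigma> i)
     (frag_of (\<sigma> - {i}, insert i \<epsilon>) - frag_of (\<sigma> - {i}, \<epsilon>)))"

lemma cube_boundary_of:
  "cube_boundary (frag_of (\<sigma>, \<epsilon>)) = (\<Sum>i\<in>\<sigma>. frag_cmul (position_sign \<sigma> i)
     (frag_of (\<sigma> - {i}, insert i \<epsilon>) - frag_of (\<sigma> - {i}, \<epsilon>)))"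
  by (simp add: cube_boundary_def)

lemma cube_boundary_simps [simp]:
  "cube_boundary 0 = 0"
  "cube_boundary (a - b) = cube_boundary a - cube_boundary b"
  "cube_boundary (a + b) = cube_boundary a + cube_boundary b"
  "cube_boundary (- a) = - cube_boundary a"
  "cube_boundary (frag_cmul n a) = frag_cmul n (cube_boundary a)"
  by (simp_all add: cube_boundary_def frag_extend_diff frag_extend_add frag_extend_minus frag_extend_cmul)

lemma cube_boundary_sum: "finite S \<Longrightarrow> cube_boundary (sum f S) = (\<Sum>x\<in>S. cube_boundary (f x))"
  by (simp add: cube_boundary_def frag_extend_sum o_def)

lemma cube_boundary_boundary:
  assumes "\<And>c. c \<in> Poly_Mapping.keys x \<Longrightarrow> finite (fst c)"
  shows "cube_boundary (cube_boundary x) = 0"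
proof (rule frag_additive_eqI[where S = "{c. finite (fst c)}" and f = "\<lambda>x. cube_boundary (cube_boundary x)" and g = "\<lambda>_. 0"])
  fix c :: cell assume "c \<in> {c. finite (fst c)}"
  then obtain \<sigma> \<epsilon> where c: "c = (\<sigma>, \<epsilon>)" and fin: "finite \<sigma>" by (cases c) auto
  \<comment> \<open>The signed sum of the four faces of codimension 2 obtained by fixing the
    coordinates i and j; it is symmetric in i and j.\<close>
  define F where "F i j = frag_of (\<sigma> - {i} - {j}, insert j (insert i \<epsilon>)) - frag_of (\<sigma> - {i} - {j}, insert i \<epsilon>)
     - (frag_of (\<sigma> - {i} - {j}, insert j \<epsilon>) - frag_of (\<sigma> - {i} - {j}, \<epsilon>))" for i j
  have "cube_boundary (cube_boundary (frag_of c)) =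
    (\<Sum>i\<in>\<sigma>. frag_cmul (position_sign \<sigma> i) (\<Sum>j\<in>\<sigma> - {i}. frag_cmul (position_sign (\<sigma> - {i}) j) (F i j)))"
  proof -
    have "cube_boundary (frag_of (\<sigma> - {i}, insert i \<epsilon>)) - cube_boundary (frag_of (\<sigma> - {i}, \<epsilon>)) =
      (\<Sum>j\<in>\<sigma> - {i}. frag_cmul (position_sign (\<sigma> - {i}) j) (F i j))" for i
      unfolding cube_boundary_of F_def sum_subtractf[symmetric]
      by (rule sum.cong[OF refl]) (simp only: frag_cmul_diff)
    then show ?thesis by (simp add: c cube_boundary_of[of \<sigma>] cube_boundary_sum fin)
  qed
  also have "\<dots> = 0"
  proof (rule alternating_double_sum_0[OF fin])
    fix i j assume "i \<in> \<sigma>" "j \<in> \<sigma>" "i \<noteq> j"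
    have "\<sigma> - {i} - {j} = \<sigma> - {j} - {i}" "insert j (insert i \<epsilon>) = insert i (insert j \<epsilon>)" by auto
    then show "F i j = F j i" by (simp add: F_def)
  qed
  finally show "cube_boundary (cube_boundary (frag_of c)) = 0" .
qed (use assms in auto)

lemma augmentation_cube_boundary:
  assumes "Poly_Mapping.keys x \<subseteq> {c. card (fst c) = Suc 0}"
  shows "augmentation (cube_boundary x) = 0"
proof (rule frag_additive_eqI[OF assms, where f = "\<lambda>x. augmentation (cube_boundary x)" and g = "\<lambda>_. 0"])
  fix c :: cell assume "c \<in> {c. card (fst c) = Suc 0}"
  then obtain i \<epsilon> where "c = ({i}, \<epsilon>)" by (cases c) (auto simp: card_1_singleton_iff)
  then show "augmentation (cube_boundary (frag_of c)) = 0" by (simp add: cube_boundary_of)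
qed auto

text \<open>Faces of every codimension. A face may fix free coordinates of \<open>c\<close> at
  either value but must agree with \<open>c\<close> off \<open>fst c\<close>, which is the condition
  on \<delta>.\<close>

definition faces :: "cell \<Rightarrow> cell set" where
  "faces c = {(\<tau>, \<delta>). \<tau> \<subseteq> fst c \<and> \<delta> \<inter> \<tau> = {} \<and> \<delta> - fst c = snd c}"

lemma keys_cube_boundary:
  assumes "Poly_Mapping.keys x \<subseteq> {c. card (fst c) = Suc p} \<inter> A" "\<And>c. c \<in> A \<Longrightarrow> faces c \<subseteq> A"
    "\<And>c. c \<in> A \<Longrightarrow> fst c \<inter> snd c = {}"
  shows "Poly_Mapping.keys (cube_boundary x) \<subseteq> {c. card (fst c) = p} \<inter> A"
  unfolding cube_boundary_def
proof (rule keys_frag_extend_subset[OF assms(1)])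
  fix c assume c: "c \<in> {c. card (fst c) = Suc p} \<inter> A"
  obtain \<sigma> \<epsilon> where ce: "c = (\<sigma>, \<epsilon>)" by (cases c)
  have "finite \<sigma>" using c by (intro card_ge_0_finite) (simp add: ce)
  have "(\<sigma> - {i}, \<delta>) \<in> {c. card (fst c) = p} \<inter> A" if i: "i \<in> \<sigma>" and \<delta>: "\<delta> = \<epsilon> \<or> \<delta> = insert i \<epsilon>" for i \<delta>
  proof -
    have "\<sigma> \<inter> \<epsilon> = {}" using assms(3)[of c] c by (simp add: ce)
    then have "(\<sigma> - {i}, \<delta>) \<in> faces c" using i \<delta> unfolding ce faces_def by force
    moreover have "card (\<sigma> - {i}) = p" using c i \<open>finite \<sigma>\<close> by (simp add: ce)
    ultimately show ?thesis using assms(2)[of c] c by auto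
  qed
  then show "Poly_Mapping.keys (case c of (\<sigma>, \<epsilon>) \<Rightarrow> \<Sum>i\<in>\<sigma>. frag_cmul (position_sign \<sigma> i)
     (frag_of (\<sigma> - {i}, insert i \<epsilon>) - frag_of (\<sigma> - {i}, \<epsilon>))) \<subseteq> {c. card (fst c) = p} \<inter> A"
    unfolding ce prod.case
    by (intro order_trans[OF keys_sum] UN_least order_trans[OF keys_cmul] keys_diff_subset) auto
qed

lemma faces_iff:
  "d \<in> faces c \<longleftrightarrow> fst d \<subseteq> fst c \<and> snd d \<inter> fst d = {} \<and> snd d - fst c = snd c"
  by (simp add: faces_def case_prod_beta)

lemma faces_trans: "d \<in> faces c \<Longrightarrow> faces d \<subseteq> faces c"
proof
  fix e assume de: "d \<in> faces c" "e \<in> faces d"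
  have "fst e \<subseteq> fst c" "snd e \<inter> fst e = {}" using de unfolding faces_iff by blast+
  moreover have "snd e - fst c = (snd e - fst d) - fst c" using de unfolding faces_iff by blast
  then have "snd e - fst c = snd c" using de unfolding faces_iff by simp
  ultimately show "e \<in> faces c" unfolding faces_iff by blast
qed

lemma faces_refl: "fst c \<inter> snd c = {} \<Longrightarrow> c \<in> faces c"
  unfolding faces_iff by blast

text \<open>Contracting the smallest coordinate keeps all signs in the homotopy equal.\<close>

lemma cube_acyclic:
  assumes "finite \<sigma>" "\<sigma> \<inter> \<epsilon> = {}"
    and "Poly_Mapping.keys z \<subseteq> {c. card (fst c) = p} \<inter> faces (\<sigma>, \<epsilon>)"
    and "cube_boundary z = 0" and "p = 0 \<Longrightarrow> augmentation z = 0"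
  shows "\<exists>x. Poly_Mapping.keys x \<subseteq> {c. card (fst c) = Suc p} \<inter> faces (\<sigma>, \<epsilon>) \<and> cube_boundary x = z"
  using assms
proof (induction \<sigma> arbitrary: z rule: finite_linorder_min_induct)
  case empty
  have sub: "faces ({}, \<epsilon>) \<subseteq> {({}, \<epsilon>)}" by (auto simp: faces_def)
  have "z = 0"
  proof (cases p)
    case 0
    have "augmentation z = frag_cmul (Poly_Mapping.lookup z ({}, \<epsilon>)) (frag_of ())"
    proof (rule frag_additive_eqI[where S = "{({}, \<epsilon>)}" and f = augmentation and
        g = "\<lambda>z. frag_cmul (Poly_Mapping.lookup z ({}, \<epsilon>)) (frag_of ())"])
      show "Poly_Mapping.keys z \<subseteq> {({}, \<epsilon>)}" using empty.prems(2) sub by auto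
    qed (auto simp: lookup_minus frag_cmul_diff_distrib)
    then have "Poly_Mapping.lookup z ({}, \<epsilon>) = 0" using empty.prems(4) 0 by simp
    then have "({}, \<epsilon>) \<notin> Poly_Mapping.keys z" by (simp add: in_keys_iff)
    then have "Poly_Mapping.keys z = {}" using empty.prems(2) sub by blast
    then show ?thesis by simp
  next
    case (Suc q)
    have "c \<notin> Poly_Mapping.keys z" for c
    proof
      assume "c \<in> Poly_Mapping.keys z"
      then have c: "c \<in> faces ({}, \<epsilon>)" "card (fst c) = p" using empty.prems(2) by blast+
      then have "c = ({}, \<epsilon>)" using sub by blast
      then show False using c(2) Suc by simp
    qed
    then have "Poly_Mapping.keys z = {}" by blast
    then show ?thesis by simp
  qed
  then show ?case by (intro exI[of _ 0]) simp
next
  case (insert i \<sigma>)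
  let ?F = "faces (insert i \<sigma>, \<epsilon>)"
  have i: "i \<notin> \<sigma>" "i \<notin> \<epsilon>" using insert.hyps(2) insert.prems(1) by auto
  have dis: "fst c \<inter> snd c = {}" if "c \<in> ?F" for c using that unfolding faces_iff by blast
  have finF: "finite (fst c)" if "c \<in> ?F" for c
    using that insert.hyps(1) finite_subset[of "fst c" "insert i \<sigma>"] unfolding faces_iff by simp
  \<comment> \<open>\<open>s\<close> sweeps a cell lying at i-th coordinate 1 along the i-th
    direction, and \<pi> is the projection onto the facet at i-th coordinate 0, which kills the
    cells extended in that direction. They satisfy the homotopy formula between \<pi> and the
    identity.\<close>
  define s :: "(cell \<Rightarrow>\<^sub>0 int) \<Rightarrow> (cell \<Rightarrow>\<^sub>0 int)" where
    "s = frag_extend (\<lambda>(\<tau>, \<delta>). if i \<in> \<delta> then frag_of (insert i \<tau>, \<delta> - {i}) else 0)"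
  define \<pi> :: "(cell \<Rightarrow>\<^sub>0 int) \<Rightarrow> (cell \<Rightarrow>\<^sub>0 int)" where
    "\<pi> = frag_extend (\<lambda>(\<tau>, \<delta>). if i \<in> \<tau> then 0 else frag_of (\<tau>, \<delta> - {i}))"
  have sdiff: "s (a - b) = s a - s b" and pdiff: "\<pi> (a - b) = \<pi> a - \<pi> b" for a b
    by (simp_all add: s_def \<pi>_def frag_extend_diff)
  have ssum: "finite S \<Longrightarrow> s (sum f S) = (\<Sum>x\<in>S. s (f x))" for S :: "nat set" and f
    by (simp add: s_def frag_extend_sum o_def)
  have scm: "s (frag_cmul n a) = frag_cmul n (s a)" for n a by (simp add: s_def frag_extend_cmul)
  have sof: "s (frag_of (\<tau>, \<delta>)) = (if i \<in> \<delta> then frag_of (insert i \<tau>, \<delta> - {i}) else 0)" for \<tau> \<delta>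
    by (simp add: s_def)
  have pof: "\<pi> (frag_of (\<tau>, \<delta>)) = (if i \<in> \<tau> then 0 else frag_of (\<tau>, \<delta> - {i}))" for \<tau> \<delta>
    by (simp add: \<pi>_def)
  have homotopy: "cube_boundary (s x) + s (cube_boundary x) = x - \<pi> x" if x: "Poly_Mapping.keys x \<subseteq> ?F" for x
  proof (rule frag_additive_eqI[OF x, where f = "\<lambda>x. cube_boundary (s x) + s (cube_boundary x)" and g = "\<lambda>x. x - \<pi> x"])
    fix c assume c: "c \<in> ?F"
    obtain \<tau> \<delta> where ce: "c = (\<tau>, \<delta>)" by (cases c)
    have \<tau>: "\<tau> \<subseteq> insert i \<sigma>" "\<delta> \<inter> \<tau> = {}" "finite \<tau>"
      using c finF[OF c] by (auto simp: ce faces_def)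
    have less: "i < j" if "j \<in> \<tau>" "j \<noteq> i" for j using \<tau> that insert.hyps(2) by auto
    have sbd: "s (cube_boundary (frag_of c)) = (\<Sum>j\<in>\<tau>. frag_cmul (position_sign \<tau> j)
         ((if i \<in> insert j \<delta> then frag_of (insert i (\<tau> - {j}), insert j \<delta> - {i}) else 0)
           - (if i \<in> \<delta> then frag_of (insert i (\<tau> - {j}), \<delta> - {i}) else 0)))"
      by (simp add: ce cube_boundary_of ssum \<tau> scm sdiff sof)
    consider "i \<in> \<tau>" | "i \<notin> \<tau>" "i \<in> \<delta>" | "i \<notin> \<tau>" "i \<notin> \<delta>" by blast
    then show "cube_boundary (s (frag_of c)) + s (cube_boundary (frag_of c)) = frag_of c - \<pi> (frag_of c)"
    proof cases
      case 1
      then have "i \<notin> \<delta>" using \<tau> by auto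
      have min: "{u \<in> \<tau>. u < i} = {}" using less by force
      have ps: "position_sign \<tau> i = 1" unfolding position_sign_def min by simp
      have "s (cube_boundary (frag_of c)) = (\<Sum>j\<in>\<tau>. if j = i then frag_of c else 0)"
        unfolding sbd using 1 \<open>i \<notin> \<delta>\<close>
        by (intro sum.cong refl) (auto simp: ce ps insert_absorb)
      then show ?thesis using 1 \<open>i \<notin> \<delta>\<close> \<tau>(3) by (simp add: ce sof pof)
    next
      case 2
      have sg: "position_sign (insert i \<tau>) j = - position_sign \<tau> j" if "j \<in> \<tau>" for j
      proof -
        have "{u \<in> insert i \<tau>. u < j} = insert i {u \<in> \<tau>. u < j}" using less[OF that] that 2 by auto
        then show ?thesis using 2 \<tau>(3) by (simp add: position_sign_def)
      qed
      have min: "{u \<in> insert i \<tau>. u < i} = {}" using less 2 by force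
      have "cube_boundary (s (frag_of c)) = (\<Sum>j\<in>insert i \<tau>. frag_cmul (position_sign (insert i \<tau>) j)
          (frag_of (insert i \<tau> - {j}, insert j (\<delta> - {i})) - frag_of (insert i \<tau> - {j}, \<delta> - {i})))"
        using 2 by (simp add: ce sof cube_boundary_of)
      also have "\<dots> = frag_of (\<tau>, \<delta>) - frag_of (\<tau>, \<delta> - {i}) + (\<Sum>j\<in>\<tau>. frag_cmul (position_sign (insert i \<tau>) j)
          (frag_of (insert i \<tau> - {j}, insert j (\<delta> - {i})) - frag_of (insert i \<tau> - {j}, \<delta> - {i})))"
      proof -
        have "position_sign (insert i \<tau>) i = 1" unfolding position_sign_def min by simp
        moreover have "insert i \<tau> - {i} = \<tau>" "insert i (\<delta> - {i}) = \<delta>" using 2 by auto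
        ultimately show ?thesis by (simp only: sum.insert[OF \<tau>(3) 2(1)] frag_cmul_one)
      qed
      finally have bs: "cube_boundary (s (frag_of c)) = frag_of (\<tau>, \<delta>) - frag_of (\<tau>, \<delta> - {i}) + (\<Sum>j\<in>\<tau>. frag_cmul (position_sign (insert i \<tau>) j)
          (frag_of (insert i \<tau> - {j}, insert j (\<delta> - {i})) - frag_of (insert i \<tau> - {j}, \<delta> - {i})))" .
      have rest: "(\<Sum>j\<in>\<tau>. frag_cmul (position_sign (insert i \<tau>) j)
          (frag_of (insert i \<tau> - {j}, insert j (\<delta> - {i})) - frag_of (insert i \<tau> - {j}, \<delta> - {i})))
         = - s (cube_boundary (frag_of c))"
      proof -
        have *: "frag_cmul (position_sign (insert i \<tau>) j)
            (frag_of (insert i \<tau> - {j}, insert j (\<delta> - {i})) - frag_of (insert i \<tau> - {j}, \<delta> - {i})) =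
          - frag_cmul (position_sign \<tau> j)
         ((if i \<in> insert j \<delta> then frag_of (insert i (\<tau> - {j}), insert j \<delta> - {i}) else 0)
           - (if i \<in> \<delta> then frag_of (insert i (\<tau> - {j}), \<delta> - {i}) else 0))" if j: "j \<in> \<tau>" for j
        proof -
          have "insert i \<tau> - {j} = insert i (\<tau> - {j})" "insert j (\<delta> - {i}) = insert j \<delta> - {i}"
            using 2 j by auto
          then show ?thesis using 2 by (simp add: sg[OF j])
        qed
        show ?thesis unfolding sbd by (simp only: * sum_negf cong: sum.cong)
      qed
      show ?thesis using 2 unfolding bs rest by (simp add: ce pof)
    next
      case 3
      have "s (cube_boundary (frag_of c)) = 0"
        unfolding sbd using 3 by (intro sum.neutral) auto
      then show ?thesis using 3 by (simp add: ce sof pof)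
    qed
  qed (auto simp: sdiff pdiff)
  have z: "Poly_Mapping.keys z \<subseteq> {c. card (fst c) = p} \<inter> ?F" by (rule insert.prems(2))
  have sz: "Poly_Mapping.keys (s z) \<subseteq> {c. card (fst c) = Suc p} \<inter> ?F"
    unfolding s_def
  proof (rule keys_frag_extend_subset[OF z])
    fix c assume c: "c \<in> {c. card (fst c) = p} \<inter> ?F"
    then show "Poly_Mapping.keys (case c of (\<tau>, \<delta>) \<Rightarrow> if i \<in> \<delta> then frag_of (insert i \<tau>, \<delta> - {i}) else 0)
        \<subseteq> {c. card (fst c) = Suc p} \<inter> ?F"
      using finF[of c] i by (cases c) (auto simp: faces_def card_insert_if)
  qed
  have pz: "Poly_Mapping.keys (\<pi> z) \<subseteq> {c. card (fst c) = p} \<inter> faces (\<sigma>, \<epsilon>)"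
    unfolding \<pi>_def
  proof (rule keys_frag_extend_subset[OF z])
    fix c assume c: "c \<in> {c. card (fst c) = p} \<inter> ?F"
    then show "Poly_Mapping.keys (case c of (\<tau>, \<delta>) \<Rightarrow> if i \<in> \<tau> then 0 else frag_of (\<tau>, \<delta> - {i}))
        \<subseteq> {c. card (fst c) = p} \<inter> faces (\<sigma>, \<epsilon>)"
      using i by (cases c) (auto simp: faces_def)
  qed
  \<comment> \<open>A cycle z is thus homologous to its projection \<pi> z, which lives in a cube of
    one dimension less, where the induction hypothesis applies.\<close>
  have "cube_boundary (s z) = z - \<pi> z"
    using homotopy[of z] z insert.prems(3) by (simp add: s_def)
  then have \<pi>: "\<pi> z = z - cube_boundary (s z)" by simp
  have "cube_boundary (cube_boundary (s z)) = 0"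
    by (rule cube_boundary_boundary) (use sz finF in auto)
  then have bd\<pi>: "cube_boundary (\<pi> z) = 0" using insert.prems(3) by (simp add: \<pi>)
  have dis\<sigma>: "\<sigma> \<inter> \<epsilon> = {}" using insert.prems(1) by auto
  have aug\<pi>: "augmentation (\<pi> z) = 0" if "p = 0"
  proof -
    have "augmentation (cube_boundary (s z)) = 0"
      by (rule augmentation_cube_boundary) (use sz that in auto)
    then show ?thesis using insert.prems(4)[OF that] by (simp add: \<pi>)
  qed
  obtain x where x: "Poly_Mapping.keys x \<subseteq> {c. card (fst c) = Suc p} \<inter> faces (\<sigma>, \<epsilon>)" "cube_boundary x = \<pi> z"
    using insert.IH[OF dis\<sigma> pz bd\<pi>] aug\<pi> by blast
  have "faces (\<sigma>, \<epsilon>) \<subseteq> ?F" using i by (auto simp: faces_def)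
  then have "Poly_Mapping.keys (x + s z) \<subseteq> {c. card (fst c) = Suc p} \<inter> ?F"
    using x(1) sz by (intro keys_add_subset) blast+
  moreover have "cube_boundary (x + s z) = z" using x(2) by (simp add: \<pi>)
  ultimately show ?case by (intro exI[of _ "x + s z"] conjI)
qed

section \<open>The complex of orbits of cells\<close>

text \<open>Only the fixed coordinates of a cell can move under a reflection; on the free ones it
  acts by the sign \<open>reflect_sign\<close>.\<close>

definition reflect_cell :: "nat set \<Rightarrow> cell \<Rightarrow> cell" where
  "reflect_cell g c = (fst c, sym_diff (snd c) g - fst c)"

text \<open>Every reflected free coordinate reverses the orientation of the cell once.\<close>

definition reflect_sign :: "nat set \<Rightarrow> cell \<Rightarrow> int" where
  "reflect_sign g c = (-1) ^ card (g \<inter> fst c)"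

definition reflect_chain :: "nat set \<Rightarrow> (cell \<Rightarrow>\<^sub>0 int) \<Rightarrow> (cell \<Rightarrow>\<^sub>0 int)" where
  "reflect_chain g = frag_extend (\<lambda>c. frag_cmul (reflect_sign g c) (frag_of (reflect_cell g c)))"

lemma reflect_chain_simps [simp]:
  "reflect_chain g 0 = 0"
  "reflect_chain g (a - b) = reflect_chain g a - reflect_chain g b"
  "reflect_chain g (frag_cmul n a) = frag_cmul n (reflect_chain g a)"
  by (simp_all add: reflect_chain_def frag_extend_diff frag_extend_cmul)

lemma reflect_chain_of: "reflect_chain g (frag_of c) = frag_cmul (reflect_sign g c) (frag_of (reflect_cell g c))"
  by (simp add: reflect_chain_def)

lemma reflect_chain_sum: "finite S \<Longrightarrow> reflect_chain g (sum f S) = (\<Sum>x\<in>S. reflect_chain g (f x))"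
  by (simp add: reflect_chain_def frag_extend_sum o_def)

lemma minus_one_power_card_sym_diff:
  assumes "finite A" "finite B"
  shows "(-1 :: int) ^ card (sym_diff A B) = (-1) ^ card A * (-1) ^ card B"
proof -
  have "card A = card (A - B) + card (A \<inter> B)" "card B = card (B - A) + card (A \<inter> B)"
    using assms by (metis card_Int_Diff add.commute, metis card_Int_Diff add.commute Int_commute)
  moreover have "card (sym_diff A B) = card (A - B) + card (B - A)"
    using assms by (intro card_Un_disjoint) auto
  ultimately show ?thesis
    by (simp add: power_add mult.assoc left_minus_one_mult_self flip: power2_eq_square power_mult mult_2)
qed

lemma reflect_sign_sq [simp]: "reflect_sign g c * reflect_sign g c = 1"
  by (simp add: reflect_sign_def flip: power_mult_distrib)

lemma reflect_sign_mult:
  assumes "finite (fst c)"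
  shows "reflect_sign (sym_diff g h) c = reflect_sign g c * reflect_sign h c"
proof -
  have "sym_diff g h \<inter> fst c = sym_diff (g \<inter> fst c) (h \<inter> fst c)" by blast
  then show ?thesis using minus_one_power_card_sym_diff[of "g \<inter> fst c" "h \<inter> fst c"] assms
    by (simp add: reflect_sign_def)
qed

lemma reflect_cell_comp: "reflect_cell g (reflect_cell h c) = reflect_cell (sym_diff g h) c"
  unfolding reflect_cell_def fst_conv snd_conv prod.inject by blast

lemma fst_reflect_cell [simp]: "fst (reflect_cell g c) = fst c"
  by (simp add: reflect_cell_def)

lemma reflect_sign_cell [simp]: "reflect_sign g (reflect_cell h c) = reflect_sign g c"
  by (simp add: reflect_sign_def)

text \<open>If i is reflected, the two facets in direction i are interchanged, which costs a sign;
  but the facets have one reflected free coordinate less than the cell, which restores it. If i is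
  not reflected, neither change occurs.\<close>

lemma cube_boundary_reflect:
  assumes "Poly_Mapping.keys x \<subseteq> {c. finite (fst c) \<and> fst c \<inter> snd c = {}}"
  shows "cube_boundary (reflect_chain g x) = reflect_chain g (cube_boundary x)"
proof (rule frag_additive_eqI[OF assms, where f = "\<lambda>x. cube_boundary (reflect_chain g x)"
      and g = "\<lambda>x. reflect_chain g (cube_boundary x)"])
  fix c :: cell assume "c \<in> {c. finite (fst c) \<and> fst c \<inter> snd c = {}}"
  then obtain \<sigma> \<epsilon> where c: "c = (\<sigma>, \<epsilon>)" and fin: "finite \<sigma>" and dis: "\<sigma> \<inter> \<epsilon> = {}" by (cases c) auto
  have "cube_boundary (reflect_chain g (frag_of c)) = frag_cmul ((-1) ^ card (g \<inter> \<sigma>))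
      (\<Sum>i\<in>\<sigma>. frag_cmul (position_sign \<sigma> i)
       (frag_of (\<sigma> - {i}, insert i (sym_diff \<epsilon> g - \<sigma>)) - frag_of (\<sigma> - {i}, sym_diff \<epsilon> g - \<sigma>)))"
    by (simp add: c reflect_chain_of reflect_sign_def reflect_cell_def cube_boundary_of)
  also have "\<dots> = (\<Sum>i\<in>\<sigma>. frag_cmul ((-1) ^ card (g \<inter> \<sigma>)) (frag_cmul (position_sign \<sigma> i)
       (frag_of (\<sigma> - {i}, insert i (sym_diff \<epsilon> g - \<sigma>)) - frag_of (\<sigma> - {i}, sym_diff \<epsilon> g - \<sigma>))))"
    by (simp only: frag_cmul_sum)
  also have "\<dots> = (\<Sum>i\<in>\<sigma>. reflect_chain g (frag_cmul (position_sign \<sigma> i)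
       (frag_of (\<sigma> - {i}, insert i \<epsilon>) - frag_of (\<sigma> - {i}, \<epsilon>))))"
  proof (rule sum.cong[OF refl])
    fix i assume i: "i \<in> \<sigma>"
    then have ie: "i \<notin> \<epsilon>" using dis by blast
    show "frag_cmul ((-1) ^ card (g \<inter> \<sigma>)) (frag_cmul (position_sign \<sigma> i)
       (frag_of (\<sigma> - {i}, insert i (sym_diff \<epsilon> g - \<sigma>)) - frag_of (\<sigma> - {i}, sym_diff \<epsilon> g - \<sigma>)))
      = reflect_chain g (frag_cmul (position_sign \<sigma> i) (frag_of (\<sigma> - {i}, insert i \<epsilon>) - frag_of (\<sigma> - {i}, \<epsilon>)))"
    proof (cases "i \<in> g")
      case True
      have "sym_diff (insert i \<epsilon>) g - (\<sigma> - {i}) = sym_diff \<epsilon> g - \<sigma>"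
        "sym_diff \<epsilon> g - (\<sigma> - {i}) = insert i (sym_diff \<epsilon> g - \<sigma>)"
        using True i ie by blast+
      moreover have "g \<inter> \<sigma> = insert i (g \<inter> (\<sigma> - {i}))" using True i by blast
      then have "card (g \<inter> \<sigma>) = Suc (card (g \<inter> (\<sigma> - {i})))" using fin by simp
      ultimately show ?thesis
        by (simp add: reflect_chain_of reflect_sign_def reflect_cell_def frag_cmul_diff mult.commute flip: minus_frag_cmul)
    next
      case False
      have "sym_diff (insert i \<epsilon>) g - (\<sigma> - {i}) = insert i (sym_diff \<epsilon> g - \<sigma>)"
        "sym_diff \<epsilon> g - (\<sigma> - {i}) = sym_diff \<epsilon> g - \<sigma>"
        using False i ie by blast+
      moreover have "g \<inter> (\<sigma> - {i}) = g \<inter> \<sigma>" using False by blast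
      ultimately show ?thesis
        by (simp add: reflect_chain_of reflect_sign_def reflect_cell_def frag_cmul_diff mult.commute)
    qed
  qed
  also have "\<dots> = reflect_chain g (cube_boundary (frag_of c))"
    by (simp only: c cube_boundary_of reflect_chain_sum[OF fin])
  finally show "cube_boundary (reflect_chain g (frag_of c)) = reflect_chain g (cube_boundary (frag_of c))" .
qed auto

lemma signed_injective_chain_map_0:
  fixes u :: "'a \<Rightarrow> 'b" and s :: "'a \<Rightarrow> int"
  assumes inj: "inj_on u S" and s: "\<And>x. x \<in> S \<Longrightarrow> s x * s x = 1"
    and y: "Poly_Mapping.keys y \<subseteq> S" and 0: "frag_extend (\<lambda>x. frag_cmul (s x) (frag_of (u x))) y = 0"
  shows "y = 0"
proof -
  let ?l = "frag_extend (\<lambda>r. frag_cmul (s (inv_into S u r)) (frag_of (inv_into S u r)))"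
  have "?l (frag_extend (\<lambda>x. frag_cmul (s x) (frag_of (u x))) y) = y"
    by (rule frag_additive_eqI[OF y, where f = "\<lambda>y. ?l (frag_extend (\<lambda>x. frag_cmul (s x) (frag_of (u x))) y)" and g = "\<lambda>y. y"])
      (auto simp: frag_extend_diff frag_extend_cmul inj s)
  then show ?thesis using 0 by simp
qed

text \<open>Subgroups of \<int>\<open>\<^sub>2^m\<close> appear as families of sets closed under
  symmetric difference. A reflection g maps a cell with free coordinates \<sigma> to itself exactly
  when g \<subseteq> \<sigma>, so the last assumption is freeness of the action on cells.\<close>

locale free_reflection_group =
  fixes m :: nat and K :: "nat set set" and \<Gamma> :: "nat set set"
  assumes K_sub: "K \<subseteq> Pow {1..m}" and K_down: "\<sigma> \<in> K \<Longrightarrow> \<tau> \<subseteq> \<sigma> \<Longrightarrow> \<tau> \<in> K"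
    and \<Gamma>_sub: "\<Gamma> \<subseteq> Pow {1..m}" and \<Gamma>_empty: "{} \<in> \<Gamma>"
    and \<Gamma>_sym_diff: "g \<in> \<Gamma> \<Longrightarrow> h \<in> \<Gamma> \<Longrightarrow> sym_diff g h \<in> \<Gamma>"
    and \<Gamma>_free: "g \<in> \<Gamma> \<Longrightarrow> \<sigma> \<in> K \<Longrightarrow> g \<subseteq> \<sigma> \<Longrightarrow> g = {}"
begin

definition cells :: "cell set" where
  "cells = {c. fst c \<in> K \<and> snd c \<subseteq> {1..m} - fst c}"

lemma finite_cells: "finite cells"
proof (rule finite_subset)
  show "cells \<subseteq> Pow {1..m} \<times> Pow {1..m}" using K_sub by (auto simp: cells_def)
qed simp

lemma cellsD:
  assumes "c \<in> cells"
  shows "fst c \<in> K" "fst c \<inter> snd c = {}" "finite (fst c)" "fst c \<subseteq> {1..m}" "snd c \<subseteq> {1..m}"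
proof -
  show "fst c \<in> K" "fst c \<inter> snd c = {}" "snd c \<subseteq> {1..m}" using assms unfolding cells_def by blast+
  then show "fst c \<subseteq> {1..m}" using K_sub by blast
  then show "finite (fst c)" by (rule finite_subset) simp
qed

lemma faces_cells: "c \<in> cells \<Longrightarrow> faces c \<subseteq> cells"
proof
  fix d assume c: "c \<in> cells" and d: "d \<in> faces c"
  have "fst d \<in> K" using K_down[OF cellsD(1)[OF c]] d unfolding faces_iff by blast
  moreover have "snd d \<subseteq> {1..m} - fst d" using d cellsD(4,5)[OF c] unfolding faces_iff by blast
  ultimately show "d \<in> cells" unfolding cells_def by blast
qed

lemma reflect_cells: "c \<in> cells \<Longrightarrow> g \<in> \<Gamma> \<Longrightarrow> reflect_cell g c \<in> cells"
  using \<Gamma>_sub unfolding cells_def reflect_cell_def by auto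

lemma reflect_cell_empty: "c \<in> cells \<Longrightarrow> reflect_cell {} c = c"
  using cellsD(2)[of c] by (cases c) (auto simp: reflect_cell_def)

lemma reflect_cell_inj:
  assumes "c \<in> cells" "g \<in> \<Gamma>" "h \<in> \<Gamma>" "reflect_cell g c = reflect_cell h c"
  shows "g = h"
proof -
  have "sym_diff (snd c) g - fst c = sym_diff (snd c) h - fst c"
    using assms(4) by (simp add: reflect_cell_def)
  then have "sym_diff g h \<subseteq> fst c" by blast
  then have "sym_diff g h = {}"
    using \<Gamma>_free[OF \<Gamma>_sym_diff[OF assms(2,3)] cellsD(1)[OF assms(1)]] by blast
  then show ?thesis by blast
qed

text \<open>The orbit complex is modelled on one chosen cell per orbit. The choice is made from the
  orbit as a set, hence is constant along the orbit; by freeness exactly one reflection in \<Gamma>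
  leads from a cell to its representative, so the sign attached to that reflection is
  unambiguous.\<close>

definition rep :: "cell \<Rightarrow> cell" where
  "rep c = (SOME d. d \<in> (\<lambda>g. reflect_cell g c) ` \<Gamma>)"

definition to_rep :: "cell \<Rightarrow> nat set" where
  "to_rep c = (SOME g. g \<in> \<Gamma> \<and> reflect_cell g c = rep c)"

definition reps :: "cell set" where
  "reps = {c \<in> cells. rep c = c}"

text \<open>The projection of cellular chains onto their coinvariants under \<Gamma>, written in the
  basis of representatives.\<close>

definition to_reps :: "(cell \<Rightarrow>\<^sub>0 int) \<Rightarrow> (cell \<Rightarrow>\<^sub>0 int)" where
  "to_reps = frag_extend (\<lambda>c. frag_cmul (reflect_sign (to_rep c) c) (frag_of (rep c)))"

lemma to_reps_simps [simp]:
  "to_reps 0 = 0"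
  "to_reps (a - b) = to_reps a - to_reps b"
  "to_reps (a + b) = to_reps a + to_reps b"
  "to_reps (- a) = - to_reps a"
  "to_reps (frag_cmul n a) = frag_cmul n (to_reps a)"
  by (simp_all add: to_reps_def frag_extend_diff frag_extend_add frag_extend_minus frag_extend_cmul)

lemma to_reps_sum: "finite S \<Longrightarrow> to_reps (sum f S) = (\<Sum>x\<in>S. to_reps (f x))"
  by (simp add: to_reps_def frag_extend_sum o_def)

lemma to_reps_of: "to_reps (frag_of c) = frag_cmul (reflect_sign (to_rep c) c) (frag_of (rep c))"
  by (simp add: to_reps_def)

lemma orbit_reflect:
  assumes "g \<in> \<Gamma>"
  shows "(\<lambda>h. reflect_cell h (reflect_cell g c)) ` \<Gamma> = (\<lambda>h. reflect_cell h c) ` \<Gamma>"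
proof -
  have "(\<lambda>h. reflect_cell h c) ` (\<lambda>h. sym_diff h g) ` \<Gamma> = (\<lambda>h. reflect_cell h c) ` \<Gamma>"
  proof (rule arg_cong[where f = "image (\<lambda>h. reflect_cell h c)"])
    have "h \<in> (\<lambda>h. sym_diff h g) ` \<Gamma>" if "h \<in> \<Gamma>" for h
    proof
      show "h = sym_diff (sym_diff h g) g" by blast
    qed (rule \<Gamma>_sym_diff[OF that assms])
    then show "(\<lambda>h. sym_diff h g) ` \<Gamma> = \<Gamma>" using \<Gamma>_sym_diff[OF _ assms] by blast
  qed
  then show ?thesis by (simp only: image_image reflect_cell_comp)
qed

lemma rep_reflect: "g \<in> \<Gamma> \<Longrightarrow> rep (reflect_cell g c) = rep c"
  unfolding rep_def by (simp only: orbit_reflect)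

lemma to_rep: "to_rep c \<in> \<Gamma>" "reflect_cell (to_rep c) c = rep c"
proof -
  have "rep c \<in> (\<lambda>g. reflect_cell g c) ` \<Gamma>"
    unfolding rep_def by (rule someI_ex) (use \<Gamma>_empty in blast)
  then have "\<exists>g. g \<in> \<Gamma> \<and> reflect_cell g c = rep c" by auto
  from someI_ex[OF this] show "to_rep c \<in> \<Gamma>" "reflect_cell (to_rep c) c = rep c"
    by (simp_all add: to_rep_def)
qed

lemma rep_in_reps: "c \<in> cells \<Longrightarrow> rep c \<in> reps"
  using reflect_cells[of c "to_rep c"] rep_reflect[of "to_rep c" c] to_rep[of c] by (simp add: reps_def)

lemma fst_rep [simp]: "fst (rep c) = fst c"
  using fst_reflect_cell[of "to_rep c" c] to_rep(2)[of c] by simp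

lemma to_rep_unique: "c \<in> cells \<Longrightarrow> g \<in> \<Gamma> \<Longrightarrow> reflect_cell g c = rep c \<Longrightarrow> to_rep c = g"
  using reflect_cell_inj[of c "to_rep c" g] to_rep[of c] by simp

lemma to_reps_rep:
  assumes "c \<in> reps" shows "to_reps (frag_of c) = frag_of c"
proof -
  have c: "c \<in> cells" "rep c = c" using assms by (auto simp: reps_def)
  have "to_rep c = {}" by (rule to_rep_unique[OF c(1) \<Gamma>_empty]) (simp add: c reflect_cell_empty)
  then show ?thesis by (simp add: to_reps_of c reflect_sign_def)
qed

text \<open>By freeness the reflection from c to its representative is the composite of g with the
  one starting at the reflected cell, and orientation signs are multiplicative.\<close>

lemma to_reps_reflect:
  assumes x: "Poly_Mapping.keys x \<subseteq> cells" and g: "g \<in> \<Gamma>"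
  shows "to_reps (reflect_chain g x) = to_reps x"
proof (rule frag_additive_eqI[OF x, where f = "\<lambda>x. to_reps (reflect_chain g x)" and g = to_reps])
  fix c assume c: "c \<in> cells"
  let ?h = "to_rep (reflect_cell g c)"
  have "reflect_cell (sym_diff ?h g) c = rep c"
    using to_rep(2)[of "reflect_cell g c"] by (simp only: reflect_cell_comp rep_reflect[OF g])
  then have "to_rep c = sym_diff ?h g"
    by (rule to_rep_unique[OF c \<Gamma>_sym_diff[OF to_rep(1) g]])
  then show "to_reps (reflect_chain g (frag_of c)) = to_reps (frag_of c)"
    by (simp add: reflect_chain_of to_reps_of rep_reflect[OF g] reflect_sign_mult[OF cellsD(3)[OF c]] mult.commute)
qed auto

lemma keys_to_reps:
  assumes "Poly_Mapping.keys x \<subseteq> A" "A \<subseteq> cells" "\<And>c g. c \<in> A \<Longrightarrow> g \<in> \<Gamma> \<Longrightarrow> reflect_cell g c \<in> A"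
  shows "Poly_Mapping.keys (to_reps x) \<subseteq> reps \<inter> A"
  unfolding to_reps_def
proof (rule keys_frag_extend_subset[OF assms(1)])
  fix c assume c: "c \<in> A"
  have "rep c \<in> A" using assms(3)[OF c to_rep(1)[of c]] to_rep(2)[of c] by simp
  moreover have "rep c \<in> reps" using rep_in_reps c assms(2) by blast
  ultimately show "Poly_Mapping.keys (frag_cmul (reflect_sign (to_rep c) c) (frag_of (rep c))) \<subseteq> reps \<inter> A"
    by auto
qed

definition orbit_boundary :: "(cell \<Rightarrow>\<^sub>0 int) \<Rightarrow> (cell \<Rightarrow>\<^sub>0 int)" where
  "orbit_boundary x = to_reps (cube_boundary x)"

lemma orbit_boundary_simps [simp]:
  "orbit_boundary 0 = 0"
  "orbit_boundary (a - b) = orbit_boundary a - orbit_boundary b"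
  "orbit_boundary (a + b) = orbit_boundary a + orbit_boundary b"
  "orbit_boundary (- a) = - orbit_boundary a"
  "orbit_boundary (frag_cmul n a) = frag_cmul n (orbit_boundary a)"
  by (simp_all add: orbit_boundary_def)

lemma keys_cube_boundary_cells: "Poly_Mapping.keys x \<subseteq> cells \<Longrightarrow> Poly_Mapping.keys (cube_boundary x) \<subseteq> cells"
  unfolding cube_boundary_def
proof (erule keys_frag_extend_subset)
  fix c assume c: "c \<in> cells"
  obtain \<sigma> \<epsilon> where ce: "c = (\<sigma>, \<epsilon>)" by (cases c)
  have "(\<sigma> - {i}, \<delta>) \<in> cells" if i: "i \<in> \<sigma>" and \<delta>: "\<delta> = \<epsilon> \<or> \<delta> = insert i \<epsilon>" for i \<delta>
  proof -
    have "(\<sigma> - {i}, \<delta>) \<in> faces c"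
      using i \<delta> cellsD(2)[OF c] unfolding ce faces_iff fst_conv snd_conv by blast
    then show ?thesis using faces_cells[OF c] by blast
  qed
  then show "Poly_Mapping.keys (case c of (\<sigma>, \<epsilon>) \<Rightarrow> \<Sum>i\<in>\<sigma>. frag_cmul (position_sign \<sigma> i)
     (frag_of (\<sigma> - {i}, insert i \<epsilon>) - frag_of (\<sigma> - {i}, \<epsilon>))) \<subseteq> cells"
    unfolding ce prod.case
    by (intro order_trans[OF keys_sum] UN_least order_trans[OF keys_cmul] keys_diff_subset) auto
qed

text \<open>The boundary descends to coinvariants: replacing a cell by its representative is a
  signed reflection, which commutes with the boundary and is then forgotten by
  \<open>to_reps\<close>. The square of \<open>orbit_boundary\<close> vanishes for this
  reason.\<close>

lemma orbit_boundary_to_reps: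
  assumes x: "Poly_Mapping.keys x \<subseteq> cells"
  shows "orbit_boundary (to_reps x) = orbit_boundary x"
proof (rule frag_additive_eqI[OF x, where f = "\<lambda>x. orbit_boundary (to_reps x)" and g = orbit_boundary])
  fix c assume c: "c \<in> cells"
  have k: "Poly_Mapping.keys (frag_of c) \<subseteq> cells" using c by simp
  have "to_reps (frag_of c) = reflect_chain (to_rep c) (frag_of c)"
    by (simp add: to_reps_of reflect_chain_of to_rep(2))
  moreover have "cube_boundary (reflect_chain (to_rep c) (frag_of c)) = reflect_chain (to_rep c) (cube_boundary (frag_of c))"
    by (rule cube_boundary_reflect) (use cellsD(2,3)[OF c] in simp)
  ultimately show "orbit_boundary (to_reps (frag_of c)) = orbit_boundary (frag_of c)"
    by (simp add: orbit_boundary_def to_reps_reflect[OF keys_cube_boundary_cells[OF k] to_rep(1)])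
qed auto

lemma orbit_boundary_boundary:
  assumes x: "Poly_Mapping.keys x \<subseteq> cells"
  shows "orbit_boundary (orbit_boundary x) = 0"
proof -
  have "orbit_boundary (orbit_boundary x) = orbit_boundary (cube_boundary x)"
    unfolding orbit_boundary_def[of x] by (rule orbit_boundary_to_reps[OF keys_cube_boundary_cells[OF x]])
  also have "\<dots> = 0"
  proof -
    have "cube_boundary (cube_boundary x) = 0"
      by (rule cube_boundary_boundary) (use x cellsD(3) in blast)
    then show ?thesis by (simp add: orbit_boundary_def)
  qed
  finally show ?thesis .
qed

section \<open>Invariant subcomplexes and closed cells of the quotient\<close>

definition subcomplex :: "cell set \<Rightarrow> bool" where
  "subcomplex A \<longleftrightarrow> A \<subseteq> cells \<and> (\<forall>c\<in>A. faces c \<subseteq> A) \<and> (\<forall>c\<in>A. \<forall>g\<in>\<Gamma>. reflect_cell g c \<in> A)"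

definition orbit_cells :: "cell set \<Rightarrow> nat \<Rightarrow> cell set" where
  "orbit_cells A p = reps \<inter> A \<inter> {c. card (fst c) = p}"

lemma subcomplex_cells: "subcomplex cells"
  using faces_cells reflect_cells by (auto simp: subcomplex_def)

lemma subcomplex_Int: "subcomplex A \<Longrightarrow> subcomplex B \<Longrightarrow> subcomplex (A \<inter> B)"
  unfolding subcomplex_def by blast

lemma orbit_cells_sub: "orbit_cells A p \<subseteq> cells"
  by (auto simp: orbit_cells_def reps_def)

lemma keys_to_reps_card:
  assumes "subcomplex A" "Poly_Mapping.keys x \<subseteq> {c. card (fst c) = p} \<inter> A"
  shows "Poly_Mapping.keys (to_reps x) \<subseteq> orbit_cells A p"
proof -
  have "Poly_Mapping.keys (to_reps x) \<subseteq> reps \<inter> ({c. card (fst c) = p} \<inter> A)"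
    using assms(1) by (intro keys_to_reps[OF assms(2)]) (auto simp: subcomplex_def)
  then show ?thesis unfolding orbit_cells_def by blast
qed

lemma keys_orbit_boundary:
  assumes A: "subcomplex A" and x: "Poly_Mapping.keys x \<subseteq> orbit_cells A (Suc p)"
  shows "Poly_Mapping.keys (orbit_boundary x) \<subseteq> orbit_cells A p"
  unfolding orbit_boundary_def
proof (rule keys_to_reps_card[OF A keys_cube_boundary])
  show "Poly_Mapping.keys x \<subseteq> {c. card (fst c) = Suc p} \<inter> A" using x by (auto simp: orbit_cells_def)
  show "fst c \<inter> snd c = {}" if "c \<in> A" for c
    using that A cellsD(2)[of c] unfolding subcomplex_def by blast
qed (use A in \<open>auto simp: subcomplex_def\<close>)

lemma orbit_boundary_0:
  assumes "Poly_Mapping.keys x \<subseteq> orbit_cells A 0"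
  shows "orbit_boundary x = 0"
proof (rule frag_additive_eqI[OF assms, where f = orbit_boundary and g = "\<lambda>_. 0"])
  fix c assume c: "c \<in> orbit_cells A 0"
  then have "c \<in> cells" "card (fst c) = 0" unfolding orbit_cells_def reps_def by blast+
  then have "finite (fst c)" "card (fst c) = 0" using cellsD(3) by blast+
  then have "fst c = {}" by simp
  then show "orbit_boundary (frag_of c) = 0"
    by (cases c) (simp add: orbit_boundary_def cube_boundary_of)
qed auto

text \<open>Vertices have no free coordinates, so all their orientation signs are 1.\<close>

lemma augmentation_to_reps:
  assumes "Poly_Mapping.keys x \<subseteq> cells \<inter> {c. card (fst c) = 0}"
  shows "augmentation (to_reps x) = augmentation x"
proof (rule frag_additive_eqI[OF assms, where f = "\<lambda>x. augmentation (to_reps x)" and g = augmentation])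
  fix c assume c: "c \<in> cells \<inter> {c. card (fst c) = 0}"
  then have "fst c = {}" using cellsD(3)[of c] by simp
  then show "augmentation (to_reps (frag_of c)) = augmentation (frag_of c)"
    by (simp add: to_reps_of reflect_sign_def)
qed auto

text \<open>All cells lying over one closed cell of the quotient; saturating under \<Gamma> makes
  this an invariant subcomplex.\<close>

definition closed_cell :: "cell \<Rightarrow> cell set" where
  "closed_cell c = (\<Union>g\<in>\<Gamma>. reflect_cell g ` faces c)"

lemma faces_reflect:
  assumes "c \<in> cells" "g \<in> \<Gamma>" "d \<in> faces (reflect_cell g c)"
  shows "d \<in> reflect_cell g ` faces c"
proof
  have "snd d \<inter> fst d = {}" using assms(3) unfolding faces_iff by blast
  then show "d = reflect_cell g (reflect_cell g d)"
    by (cases d) (auto simp: reflect_cell_def)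
  have "sym_diff (snd d) g - fst d - fst c = snd c"
    using assms(3) cellsD(2)[OF assms(1)] unfolding faces_iff reflect_cell_def fst_conv snd_conv by blast
  then show "reflect_cell g d \<in> faces c"
    using assms(3) unfolding faces_iff reflect_cell_def fst_conv snd_conv by blast
qed

lemma subcomplex_closed_cell:
  assumes c: "c \<in> cells" shows "subcomplex (closed_cell c)"
  unfolding subcomplex_def
proof (intro conjI ballI)
  show "closed_cell c \<subseteq> cells"
    using faces_cells[OF c] reflect_cells by (auto simp: closed_cell_def)
  fix d assume "d \<in> closed_cell c"
  then obtain g f where gf: "g \<in> \<Gamma>" "f \<in> faces c" "d = reflect_cell g f" by (auto simp: closed_cell_def)
  show "faces d \<subseteq> closed_cell c"
  proof
    fix e assume "e \<in> faces d"
    then have "e \<in> reflect_cell g ` faces f"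
      using gf faces_cells[OF c] faces_reflect[of f g e] by blast
    then show "e \<in> closed_cell c" using faces_trans[OF gf(2)] gf(1) by (auto simp: closed_cell_def)
  qed
  fix h assume "h \<in> \<Gamma>"
  then show "reflect_cell h d \<in> closed_cell c"
    using \<Gamma>_sym_diff[of h g] gf unfolding closed_cell_def gf(3) reflect_cell_comp by blast
qed

text \<open>All faces of c have the same fixed coordinates off \<open>fst c\<close>, so a reflection
  relating two of them lies inside \<open>fst c\<close> and is trivial by freeness. A closed cell
  therefore embeds in the quotient.\<close>

lemma faces_same_orbit:
  assumes c: "c \<in> cells" and f: "f \<in> faces c" "f' \<in> faces c" and g: "g \<in> \<Gamma>" "f' = reflect_cell g f"
  shows "f' = f"
proof -
  have f': "fst f' = fst f" "snd f' = sym_diff (snd f) g - fst f" using g by (simp_all add: reflect_cell_def)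
  have "g - fst c = {}"
    using f f' unfolding faces_iff by blast
  then have "g = {}" using \<Gamma>_free[OF g(1) cellsD(1)[OF c]] by blast
  then show ?thesis using g(2) reflect_cell_empty f(1) faces_cells[OF c] by blast
qed

text \<open>Since different faces of c lie in different orbits, the orbit complex of the closed cell
  is, up to signs, the cellular complex of a single cube, whose acyclicity is transferred.\<close>

lemma orbit_complex_closed_cell_acyclic:
  assumes c: "c \<in> cells" and d: "Poly_Mapping.keys d \<subseteq> orbit_cells (closed_cell c) p"
    and bd: "orbit_boundary d = 0" and aug: "p = 0 \<Longrightarrow> augmentation d = 0"
  shows "\<exists>x. Poly_Mapping.keys x \<subseteq> orbit_cells (closed_cell c) (Suc p) \<and> orbit_boundary x = d"
proof -
  let ?F = "\<lambda>p. {e. card (fst e) = p} \<inter> faces c"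
  have Fc: "?F p \<subseteq> cells" for p using faces_cells[OF c] by blast
  have F_cl: "faces c \<subseteq> closed_cell c"
  proof
    fix f assume f: "f \<in> faces c"
    then have "f = reflect_cell {} f" using reflect_cell_empty faces_cells[OF c] by fastforce
    then show "f \<in> closed_cell c" using f \<Gamma>_empty unfolding closed_cell_def by blast
  qed
  have "\<exists>g f. g \<in> \<Gamma> \<and> f \<in> ?F p \<and> r = reflect_cell g f" if "r \<in> orbit_cells (closed_cell c) p" for r
    using that unfolding orbit_cells_def closed_cell_def by fastforce
  then obtain gg ff where gf: "\<And>r. r \<in> orbit_cells (closed_cell c) p \<Longrightarrow>
      gg r \<in> \<Gamma> \<and> ff r \<in> ?F p \<and> r = reflect_cell (gg r) (ff r)" by metis
  \<comment> \<open>The lift of d to the cube: each representative is replaced by the face of c in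
    its orbit, with the sign of the reflection between them.\<close>
  define z where "z = frag_extend (\<lambda>r. frag_cmul (reflect_sign (gg r) (ff r)) (frag_of (ff r))) d"
  have zF: "Poly_Mapping.keys z \<subseteq> ?F p"
    unfolding z_def by (rule keys_frag_extend_subset[OF d]) (use gf in auto)
  have tz: "to_reps z = d"
    unfolding z_def
  proof (rule frag_additive_eqI[OF d, where f = "\<lambda>d. to_reps (frag_extend (\<lambda>r. frag_cmul (reflect_sign (gg r) (ff r)) (frag_of (ff r))) d)"
          and g = "\<lambda>d. d"])
    fix r assume r: "r \<in> orbit_cells (closed_cell c) p"
    have fr: "gg r \<in> \<Gamma>" "ff r \<in> cells" "r = reflect_cell (gg r) (ff r)" using gf[OF r] Fc by blast+
    have "to_reps (frag_of (ff r)) = to_reps (reflect_chain (gg r) (frag_of (ff r)))"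
      using to_reps_reflect[of "frag_of (ff r)" "gg r"] fr(1,2) by simp
    also have "\<dots> = frag_cmul (reflect_sign (gg r) (ff r)) (to_reps (frag_of r))"
      using fr(3) by (simp add: reflect_chain_of)
    also have "to_reps (frag_of r) = frag_of r" using r by (intro to_reps_rep) (simp add: orbit_cells_def)
    finally show "to_reps (frag_extend (\<lambda>r. frag_cmul (reflect_sign (gg r) (ff r)) (frag_of (ff r))) (frag_of r)) = frag_of r"
      by simp
  qed (auto simp: frag_extend_diff)
  have inj: "inj_on rep (faces c)"
  proof (rule inj_onI)
    fix f f' assume f: "f \<in> faces c" "f' \<in> faces c" "rep f = rep f'"
    have cl: "f \<in> cells" "f' \<in> cells" using f faces_cells[OF c] by auto
    have "reflect_cell (to_rep f) f = reflect_cell (to_rep f') f'" using f(3) by (simp add: to_rep(2))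
    then have "reflect_cell (to_rep f') (reflect_cell (to_rep f) f) = reflect_cell {} f'"
      by (simp only: reflect_cell_comp Diff_cancel Un_empty_right)
    then have "f' = reflect_cell (sym_diff (to_rep f') (to_rep f)) f"
      by (simp only: reflect_cell_comp reflect_cell_empty[OF cl(2)])
    from faces_same_orbit[OF c f(1,2) \<Gamma>_sym_diff[OF to_rep(1) to_rep(1)] this]
    show "f = f'" by (rule sym)
  qed
  have inj0: "y = 0" if y: "Poly_Mapping.keys y \<subseteq> faces c" "to_reps y = 0" for y
    using signed_injective_chain_map_0[OF inj _ y(1), of "\<lambda>c. reflect_sign (to_rep c) c"] y(2)
    by (simp add: to_reps_def)
  have kz: "Poly_Mapping.keys z \<subseteq> cells" using zF Fc by blast
  \<comment> \<open>The projection of this boundary to the orbits is the boundary of d, which is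
    zero, and the projection is injective on chains of faces of c.\<close>
  have "cube_boundary z = 0"
  proof (rule inj0)
    show "to_reps (cube_boundary z) = 0"
      using orbit_boundary_to_reps[OF kz] bd by (simp add: tz orbit_boundary_def)
    show "Poly_Mapping.keys (cube_boundary z) \<subseteq> faces c"
    proof (cases p)
      case 0
      have "cube_boundary z = 0"
      proof (rule frag_additive_eqI[OF zF, where f = cube_boundary and g = "\<lambda>_. 0"])
        fix e assume "e \<in> ?F p"
        then have "fst e = {}" using 0 cellsD(3)[of e] Fc[of p] by auto
        then show "cube_boundary (frag_of e) = 0" by (cases e) (simp add: cube_boundary_of)
      qed auto
      then show ?thesis by simp
    next
      case (Suc q)
      have "Poly_Mapping.keys (cube_boundary z) \<subseteq> ?F q"
      proof (rule keys_cube_boundary)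
        show "Poly_Mapping.keys z \<subseteq> {c. card (fst c) = Suc q} \<inter> faces c" using zF Suc by simp
        show "faces e \<subseteq> faces c" if "e \<in> faces c" for e by (rule faces_trans[OF that])
        show "fst e \<inter> snd e = {}" if "e \<in> faces c" for e using that unfolding faces_iff by blast
      qed
      then show ?thesis by blast
    qed
  qed
  moreover have "augmentation z = 0" if "p = 0"
  proof -
    have "Poly_Mapping.keys z \<subseteq> cells \<inter> {c. card (fst c) = 0}" using kz zF that by blast
    from augmentation_to_reps[OF this] show ?thesis using aug[OF that] tz by simp
  qed
  ultimately have "\<exists>x. Poly_Mapping.keys x \<subseteq> {e. card (fst e) = Suc p} \<inter> faces (fst c, snd c) \<and> cube_boundary x = z"
    using zF by (intro cube_acyclic cellsD(2,3)[OF c]) simp_all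
  then obtain x where x: "Poly_Mapping.keys x \<subseteq> ?F (Suc p)" "cube_boundary x = z" by auto
  have xc: "Poly_Mapping.keys x \<subseteq> cells" using x(1) Fc by blast
  have "orbit_boundary (to_reps x) = d"
    using orbit_boundary_to_reps[OF xc] x(2) tz by (simp add: orbit_boundary_def)
  moreover have "Poly_Mapping.keys (to_reps x) \<subseteq> orbit_cells (closed_cell c) (Suc p)"
    by (rule keys_to_reps_card[OF subcomplex_closed_cell[OF c]]) (use x(1) F_cl in blast)
  ultimately show ?thesis by blast
qed

end

section \<open>Star neighbourhoods in the quotient\<close>

lemma homotopic_with_straight_line:
  assumes f: "continuous_map (subtopology (powertop_real I) S) (subtopology (powertop_real I) S) f"
    and g: "continuous_map (subtopology (powertop_real I) S) (subtopology (powertop_real I) S) g"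
    and line: "\<And>x t. x \<in> topspace (subtopology (powertop_real I) S) \<Longrightarrow> 0 \<le> t \<Longrightarrow> t \<le> 1 \<Longrightarrow>
        (\<lambda>i\<in>I. (1 - t) * f x i + t * g x i) \<in> S"
  shows "homotopic_with (\<lambda>_. True) (subtopology (powertop_real I) S) (subtopology (powertop_real I) S) f g"
proof -
  let ?Y = "subtopology (powertop_real I) S"
  let ?P = "prod_topology (top_of_set {0..1::real}) ?Y"
  define h where "h z = (\<lambda>i\<in>I. (1 - fst z) * f (snd z) i + fst z * g (snd z) i)" for z
  have coord: "continuous_map ?P euclideanreal (\<lambda>z. k (snd z) i)"
    if k: "continuous_map ?Y ?Y k" and i: "i \<in> I" for k i
  proof -
    have "continuous_map ?Y (powertop_real I) k" using k by (simp add: continuous_map_in_subtopology)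
    then have "continuous_map ?Y euclideanreal (\<lambda>x. k x i)"
      using i by (simp add: continuous_map_componentwise)
    from continuous_map_compose[OF continuous_map_snd this] show ?thesis by (simp add: o_def)
  qed
  have fst: "continuous_map ?P euclideanreal fst"
    by (rule continuous_map_into_fulltopology[OF continuous_map_fst])
  have "continuous_map ?P ?Y h"
    unfolding continuous_map_in_subtopology continuous_map_componentwise
  proof (intro conjI ballI)
    fix i assume i: "i \<in> I"
    have "continuous_map ?P euclideanreal (\<lambda>z. (1 - fst z) * f (snd z) i + fst z * g (snd z) i)"
      by (intro continuous_intros fst coord[OF f i] coord[OF g i])
    then show "continuous_map ?P euclideanreal (\<lambda>z. h z i)"
      using i by (simp add: h_def)
  next
    show "h \<in> topspace ?P \<rightarrow> S" using line by (auto simp: h_def)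
  qed (auto simp: h_def)
  moreover have "h (0, x) = f x \<and> h (1, x) = g x" if "x \<in> topspace ?Y" for x
  proof -
    have "f x \<in> extensional I" "g x \<in> extensional I"
      using continuous_map_image_subset_topspace[OF f] continuous_map_image_subset_topspace[OF g] that
      by (auto simp: PiE_def)
    then show ?thesis by (simp add: h_def extensional_restrict)
  qed
  ultimately show ?thesis
    by (subst homotopic_with) auto
qed

context free_reflection_group
begin

section \<open>The group action on points and its orbit map\<close>

definition refl :: "nat set \<Rightarrow> (nat \<Rightarrow> real) \<Rightarrow> (nat \<Rightarrow> real)" where
  "refl g x = (\<lambda>i\<in>{1..m}. if i \<in> g then 1 - x i else x i)"

definition orbit_map :: "(nat \<Rightarrow> real) \<Rightarrow> (nat \<Rightarrow> real) set" where
  "orbit_map x = (\<lambda>g. refl g x) ` \<Gamma>"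

abbreviation X :: "(nat \<Rightarrow> real) topology" where "X \<equiv> real_moment_angle m K"

definition M :: "(nat \<Rightarrow> real) set topology" where
  "M = quotient_topology X orbit_map"

definition cube :: "nat set \<Rightarrow> (nat \<Rightarrow> real) set" where
  "cube \<sigma> = {x. (\<forall>i\<in>{1..m}. x i \<in> {0..1}) \<and> (\<forall>i\<in>{1..m}. i \<notin> \<sigma> \<longrightarrow> x i \<in> {0, 1})}"

lemma X_eq: "X = subtopology (powertop_real {1..m}) (\<Union>\<sigma>\<in>K. cube \<sigma>)"
  by (simp add: real_moment_angle_def cube_def)

lemma topspace_X: "topspace X = extensional {1..m} \<inter> (\<Union>\<sigma>\<in>K. cube \<sigma>)"
  by (simp add: X_eq PiE_def)

lemma topspace_X_unit_interval: "x \<in> topspace X \<Longrightarrow> i \<in> {1..m} \<Longrightarrow> x i \<in> {0..1}"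
  unfolding topspace_X cube_def by blast

lemma cube_refl: "x \<in> cube \<sigma> \<Longrightarrow> refl g x \<in> cube \<sigma>"
  by (auto simp: cube_def refl_def)

lemma refl_X: "x \<in> topspace X \<Longrightarrow> refl g x \<in> topspace X"
  using cube_refl[of x _ g] by (auto simp: topspace_X) (auto simp: refl_def)

lemma refl_refl: "x \<in> topspace X \<Longrightarrow> refl g (refl h x) = refl (sym_diff g h) x"
  by (auto simp: refl_def)

lemma refl_empty: "x \<in> topspace X \<Longrightarrow> refl {} x = x"
  by (auto simp: refl_def topspace_X extensional_restrict)

lemma continuous_map_coord: "i \<in> {1..m} \<Longrightarrow> continuous_map X euclideanreal (\<lambda>x. x i)"
  unfolding X_eq by (intro continuous_map_from_subtopology continuous_map_product_projection)

lemma continuous_map_refl: "continuous_map X X (refl g)"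
proof -
  have "continuous_map X (powertop_real {1..m}) (refl g)"
    unfolding continuous_map_componentwise
  proof (intro conjI ballI)
    fix i assume i: "i \<in> {1..m}"
    show "continuous_map X euclideanreal (\<lambda>x. refl g x i)"
      using i continuous_map_coord[OF i]
      by (cases "i \<in> g") (auto simp: refl_def intro!: continuous_intros)
  qed (auto simp: refl_def)
  moreover have "refl g \<in> topspace X \<rightarrow> (\<Union>\<sigma>\<in>K. cube \<sigma>)"
    using refl_X by (auto simp: topspace_X)
  ultimately show ?thesis by (subst (2) X_eq) (simp add: continuous_map_in_subtopology)
qed

lemma orbit_map_eq_iff:
  assumes "x \<in> topspace X" "y \<in> topspace X"
  shows "orbit_map x = orbit_map y \<longleftrightarrow> (\<exists>g\<in>\<Gamma>. y = refl g x)"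
proof
  assume "orbit_map x = orbit_map y"
  moreover have "y \<in> orbit_map y"
    unfolding orbit_map_def using refl_empty[OF assms(2)] \<Gamma>_empty by (metis imageI)
  ultimately show "\<exists>g\<in>\<Gamma>. y = refl g x" by (auto simp: orbit_map_def)
next
  assume "\<exists>g\<in>\<Gamma>. y = refl g x"
  then obtain g where g: "g \<in> \<Gamma>" "y = refl g x" by blast
  have sub: "orbit_map (refl h z) \<subseteq> orbit_map z" if "h \<in> \<Gamma>" "z \<in> topspace X" for h z
    unfolding orbit_map_def using \<Gamma>_sym_diff[OF _ that(1)] refl_refl[OF that(2)] by auto
  have "refl g y = x" unfolding g(2) refl_refl[OF assms(1)] using refl_empty[OF assms(1)] by simp
  then show "orbit_map x = orbit_map y" using sub[OF g(1) assms(1)] sub[OF g(1) assms(2)] g(2) by auto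
qed

text \<open>The saturation of an open set is the union of its preimages under the reflections in
  \<Gamma>, hence open.\<close>

lemma openin_orbit_map_image:
  assumes U: "openin X U"
  shows "openin M (orbit_map ` U)"
proof -
  have UX: "U \<subseteq> topspace X" using openin_subset[OF U] .
  have "{x \<in> topspace X. orbit_map x \<in> orbit_map ` U} = (\<Union>g\<in>\<Gamma>. {x \<in> topspace X. refl g x \<in> U})"
  proof (intro equalityI subsetI)
    fix x assume "x \<in> {x \<in> topspace X. orbit_map x \<in> orbit_map ` U}"
    then obtain u where "x \<in> topspace X" "u \<in> U" "orbit_map x = orbit_map u" by auto
    then show "x \<in> (\<Union>g\<in>\<Gamma>. {x \<in> topspace X. refl g x \<in> U})" using orbit_map_eq_iff[of x u] UX by blast
  next
    fix x assume "x \<in> (\<Union>g\<in>\<Gamma>. {x \<in> topspace X. refl g x \<in> U})"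
    then obtain g where "g \<in> \<Gamma>" "x \<in> topspace X" "refl g x \<in> U" by blast
    then show "x \<in> {x \<in> topspace X. orbit_map x \<in> orbit_map ` U}"
      using orbit_map_eq_iff[of x "refl g x"] UX by blast
  qed
  moreover have "openin X \<dots>"
    using openin_continuous_map_preimage[OF continuous_map_refl U] by (intro openin_Union) auto
  ultimately show ?thesis using UX by (auto simp: M_def openin_quotient_topology)
qed

text \<open>An open neighbourhood of the closed cell: coordinates fixed by c stay on its side of
  1/2, those in \<open>fst c\<close> are unrestricted. The threshold is the fixed point of the
  reflection of [0,1], so a reflection outside \<open>fst c\<close> moves the neighbourhood off
  itself.\<close>

definition nbhd :: "cell \<Rightarrow> (nat \<Rightarrow> real) set" where
  "nbhd c = {x \<in> topspace X. \<forall>i\<in>{1..m} - fst c. if i \<in> snd c then 1/2 < x i else x i < 1/2}"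

lemma nbhdD: "x \<in> nbhd c \<Longrightarrow> i \<in> {1..m} - fst c \<Longrightarrow> if i \<in> snd c then 1/2 < x i else x i < 1/2"
  unfolding nbhd_def by blast

lemma nbhdI:
  "x \<in> topspace X \<Longrightarrow> (\<And>i. i \<in> {1..m} - fst c \<Longrightarrow> if i \<in> snd c then 1/2 < x i else x i < 1/2) \<Longrightarrow> x \<in> nbhd c"
  unfolding nbhd_def by blast

lemma openin_nbhd: "openin X (nbhd c)"
proof -
  let ?U = "\<lambda>i. {x \<in> topspace X. x i \<in> (if i \<in> snd c then {1/2<..} else {..<1/2})}"
  have "openin X ((\<Inter>i\<in>{1..m} - fst c. ?U i) \<inter> topspace X)"
  proof (rule openin_INT)
    fix i assume "i \<in> {1..m} - fst c"
    then have "continuous_map X euclideanreal (\<lambda>x. x i)" using continuous_map_coord by simp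
    then show "openin X (?U i)" by (rule openin_continuous_map_preimage) auto
  qed simp
  moreover have "(\<Inter>i\<in>{1..m} - fst c. ?U i) \<inter> topspace X = nbhd c"
    by (auto simp: nbhd_def split: if_splits)
  ultimately show ?thesis by simp
qed

lemma nbhd_faces: "f \<in> faces c \<Longrightarrow> nbhd f \<subseteq> nbhd c"
  unfolding faces_iff nbhd_def by auto

lemma refl_nbhd:
  assumes "x \<in> nbhd c" shows "refl g x \<in> nbhd (reflect_cell g c)"
proof -
  have x: "x \<in> topspace X" "\<And>i. i \<in> {1..m} - fst c \<Longrightarrow> if i \<in> snd c then 1/2 < x i else x i < 1/2"
    using assms unfolding nbhd_def by blast+
  have "if i \<in> snd (reflect_cell g c) then 1/2 < refl g x i else refl g x i < 1/2"
    if i: "i \<in> {1..m} - fst c" for i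
    using x(2)[OF i] i by (cases "i \<in> g"; cases "i \<in> snd c") (auto simp: refl_def reflect_cell_def)
  then show ?thesis using refl_X[OF x(1)] unfolding nbhd_def fst_reflect_cell by blast
qed

definition W :: "cell set \<Rightarrow> (nat \<Rightarrow> real) set set" where
  "W A = orbit_map ` (\<Union>c\<in>A. nbhd c)"

lemma nbhd_X: "nbhd c \<subseteq> topspace X"
  by (auto simp: nbhd_def)

lemma nbhd_topspace: "x \<in> nbhd c \<Longrightarrow> x \<in> topspace X"
  using nbhd_X by blast

lemma openin_W: "openin M (W A)"
  unfolding W_def by (intro openin_orbit_map_image openin_Union) (auto simp: openin_nbhd)

lemma W_Un: "W (A \<union> B) = W A \<union> W B"
  by (simp add: W_def image_Un)

lemma W_mono: "A \<subseteq> B \<Longrightarrow> W A \<subseteq> W B"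
  unfolding W_def by blast

text \<open>If a point is close to two cells, their intersection is a common face close to it.\<close>

lemma W_Int:
  assumes A: "subcomplex A" and B: "subcomplex B"
  shows "W (A \<inter> B) = W A \<inter> W B"
proof
  show "W (A \<inter> B) \<subseteq> W A \<inter> W B" using W_mono[of "A \<inter> B"] by blast
  show "W A \<inter> W B \<subseteq> W (A \<inter> B)"
  proof
    fix y assume "y \<in> W A \<inter> W B"
    then obtain c x d x' where c: "c \<in> A" "x \<in> nbhd c" "y = orbit_map x"
      and d: "d \<in> B" "x' \<in> nbhd d" "y = orbit_map x'" unfolding W_def by blast
    have x: "x \<in> topspace X" "x' \<in> topspace X" using c(2) d(2) nbhd_X by blast+
    then obtain g where g: "g \<in> \<Gamma>" "x = refl g x'" using c(3) d(3) orbit_map_eq_iff by metis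
    define e where "e = reflect_cell g d"
    have e: "e \<in> B" "x \<in> nbhd e"
      using B d(1) g(1) unfolding e_def subcomplex_def apply blast
      using refl_nbhd[OF d(2), of g] g(2) by (simp add: e_def)
    have ce: "c \<in> cells" "e \<in> cells" using A B c e by (auto simp: subcomplex_def)
    define f where "f = (fst c \<inter> fst e, snd c \<union> snd e)"
    \<comment> \<open>On a coordinate that a cell fixes, x decides the value; hence the two cells
      agree wherever both fix the coordinate, and f is a face of each.\<close>
    have c': "i \<in> {1..m} - fst c \<Longrightarrow> (i \<in> snd c) = (1/2 < x i)"
      and e': "i \<in> {1..m} - fst e \<Longrightarrow> (i \<in> snd e) = (1/2 < x i)" for i
      using c(2) e(2) unfolding nbhd_def by (auto split: if_splits)
    have sc: "snd c \<subseteq> {1..m} - fst c" "snd e \<subseteq> {1..m} - fst e"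
      using cellsD(2,5)[OF ce(1)] cellsD(2,5)[OF ce(2)] by blast+
    have "snd f - fst c = snd c" "snd f - fst e = snd e"
      using sc c' e' unfolding f_def fst_conv snd_conv by blast+
    then have "f \<in> faces c" "f \<in> faces e"
      using sc unfolding faces_iff f_def fst_conv snd_conv by blast+
    then have "f \<in> A \<inter> B" using A B c(1) e(1) unfolding subcomplex_def by blast
    moreover have "x \<in> nbhd f"
    proof -
      have "if i \<in> snd f then 1/2 < x i else x i < 1/2" if i: "i \<in> {1..m} - fst f" for i
      proof (cases "i \<in> fst c")
        case True
        then have "i \<in> {1..m} - fst e" "i \<notin> snd c" using i sc by (auto simp: f_def)
        then show ?thesis using nbhdD[OF e(2), of i] by (simp add: f_def)
      next
        case False
        then have ic: "i \<in> {1..m} - fst c" using i by auto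
        have "i \<in> snd f \<longleftrightarrow> i \<in> snd c" using ic sc c' e' unfolding f_def snd_conv by blast
        then show ?thesis using nbhdD[OF c(2) ic] by simp
      qed
      then show ?thesis by (rule nbhdI[OF x(1)])
    qed
    ultimately show "y \<in> W (A \<inter> B)" using c(3) unfolding W_def by blast
  qed
qed

text \<open>Neighbourhoods of faces are contained in the neighbourhood of c, and those of reflected
  faces have the same image in the quotient.\<close>

lemma W_closed_cell:
  assumes c: "c \<in> cells" shows "W (closed_cell c) = orbit_map ` nbhd c"
proof
  show "W (closed_cell c) \<subseteq> orbit_map ` nbhd c"
  proof
    fix y assume "y \<in> W (closed_cell c)"
    then obtain g f x where g: "g \<in> \<Gamma>" "f \<in> faces c" "x \<in> nbhd (reflect_cell g f)" "y = orbit_map x"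
      unfolding W_def closed_cell_def by blast
    have fc: "f \<in> cells" using g(2) faces_cells[OF c] by blast
    have x: "x \<in> topspace X" using g(3) nbhd_X by blast
    have "refl g x \<in> nbhd (reflect_cell g (reflect_cell g f))" by (rule refl_nbhd[OF g(3)])
    then have "refl g x \<in> nbhd f" by (simp add: reflect_cell_comp reflect_cell_empty[OF fc])
    then have "refl g x \<in> nbhd c" using nbhd_faces[OF g(2)] by blast
    moreover have "orbit_map (refl g x) = y"
      using orbit_map_eq_iff[OF x refl_X[OF x]] g by blast
    ultimately show "y \<in> orbit_map ` nbhd c" by blast
  qed
  have "c \<in> closed_cell c"
    using faces_refl[OF cellsD(2)[OF c]] reflect_cell_empty[OF c] \<Gamma>_empty unfolding closed_cell_def by force
  then show "orbit_map ` nbhd c \<subseteq> W (closed_cell c)" unfolding W_def by blast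
qed

text \<open>A reflected coordinate outside \<open>fst c\<close> would cross 1/2. So a reflection
  relating two points of the neighbourhood lies inside \<open>fst c\<close>, and freeness makes it
  trivial.\<close>

lemma inj_on_orbit_map_nbhd:
  assumes c: "c \<in> cells" shows "inj_on orbit_map (nbhd c)"
proof (rule inj_onI)
  fix x y assume xy: "x \<in> nbhd c" "y \<in> nbhd c" "orbit_map x = orbit_map y"
  have X: "x \<in> topspace X" "y \<in> topspace X" using xy(1,2) nbhd_topspace by blast+
  obtain g where g: "g \<in> \<Gamma>" "y = refl g x" using xy(3) orbit_map_eq_iff[OF X] by blast
  have "i \<in> fst c" if i: "i \<in> g" for i
  proof (rule ccontr)
    assume "i \<notin> fst c"
    moreover have im: "i \<in> {1..m}" using i g(1) \<Gamma>_sub by blast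
    ultimately have "if i \<in> snd c then 1/2 < x i else x i < 1/2" "if i \<in> snd c then 1/2 < y i else y i < 1/2"
      using xy(1,2) unfolding nbhd_def by blast+
    moreover have "y i = 1 - x i" using im i by (simp add: g(2) refl_def)
    ultimately show False by (cases "i \<in> snd c") auto
  qed
  then have "g = {}" using \<Gamma>_free[OF g(1) cellsD(1)[OF c]] by blast
  then show "x = y" using g(2) refl_empty[OF X(1)] by simp
qed

text \<open>A single straight line to a vertex could leave the complex, since x may lie in a cube
  whose free directions are not those of c. The coordinates fixed by c are moved first: this keeps x
  in its own cube, because such a coordinate of x that is already 0 or 1 has the value prescribed by
  c. The endpoint lies in the cube of \<open>fst c\<close>, which is convex, and a second line leads
  to a vertex.\<close>

lemma contractible_nbhd:
  assumes c: "c \<in> cells"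
  shows "contractible_space (subtopology X (nbhd c))"
proof -
  let ?S = "nbhd c"
  let ?Y = "subtopology (powertop_real {1..m}) ?S"
  have Y: "subtopology X ?S = ?Y"
  proof -
    have "(\<Union>\<sigma>\<in>K. cube \<sigma>) \<inter> ?S = ?S" using nbhd_X[of c] by (auto simp: topspace_X)
    then show ?thesis by (simp add: X_eq subtopology_subtopology)
  qed
  have tY: "topspace ?Y = ?S" using nbhd_X[of c] by (auto simp: topspace_X PiE_def)
  define b where "b i = (if i \<in> snd c then 1 else 0 :: real)" for i
  define r where "r x = (\<lambda>i\<in>{1..m}. if i \<in> fst c then x i else b i)" for x :: "nat \<Rightarrow> real"
  define v where "v = (\<lambda>i\<in>{1..m}. b i)"
  have close: "x i = b i" if "x \<in> ?S" "i \<in> {1..m} - fst c" "x i \<in> {0, 1}" for x i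
    using nbhdD[OF that(1,2)] that(3) by (auto simp: b_def split: if_splits)
  have line1: "(\<lambda>i\<in>{1..m}. (1 - t) * id x i + t * r x i) \<in> ?S" if x: "x \<in> ?S" and t: "0 \<le> t" "t \<le> 1" for x t
  proof -
    let ?z = "\<lambda>i\<in>{1..m}. (1 - t) * id x i + t * r x i"
    obtain \<sigma> where \<sigma>: "\<sigma> \<in> K" "x \<in> cube \<sigma>" using nbhd_topspace[OF x] by (auto simp: topspace_X)
    have zi: "?z i = (if i \<in> fst c then x i else (1 - t) * x i + t * b i)" if "i \<in> {1..m}" for i
      using that by (auto simp: r_def algebra_simps)
    have b01: "b i \<in> {0..1}" for i by (simp add: b_def)
    have "?z \<in> cube \<sigma>"
      unfolding cube_def
    proof (intro CollectI conjI ballI impI)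
      fix i assume i: "i \<in> {1..m}"
      have "x i \<in> {0..1}" using \<sigma>(2) i by (auto simp: cube_def)
      moreover have "(1 - t) * x i + t * b i \<in> {0..1}"
        using \<open>x i \<in> {0..1}\<close> b01[of i] t
          convex_bound_le[of "x i" 1 "b i" "1 - t" t] by auto
      ultimately show "?z i \<in> {0..1}" using zi[OF i] by auto
      assume "i \<notin> \<sigma>"
      then have xi: "x i \<in> {0, 1}" using \<sigma>(2) i by (auto simp: cube_def)
      show "?z i \<in> {0, 1}"
      proof (cases "i \<in> fst c")
        case True then show ?thesis using xi zi[OF i] by simp
      next
        case False
        then have "x i = b i" using close[OF x _ xi] i by blast
        then have "(1 - t) * x i + t * b i = x i" by (simp add: algebra_simps)
        then show ?thesis using xi zi[OF i] False by simp
      qed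
    qed
    then have "?z \<in> topspace X" using \<sigma>(1) by (auto simp: topspace_X)
    moreover have "if i \<in> snd c then 1/2 < ?z i else ?z i < 1/2" if i: "i \<in> {1..m} - fst c" for i
    proof -
      have z: "?z i = (1 - t) * x i + t * b i" using zi[of i] i by simp
      have xb: "if i \<in> snd c then 1/2 < x i else x i < 1/2" using nbhdD[OF x i] .
      show ?thesis
      proof (cases "i \<in> snd c")
        case True
        then have "1/2 < x i" "b i = 1" using xb by (simp_all add: b_def)
        then have "1/2 < (1 - t) * x i + t * b i"
          using t convex_bound_lt[of "- x i" "-1/2" "- b i" "1 - t" t] by (simp add: algebra_simps)
        then show ?thesis using True z by simp
      next
        case False
        then have "x i < 1/2" "b i = 0" using xb by (simp_all add: b_def)
        then have "(1 - t) * x i + t * b i < 1/2"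
          using t convex_bound_lt[of "x i" "1/2" "b i" "1 - t" t] by simp
        then show ?thesis using False z by simp
      qed
    qed
    ultimately show ?thesis by (rule nbhdI)
  qed
  have rS: "r x \<in> ?S" if "x \<in> ?S" for x
  proof -
    have "(\<lambda>i\<in>{1..m}. (1 - 1) * id x i + 1 * r x i) = r x" by (auto simp: r_def)
    then show ?thesis using line1[OF that, of 1] by (simp only: zero_le_one order_refl)
  qed
  have line2: "(\<lambda>i\<in>{1..m}. (1 - t) * r x i + t * v i) \<in> ?S" if x: "x \<in> ?S" and t: "0 \<le> t" "t \<le> 1" for x t
  proof -
    let ?z = "\<lambda>i\<in>{1..m}. (1 - t) * r x i + t * v i"
    have zi: "?z i = (if i \<in> fst c then (1 - t) * x i + t * b i else b i)" if "i \<in> {1..m}" for i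
      using that by (auto simp: r_def v_def algebra_simps)
    have b01: "b i \<in> {0, 1}" for i by (simp add: b_def)
    have "?z \<in> cube (fst c)"
      unfolding cube_def
    proof (intro CollectI conjI ballI impI)
      fix i assume i: "i \<in> {1..m}"
      have "x i \<in> {0..1}" using topspace_X_unit_interval[OF nbhd_topspace[OF x] i] .
      then have "(1 - t) * x i + t * b i \<in> {0..1}"
        using b01[of i] t convex_bound_le[of "x i" 1 "b i" "1 - t" t] by auto
      then show "?z i \<in> {0..1}" using zi[OF i] b01[of i] by auto
      show "?z i \<in> {0, 1}" if "i \<notin> fst c" using zi[OF i] b01[of i] that by simp
    qed
    then have "?z \<in> topspace X" using cellsD(1)[OF c] by (auto simp: topspace_X)
    moreover have "if i \<in> snd c then 1/2 < ?z i else ?z i < 1/2" if i: "i \<in> {1..m} - fst c" for i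
      using zi[of i] i by (auto simp: b_def)
    ultimately show ?thesis by (rule nbhdI)
  qed
  have cid: "continuous_map ?Y ?Y id" by (rule continuous_map_id)
  have cr: "continuous_map ?Y ?Y r"
    unfolding continuous_map_in_subtopology continuous_map_componentwise
  proof (intro conjI ballI)
    fix i assume i: "i \<in> {1..m}"
    have "continuous_map ?Y euclideanreal (\<lambda>x. x i)"
      by (intro continuous_map_from_subtopology continuous_map_product_projection i)
    then show "continuous_map ?Y euclideanreal (\<lambda>x. r x i)"
      using i by (cases "i \<in> fst c") (auto simp: r_def)
  qed (use rS tY in \<open>auto simp: r_def\<close>)
  have vS: "v \<in> ?S" if "x \<in> ?S" for x
  proof -
    have "(\<lambda>i\<in>{1..m}. (1 - 1) * r x i + 1 * v i) = v" by (auto simp: v_def)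
    then show ?thesis using line2[OF that, of 1] by (simp only: zero_le_one order_refl)
  qed
  have cv: "continuous_map ?Y ?Y (\<lambda>_. v)" 
  proof (cases "?Y = trivial_topology")
    case False
    then have "?S \<noteq> {}" using tY null_topspace_iff_trivial by metis
    then show ?thesis using vS tY by (auto simp: continuous_map_const)
  qed simp
  have "homotopic_with (\<lambda>_. True) ?Y ?Y id r"
    by (rule homotopic_with_straight_line[OF cid cr]) (simp only: tY line1)
  moreover have "homotopic_with (\<lambda>_. True) ?Y ?Y r (\<lambda>_. v)"
    by (rule homotopic_with_straight_line[OF cr cv]) (simp only: tY line2)
  ultimately have "homotopic_with (\<lambda>_. True) ?Y ?Y id (\<lambda>_. v)" by (rule homotopic_with_trans)
  then show ?thesis unfolding Y contractible_space_def by blast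
qed

text \<open>On the neighbourhood of c the orbit map is injective, continuous and open, so
  contractibility passes to the image.\<close>

lemma contractible_W_closed_cell:
  assumes c: "c \<in> cells"
  shows "contractible_space (subtopology M (W (closed_cell c)))"
proof -
  let ?N = "nbhd c"
  let ?Z = "subtopology M (orbit_map ` ?N)"
  have tN: "topspace (subtopology X ?N) = ?N" using nbhd_X[of c] by auto
  have tZ: "topspace ?Z = orbit_map ` ?N"
    using nbhd_X[of c] by (auto simp: M_def topspace_quotient_topology)
  have q: "continuous_map X M orbit_map"
    unfolding M_def by (rule quotient_imp_continuous_map[OF quotient_map_quotient_topology])
  have "homeomorphic_map (subtopology X ?N) ?Z orbit_map"
  proof (rule bijective_open_imp_homeomorphic_map)
    show "continuous_map (subtopology X ?N) ?Z orbit_map"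
      unfolding continuous_map_in_subtopology
      using continuous_map_from_subtopology[OF q] tN by auto
    show "open_map (subtopology X ?N) ?Z orbit_map"
      unfolding open_map_def
    proof (intro allI impI)
      fix U assume "openin (subtopology X ?N) U"
      then have U: "openin X U" "U \<subseteq> ?N" using openin_nbhd[of c] by (auto simp: openin_open_subtopology)
      then show "openin ?Z (orbit_map ` U)"
        using openin_orbit_map_image[OF U(1)] openin_orbit_map_image[OF openin_nbhd[of c]]
        by (auto simp: openin_open_subtopology)
    qed
  qed (use tN tZ inj_on_orbit_map_nbhd[OF c] in auto)
  then have "subtopology X ?N homeomorphic_space ?Z" by (rule homeomorphic_map_imp_homeomorphic_space)
  then show ?thesis
    using contractible_nbhd[OF c] homeomorphic_space_contractibility W_closed_cell[OF c] by metis
qed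

lemma W_cells: "W cells = topspace M"
proof
  show "W cells \<subseteq> topspace M" using openin_subset[OF openin_W] .
  show "topspace M \<subseteq> W cells"
  proof
    fix y assume "y \<in> topspace M"
    then obtain x where x: "x \<in> topspace X" "y = orbit_map x" by (auto simp: M_def topspace_quotient_topology)
    then obtain \<sigma> where \<sigma>: "\<sigma> \<in> K" "x \<in> cube \<sigma>" by (auto simp: topspace_X)
    define c where "c = (\<sigma>, {i \<in> {1..m} - \<sigma>. x i = 1})"
    have "c \<in> cells" using \<sigma>(1) by (auto simp: cells_def c_def)
    moreover have "x \<in> nbhd c" using x(1) \<sigma>(2) by (auto simp: nbhd_def c_def cube_def)
    ultimately show "y \<in> W cells" using x(2) unfolding W_def by blast
  qed
qed

end

section \<open>Comparison with singular chains\<close>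

context free_reflection_group
begin

abbreviation MW :: "cell set \<Rightarrow> (nat \<Rightarrow> real) set topology" where
  "MW A \<equiv> subtopology M (W A)"

lemma closed_cell_subset: "subcomplex A \<Longrightarrow> c \<in> A \<Longrightarrow> closed_cell c \<subseteq> A"
  unfolding closed_cell_def subcomplex_def by blast

lemma faces_closed_cell:
  assumes "c \<in> cells" "f \<in> faces c" shows "f \<in> closed_cell c"
proof -
  have "reflect_cell {} f \<in> closed_cell c" using assms(2) \<Gamma>_empty unfolding closed_cell_def by blast
  then show ?thesis using reflect_cell_empty faces_cells[OF assms(1)] assms(2) by fastforce
qed

lemma mem_closed_cell: "c \<in> cells \<Longrightarrow> c \<in> closed_cell c"
  using faces_closed_cell faces_refl cellsD(2) by blast

lemma W_acyclic:
  assumes "c \<in> cells" "singular_chain p (MW (closed_cell c)) z" "chain_boundary p z = 0"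
    and "p = 0 \<Longrightarrow> augmentation z = 0"
  obtains e where "singular_chain (Suc p) (MW (closed_cell c)) e" "chain_boundary (Suc p) e = z"
  using contractible_space_imp_homologous[OF contractible_W_closed_cell[OF assms(1)] assms(2-4)] by blast

lemma W_closed_cell_nonempty_chain:
  assumes "c \<in> orbit_cells cells 0"
  obtains z where "singular_chain 0 (MW (closed_cell c)) z" "augmentation z = frag_of ()"
proof -
  have c: "c \<in> cells" "fst c = {}"
    using assms cellsD(3)[of c] by (auto simp: orbit_cells_def)
  define x where "x = (\<lambda>i\<in>{1..m}. if i \<in> snd c then 1 else 0 :: real)"
  have "x \<in> cube {}" by (auto simp: x_def cube_def)
  then have "x \<in> topspace X" using cellsD(1)[OF c(1)] c(2) by (auto simp: topspace_X x_def)
  then have "x \<in> nbhd c" by (rule nbhdI) (auto simp: x_def)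
  then have y: "orbit_map x \<in> topspace (MW (closed_cell c))"
    using W_closed_cell[OF c(1)] openin_subset[OF openin_W[of "closed_cell c"]] by auto
  have "singular_simplex 0 (MW (closed_cell c)) (restrict (\<lambda>_. orbit_map x) (standard_simplex 0))"
    using y by (auto simp: singular_simplex_def continuous_map_const)
  then show thesis using that[of "frag_of (restrict (\<lambda>_. orbit_map x) (standard_simplex 0))"]
    by (simp add: singular_chain_of)
qed

lemma W_chain_mono:
  "singular_chain p (MW A) z \<Longrightarrow> A \<subseteq> B \<Longrightarrow> singular_chain p (MW B) z"
  using singular_chain_mono W_mono by blast

lemma W_Un_decompose:
  assumes "singular_chain p (MW (A \<union> B)) c" "chain_boundary p c = u + v"
    "singular_chain (p - Suc 0) (MW A) u" "singular_chain (p - Suc 0) (MW B) v" "p = 0 \<Longrightarrow> u = 0 \<and> v = 0"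
  shows "\<exists>a b e. singular_chain p (MW A) a \<and> singular_chain p (MW B) b \<and>
    singular_chain (Suc p) (MW (A \<union> B)) e \<and> c = a + b + chain_boundary (Suc p) e"
  using singular_chain_Un_decompose[OF openin_W[of A] openin_W[of B] assms(1)[unfolded W_Un] assms(2-5), folded W_Un]
  by metis

lemma carried_extend:
  assumes F: "\<And>c. c \<in> orbit_cells cells p \<Longrightarrow> singular_chain p (MW (closed_cell c)) (F c)"
    and A: "subcomplex A" and x: "Poly_Mapping.keys x \<subseteq> orbit_cells A p"
  shows "singular_chain p (MW A) (frag_extend F x)"
proof (rule singular_chain_extend)
  fix c assume "c \<in> Poly_Mapping.keys x"
  then have c: "c \<in> orbit_cells A p" using x by blast
  then have "c \<in> A" "c \<in> orbit_cells cells p" using A by (auto simp: orbit_cells_def subcomplex_def)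
  then show "singular_chain p (MW A) (F c)" using W_chain_mono[OF F] closed_cell_subset[OF A] by blast
qed

lemma orbit_boundary_of_cell:
  assumes "c \<in> orbit_cells cells (Suc p)"
  shows "Poly_Mapping.keys (orbit_boundary (frag_of c)) \<subseteq> orbit_cells (closed_cell c) p"
proof (rule keys_orbit_boundary)
  have c: "c \<in> cells" using assms by (simp add: orbit_cells_def)
  show "subcomplex (closed_cell c)" by (rule subcomplex_closed_cell[OF c])
  show "Poly_Mapping.keys (frag_of c) \<subseteq> orbit_cells (closed_cell c) (Suc p)"
    using assms mem_closed_cell[OF c] by (auto simp: orbit_cells_def)
qed

lemma augmentation_orbit_boundary:
  assumes "Poly_Mapping.keys x \<subseteq> orbit_cells cells (Suc 0)"
  shows "augmentation (orbit_boundary x) = 0"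
proof -
  have "Poly_Mapping.keys (cube_boundary x) \<subseteq> {c. card (fst c) = 0} \<inter> cells"
    by (rule keys_cube_boundary) (use assms faces_cells cellsD(2) in \<open>auto simp: orbit_cells_def\<close>)
  then have "augmentation (orbit_boundary x) = augmentation (cube_boundary x)"
    unfolding orbit_boundary_def by (intro augmentation_to_reps) blast
  also have "\<dots> = 0"
    using assms by (intro augmentation_cube_boundary) (auto simp: orbit_cells_def)
  finally show ?thesis .
qed

text \<open>The image of the boundary of a cell is a cycle in the contractible carrier of that cell
  and can be filled there. For a cell of dimension 1 this also requires augmentation 0, which is why
  the map is made to preserve augmentations in degree 0.\<close>

lemma carried_chain_map_exists:
  obtains \<phi> :: "cell \<Rightarrow> (nat \<Rightarrow> real) set chain"
  where "\<And>p c. c \<in> orbit_cells cells p \<Longrightarrow> singular_chain p (MW (closed_cell c)) (\<phi> c)"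
    and "\<And>x. Poly_Mapping.keys x \<subseteq> orbit_cells cells 0 \<Longrightarrow> augmentation (frag_extend \<phi> x) = augmentation x"
    and "\<And>p x. Poly_Mapping.keys x \<subseteq> orbit_cells cells p \<Longrightarrow>
           chain_boundary p (frag_extend \<phi> x) = frag_extend \<phi> (orbit_boundary x)"
proof -
  let ?carr = "\<lambda>p F. \<forall>c\<in>orbit_cells cells p. singular_chain p (MW (closed_cell c)) (F c)"
  \<comment> \<open>That cycles go to cycles is the part of the invariant that permits filling in
    the next degree.\<close>
  let ?J = "\<lambda>p F. ?carr p F \<and>
      (p = 0 \<longrightarrow> (\<forall>c\<in>orbit_cells cells 0. augmentation (F c) = frag_of ())) \<and>
      (\<forall>y. Poly_Mapping.keys y \<subseteq> orbit_cells cells p \<and> orbit_boundary y = 0 \<longrightarrow> chain_boundary p (frag_extend F y) = 0)"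
  let ?R = "\<lambda>p F F'. \<forall>c\<in>orbit_cells cells (Suc p).
      chain_boundary (Suc p) (F' c) = frag_extend F (orbit_boundary (frag_of c))"
  have aug0: "augmentation (frag_extend F x) = augmentation x"
    if "?J 0 F" "Poly_Mapping.keys x \<subseteq> orbit_cells cells 0" for F x
    using that(2)
    by (rule frag_additive_eqI[where f = "\<lambda>x. augmentation (frag_extend F x)" and g = augmentation])
      (use that(1) in \<open>auto simp: frag_extend_diff\<close>)
  have Rext: "chain_boundary (Suc p) (frag_extend F' x) = frag_extend F (orbit_boundary x)"
    if "?R p F F'" "Poly_Mapping.keys x \<subseteq> orbit_cells cells (Suc p)" for p F F' x
    using that(2)
    by (rule frag_additive_eqI[where f = "\<lambda>x. chain_boundary (Suc p) (frag_extend F' x)"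
          and g = "\<lambda>x. frag_extend F (orbit_boundary x)"])
      (use that(1) in \<open>auto simp: frag_extend_diff chain_boundary_diff\<close>)
  have base: "\<exists>F. ?J 0 F"
  proof -
    have "\<forall>c\<in>orbit_cells cells 0. \<exists>z. singular_chain 0 (MW (closed_cell c)) z \<and> augmentation z = frag_of ()"
      using W_closed_cell_nonempty_chain by metis
    then obtain F where "\<And>c. c \<in> orbit_cells cells 0 \<Longrightarrow>
        singular_chain 0 (MW (closed_cell c)) (F c) \<and> augmentation (F c) = frag_of ()" by metis
    then show ?thesis by (intro exI[of _ F]) (auto simp: chain_boundary_def)
  qed
  have step: "\<exists>F'. ?J (Suc p) F' \<and> ?R p F F'" if J: "?J p F" for p F
  proof -
    have "\<exists>z. singular_chain (Suc p) (MW (closed_cell c)) z \<and>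
            chain_boundary (Suc p) z = frag_extend F (orbit_boundary (frag_of c))"
      if c: "c \<in> orbit_cells cells (Suc p)" for c
    proof -
      have cc: "c \<in> cells" using c by (simp add: orbit_cells_def)
      have sc: "subcomplex (closed_cell c)" by (rule subcomplex_closed_cell[OF cc])
      let ?y = "orbit_boundary (frag_of c)"
      have y: "Poly_Mapping.keys ?y \<subseteq> orbit_cells (closed_cell c) p" by (rule orbit_boundary_of_cell[OF c])
      have y': "Poly_Mapping.keys ?y \<subseteq> orbit_cells cells p"
        using y sc by (auto simp: orbit_cells_def subcomplex_def)
      have "orbit_boundary ?y = 0" by (rule orbit_boundary_boundary) (use cc in simp)
      then have bd: "chain_boundary p (frag_extend F ?y) = 0" using J y' by blast
      have "augmentation (frag_extend F ?y) = 0" if "p = 0"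
      proof -
        have "?J 0 F" using J unfolding that .
        moreover have "Poly_Mapping.keys ?y \<subseteq> orbit_cells cells 0" using y' unfolding that .
        ultimately have "augmentation (frag_extend F ?y) = augmentation ?y" by (rule aug0)
        also have "\<dots> = 0" by (rule augmentation_orbit_boundary) (use c that in simp)
        finally show ?thesis .
      qed
      moreover have "singular_chain p (MW (closed_cell c)) (frag_extend F ?y)"
        by (rule carried_extend[OF _ sc y]) (use J in blast)
      ultimately show ?thesis using W_acyclic[OF cc _ bd] by metis
    qed
    then obtain F' where F': "\<And>c. c \<in> orbit_cells cells (Suc p) \<Longrightarrow> singular_chain (Suc p) (MW (closed_cell c)) (F' c) \<and>
            chain_boundary (Suc p) (F' c) = frag_extend F (orbit_boundary (frag_of c))" by metis
    then have R: "?R p F F'" by blast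
    have "chain_boundary (Suc p) (frag_extend F' y) = 0"
      if "Poly_Mapping.keys y \<subseteq> orbit_cells cells (Suc p)" "orbit_boundary y = 0" for y
      using Rext[OF R that(1)] that(2) by simp
    then show ?thesis using F' R by (intro exI[of _ F']) auto
  qed
  have "\<exists>s. \<forall>p. ?J p (s p) \<and> ?R p (s p) (s (Suc p))"
  proof (rule dependent_nat_choice)
    show "\<exists>F. ?J 0 F" by (rule base)
    show "\<exists>F'. ?J (Suc p) F' \<and> ?R p F F'" if "?J p F" for p F using step[OF that] .
  qed
  then obtain s where s0: "\<forall>p. ?J p (s p) \<and> ?R p (s p) (s (Suc p))" by (elim exE)
  have s: "?J p (s p)" "?R p (s p) (s (Suc p))" for p
    using spec[OF s0, of p] by (rule conjunct1, rule conjunct2)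
  \<comment> \<open>The number of free coordinates recovers the degree, so a single function serves
    all degrees.\<close>
  define \<phi> where "\<phi> c = s (card (fst c)) c" for c
  have ext: "frag_extend \<phi> x = frag_extend (s p) x" if "Poly_Mapping.keys x \<subseteq> orbit_cells cells p" for x p
    by (rule frag_extend_eq) (use that in \<open>auto simp: \<phi>_def orbit_cells_def\<close>)
  show thesis
  proof
    show "singular_chain p (MW (closed_cell c)) (\<phi> c)" if "c \<in> orbit_cells cells p" for p c
    proof -
      have "card (fst c) = p" using that unfolding orbit_cells_def by blast
      then show ?thesis using s(1)[of p] that unfolding \<phi>_def by blast
    qed
    show "augmentation (frag_extend \<phi> x) = augmentation x" if "Poly_Mapping.keys x \<subseteq> orbit_cells cells 0" for x
      using aug0[OF s(1) that] ext[OF that] by simp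
    show "chain_boundary p (frag_extend \<phi> x) = frag_extend \<phi> (orbit_boundary x)"
      if x: "Poly_Mapping.keys x \<subseteq> orbit_cells cells p" for p x
    proof (cases p)
      case 0
      then show ?thesis using orbit_boundary_0[of x cells] x by (simp add: chain_boundary_def)
    next
      case (Suc q)
      have "Poly_Mapping.keys (orbit_boundary x) \<subseteq> orbit_cells cells q"
        using keys_orbit_boundary[OF subcomplex_cells] x Suc by simp
      then show ?thesis using Rext[OF s(2)[of q]] x ext Suc by simp
    qed
  qed
qed

text \<open>One choice for the whole complex, so that the comparison maps over subcomplexes are
  restrictions of each other, as Mayer--Vietoris requires.\<close>

definition \<phi> :: "cell \<Rightarrow> (nat \<Rightarrow> real) set chain" where
  "\<phi> = (SOME \<phi>. (\<forall>p c. c \<in> orbit_cells cells p \<longrightarrow> singular_chain p (MW (closed_cell c)) (\<phi> c)) \<and>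
     (\<forall>x. Poly_Mapping.keys x \<subseteq> orbit_cells cells 0 \<longrightarrow> augmentation (frag_extend \<phi> x) = augmentation x) \<and>
     (\<forall>p x. Poly_Mapping.keys x \<subseteq> orbit_cells cells p \<longrightarrow>
           chain_boundary p (frag_extend \<phi> x) = frag_extend \<phi> (orbit_boundary x)))"

definition \<Phi> :: "(cell \<Rightarrow>\<^sub>0 int) \<Rightarrow> (nat \<Rightarrow> real) set chain" where
  "\<Phi> = frag_extend \<phi>"

lemma \<Phi>_simps [simp]:
  "\<Phi> 0 = 0" "\<Phi> (a - b) = \<Phi> a - \<Phi> b" "\<Phi> (a + b) = \<Phi> a + \<Phi> b" "\<Phi> (- a) = - \<Phi> a"
  by (simp_all add: \<Phi>_def frag_extend_diff frag_extend_add frag_extend_minus)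

lemma
  shows carried_\<phi>: "\<And>p c. c \<in> orbit_cells cells p \<Longrightarrow> singular_chain p (MW (closed_cell c)) (\<phi> c)"
    and augmentation_\<Phi>: "\<And>x. Poly_Mapping.keys x \<subseteq> orbit_cells cells 0 \<Longrightarrow> augmentation (\<Phi> x) = augmentation x"
    and boundary_\<Phi>: "\<And>p x. Poly_Mapping.keys x \<subseteq> orbit_cells cells p \<Longrightarrow>
           chain_boundary p (\<Phi> x) = \<Phi> (orbit_boundary x)"
proof -
  have "\<exists>\<phi> :: cell \<Rightarrow> (nat \<Rightarrow> real) set chain.
     (\<forall>p c. c \<in> orbit_cells cells p \<longrightarrow> singular_chain p (MW (closed_cell c)) (\<phi> c)) \<and>
     (\<forall>x. Poly_Mapping.keys x \<subseteq> orbit_cells cells 0 \<longrightarrow> augmentation (frag_extend \<phi> x) = augmentation x) \<and>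
     (\<forall>p x. Poly_Mapping.keys x \<subseteq> orbit_cells cells p \<longrightarrow>
           chain_boundary p (frag_extend \<phi> x) = frag_extend \<phi> (orbit_boundary x))"
    using carried_chain_map_exists by metis
  from someI_ex[OF this, folded \<phi>_def]
  have *: "(\<forall>p c. c \<in> orbit_cells cells p \<longrightarrow> singular_chain p (MW (closed_cell c)) (\<phi> c)) \<and>
     (\<forall>x. Poly_Mapping.keys x \<subseteq> orbit_cells cells 0 \<longrightarrow> augmentation (\<Phi> x) = augmentation x) \<and>
     (\<forall>p x. Poly_Mapping.keys x \<subseteq> orbit_cells cells p \<longrightarrow> chain_boundary p (\<Phi> x) = \<Phi> (orbit_boundary x))"
    by (simp only: \<Phi>_def)
  show "\<And>p c. c \<in> orbit_cells cells p \<Longrightarrow> singular_chain p (MW (closed_cell c)) (\<phi> c)"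
    "\<And>x. Poly_Mapping.keys x \<subseteq> orbit_cells cells 0 \<Longrightarrow> augmentation (\<Phi> x) = augmentation x"
    "\<And>p x. Poly_Mapping.keys x \<subseteq> orbit_cells cells p \<Longrightarrow> chain_boundary p (\<Phi> x) = \<Phi> (orbit_boundary x)"
    using * by blast+
qed

lemma singular_chain_\<Phi>:
  "subcomplex A \<Longrightarrow> Poly_Mapping.keys x \<subseteq> orbit_cells A p \<Longrightarrow> singular_chain p (MW A) (\<Phi> x)"
  unfolding \<Phi>_def by (rule carried_extend[OF carried_\<phi>])

lemma orbit_cells_mono: "A \<subseteq> B \<Longrightarrow> orbit_cells A p \<subseteq> orbit_cells B p"
  unfolding orbit_cells_def by blast

lemma orbit_cells_subcomplex: "subcomplex A \<Longrightarrow> orbit_cells A p \<subseteq> orbit_cells cells p"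
  using orbit_cells_mono unfolding subcomplex_def by blast

text \<open>
  Acyclicity of the mapping cone of \<open>\<Phi>\<close> over \<open>A\<close>; the degree \<open>0\<close> part has no
  component in the orbit complex.
\<close>

definition cone_acyclic :: "cell set \<Rightarrow> bool" where
  "cone_acyclic A \<longleftrightarrow>
     (\<forall>c. singular_chain 0 (MW A) c \<longrightarrow>
        (\<exists>d' c'. Poly_Mapping.keys d' \<subseteq> orbit_cells A 0 \<and> singular_chain 1 (MW A) c' \<and>
                 c = \<Phi> d' + chain_boundary 1 c')) \<and>
     (\<forall>p c d. singular_chain (Suc p) (MW A) c \<longrightarrow> Poly_Mapping.keys d \<subseteq> orbit_cells A p \<longrightarrow>
        orbit_boundary d = 0 \<longrightarrow> chain_boundary (Suc p) c = \<Phi> d \<longrightarrow>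
        (\<exists>d' c'. Poly_Mapping.keys d' \<subseteq> orbit_cells A (Suc p) \<and> singular_chain (Suc (Suc p)) (MW A) c' \<and>
                 d = orbit_boundary d' \<and> c = \<Phi> d' + chain_boundary (Suc (Suc p)) c'))"

lemma cone_acyclic_empty: "cone_acyclic {}"
proof -
  have "topspace (MW {}) = {}" by (simp add: W_def)
  then have "singular_chain p (MW {}) c \<longleftrightarrow> c = 0" for p c by (rule singular_chain_empty)
  then show ?thesis unfolding cone_acyclic_def by (simp add: orbit_cells_def)
qed

text \<open>Orbit chains of a closed cell and singular chains of its neighbourhood are both acyclic
  up to augmentation, which \<Phi> preserves. So d bounds some d', and z - \<Phi> d' is a cycle that
  bounds. In degree 0 a multiple of one vertex of c first absorbs the augmentation of z.\<close>

lemma cone_acyclic_closed_cell: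
  assumes c: "c \<in> cells" shows "cone_acyclic (closed_cell c)"
  unfolding cone_acyclic_def
proof (intro conjI allI impI)
  let ?A = "closed_cell c"
  have sc: "subcomplex ?A" by (rule subcomplex_closed_cell[OF c])
  note bdP = boundary_\<Phi>[OF order_trans[OF _ orbit_cells_subcomplex[OF sc]]]
  note augP = augmentation_\<Phi>[OF order_trans[OF _ orbit_cells_subcomplex[OF sc]]]
  fix z assume z: "singular_chain 0 (MW ?A) z"
  let ?v = "frag_of (rep ({}, snd c))"
  have v: "({}, snd c) \<in> faces c" using cellsD(2)[OF c] unfolding faces_iff by auto
  then have vc: "({}, snd c) \<in> cells" using faces_cells[OF c] by blast
  have vA: "({}, snd c) \<in> ?A" by (rule faces_closed_cell[OF c v])
  have "rep ({}, snd c) \<in> ?A"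
    using sc vA to_rep(1)[of "({}, snd c)"] unfolding subcomplex_def to_rep(2)[symmetric] by blast
  then have "rep ({}, snd c) \<in> orbit_cells ?A 0"
    using rep_in_reps[OF vc] unfolding orbit_cells_def by simp
  then have kv: "Poly_Mapping.keys ?v \<subseteq> orbit_cells ?A 0" by simp
  define d' where "d' = frag_cmul (Poly_Mapping.lookup (augmentation z) ()) ?v"
  have kd: "Poly_Mapping.keys d' \<subseteq> orbit_cells ?A 0"
    unfolding d'_def using kv keys_cmul by blast
  have "augmentation d' = augmentation z"
    using unit_frag_eq[of "augmentation z"] by (simp add: d'_def)
  then have "augmentation (z - \<Phi> d') = 0" using augP[OF kd] by simp
  moreover have "singular_chain 0 (MW ?A) (z - \<Phi> d')"
    using z singular_chain_\<Phi>[OF sc kd] by (rule singular_chain_diff)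
  moreover have "chain_boundary 0 (z - \<Phi> d') = 0" by (simp add: chain_boundary_def)
  ultimately obtain e where "singular_chain (Suc 0) (MW ?A) e" "chain_boundary (Suc 0) e = z - \<Phi> d'"
    using W_acyclic[OF c] by blast
  then show "\<exists>d' c'. Poly_Mapping.keys d' \<subseteq> orbit_cells ?A 0 \<and> singular_chain 1 (MW ?A) c' \<and>
                 z = \<Phi> d' + chain_boundary 1 c'"
    using kd by (intro exI[of _ d'] exI[of _ e]) simp
next
  let ?A = "closed_cell c"
  have sc: "subcomplex ?A" by (rule subcomplex_closed_cell[OF c])
  note bdP = boundary_\<Phi>[OF order_trans[OF _ orbit_cells_subcomplex[OF sc]]]
  note augP = augmentation_\<Phi>[OF order_trans[OF _ orbit_cells_subcomplex[OF sc]]]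
  fix p z d assume z: "singular_chain (Suc p) (MW ?A) z" and d: "Poly_Mapping.keys d \<subseteq> orbit_cells ?A p"
    and bd: "orbit_boundary d = 0" "chain_boundary (Suc p) z = \<Phi> d"
  have "augmentation d = 0" if "p = 0"
  proof -
    have "augmentation d = augmentation (\<Phi> d)" using augP[of d] d that by simp
    then show ?thesis using augmentation_chain_boundary[of z] bd(2) that by simp
  qed
  then obtain d' where d': "Poly_Mapping.keys d' \<subseteq> orbit_cells ?A (Suc p)" "orbit_boundary d' = d"
    using orbit_complex_closed_cell_acyclic[OF c d bd(1)] by blast
  have "singular_chain (Suc p) (MW ?A) (z - \<Phi> d')"
    using z singular_chain_\<Phi>[OF sc d'(1)] by (rule singular_chain_diff)
  moreover have "chain_boundary (Suc p) (z - \<Phi> d') = 0"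
    using bdP[OF d'(1)] bd(2) d'(2) by (simp add: chain_boundary_diff)
  ultimately obtain e where "singular_chain (Suc (Suc p)) (MW ?A) e" "chain_boundary (Suc (Suc p)) e = z - \<Phi> d'"
    using W_acyclic[OF c] by blast
  then show "\<exists>d' c'. Poly_Mapping.keys d' \<subseteq> orbit_cells ?A (Suc p) \<and> singular_chain (Suc (Suc p)) (MW ?A) c' \<and>
                 d = orbit_boundary d' \<and> z = \<Phi> d' + chain_boundary (Suc (Suc p)) c'"
    using d' by (intro exI[of _ d'] exI[of _ e]) simp
qed

text \<open>Mayer--Vietoris, chasing elements of the mapping cones.\<close>

lemma cone_acyclic_Un:
  assumes A: "subcomplex A" "cone_acyclic A" and B: "subcomplex B" "cone_acyclic B"
    and AB: "cone_acyclic (A \<inter> B)"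
  shows "cone_acyclic (A \<union> B)"
  unfolding cone_acyclic_def
proof (intro conjI allI impI)
  have oU: "orbit_cells A p \<union> orbit_cells B p = orbit_cells (A \<union> B) p" for p
    by (auto simp: orbit_cells_def)
  have key: "Poly_Mapping.keys (x + y) \<subseteq> orbit_cells (A \<union> B) p"
    if "Poly_Mapping.keys x \<subseteq> orbit_cells A p" "Poly_Mapping.keys y \<subseteq> orbit_cells B p" for x y :: "cell \<Rightarrow>\<^sub>0 int" and p
    using that oU[of p] by (intro keys_add_subset) blast+
  {
    fix c assume c: "singular_chain 0 (MW (A \<union> B)) c"
    have bd0: "chain_boundary 0 c = 0 + 0" by (simp add: chain_boundary_def)
    obtain a b e where abe: "singular_chain 0 (MW A) a" "singular_chain 0 (MW B) b"
      "singular_chain (Suc 0) (MW (A \<union> B)) e" "c = a + b + chain_boundary (Suc 0) e"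
      using W_Un_decompose[OF c bd0] by auto
    obtain d1 c1 where 1: "Poly_Mapping.keys d1 \<subseteq> orbit_cells A 0" "singular_chain 1 (MW A) c1"
       "a = \<Phi> d1 + chain_boundary 1 c1" using A(2) abe(1) unfolding cone_acyclic_def by blast
    obtain d2 c2 where 2: "Poly_Mapping.keys d2 \<subseteq> orbit_cells B 0" "singular_chain 1 (MW B) c2"
       "b = \<Phi> d2 + chain_boundary 1 c2" using B(2) abe(2) unfolding cone_acyclic_def by blast
    have "singular_chain 1 (MW (A \<union> B)) (c1 + c2 + e)"
      using W_chain_mono[OF 1(2), of "A \<union> B"] W_chain_mono[OF 2(2), of "A \<union> B"] abe(3)
      by (intro singular_chain_add) auto
    moreover have "c = \<Phi> (d1 + d2) + chain_boundary 1 (c1 + c2 + e)"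
      using abe(4) 1(3) 2(3) by (simp add: chain_boundary_add)
    ultimately show "\<exists>d' c'. Poly_Mapping.keys d' \<subseteq> orbit_cells (A \<union> B) 0 \<and> singular_chain 1 (MW (A \<union> B)) c' \<and>
                 c = \<Phi> d' + chain_boundary 1 c'" using key[OF 1(1) 2(1)] by blast
  }
  fix p c d assume c: "singular_chain (Suc p) (MW (A \<union> B)) c" and d: "Poly_Mapping.keys d \<subseteq> orbit_cells (A \<union> B) p"
    and bd: "orbit_boundary d = 0" "chain_boundary (Suc p) c = \<Phi> d"
  obtain dA dB where dAB: "Poly_Mapping.keys dA \<subseteq> orbit_cells A p" "Poly_Mapping.keys dB \<subseteq> orbit_cells B p" "dA + dB = d"
    using frag_split[of d "orbit_cells A p" "orbit_cells B p"] d oU by metis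
  have bdc: "chain_boundary (Suc p) c = \<Phi> dA + \<Phi> dB" using bd(2) dAB(3) by auto
  obtain a b e where abe: "singular_chain (Suc p) (MW A) a" "singular_chain (Suc p) (MW B) b"
      "singular_chain (Suc (Suc p)) (MW (A \<union> B)) e" "c = a + b + chain_boundary (Suc (Suc p)) e"
    using W_Un_decompose[OF c bdc] singular_chain_\<Phi>[OF A(1) dAB(1)] singular_chain_\<Phi>[OF B(1) dAB(2)] by auto
  \<comment> \<open>The defect of (a, dA) from being a cone cycle over A. Since c is a cycle
    relative to d, it equals minus the corresponding defect over B, hence is a chain in the
    intersection.\<close>
  define x where "x = chain_boundary (Suc p) a - \<Phi> dA"
  have "chain_boundary (Suc p) c = chain_boundary (Suc p) a + chain_boundary (Suc p) b"
    using chain_boundary_boundary_alt[OF abe(3)] by (simp add: abe(4) chain_boundary_add)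
  then have x': "x = \<Phi> dB - chain_boundary (Suc p) b"
    using bdc by (simp add: x_def algebra_simps)
  have xA: "singular_chain p (MW A) x"
    unfolding x_def using singular_chain_boundary_alt[OF abe(1)] singular_chain_\<Phi>[OF A(1) dAB(1)] by (rule singular_chain_diff)
  have xB: "singular_chain p (MW B) x"
    unfolding x' using singular_chain_\<Phi>[OF B(1) dAB(2)] singular_chain_boundary_alt[OF abe(2)] by (rule singular_chain_diff)
  have x: "singular_chain p (MW (A \<inter> B)) x" unfolding W_Int[OF A(1) B(1)] by (rule singular_chain_Int[OF xA xB])
  have bdx: "chain_boundary p x = \<Phi> (orbit_boundary (- dA))"
    using boundary_\<Phi>[OF order_trans[OF dAB(1) orbit_cells_subcomplex[OF A(1)]]] chain_boundary_boundary_alt[OF abe(1)]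
    by (simp add: x_def chain_boundary_diff)
  \<comment> \<open>Acyclicity over the intersection is applied to the pair of x and the boundary of
    -dA; for p = 0 the second entry is zero and only x remains.\<close>
  have "\<exists>d0 c0. Poly_Mapping.keys d0 \<subseteq> orbit_cells (A \<inter> B) p \<and> singular_chain (Suc p) (MW (A \<inter> B)) c0 \<and>
     orbit_boundary (- dA) = orbit_boundary d0 \<and> x = \<Phi> d0 + chain_boundary (Suc p) c0"
  proof (cases p)
    case 0
    have "Poly_Mapping.keys dA \<subseteq> orbit_cells A 0" using dAB(1) 0 by simp
    then have "orbit_boundary (- dA) = 0" by (simp add: orbit_boundary_0)
    moreover obtain d0 c0 where "Poly_Mapping.keys d0 \<subseteq> orbit_cells (A \<inter> B) 0" "singular_chain 1 (MW (A \<inter> B)) c0"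
      "x = \<Phi> d0 + chain_boundary 1 c0" using AB x 0 unfolding cone_acyclic_def by blast
    ultimately show ?thesis using 0 orbit_boundary_0[of d0] by (intro exI[of _ d0] exI[of _ c0]) simp
  next
    case (Suc q)
    have "Poly_Mapping.keys (orbit_boundary dA) \<subseteq> orbit_cells A q"
      using keys_orbit_boundary[OF A(1)] dAB(1) Suc by simp
    moreover have "orbit_boundary dA = orbit_boundary (- dB)" using bd(1) dAB(3) by (auto simp: eq_neg_iff_add_eq_0)
    moreover have "Poly_Mapping.keys (orbit_boundary (- dB)) \<subseteq> orbit_cells B q"
      using keys_orbit_boundary[OF B(1)] dAB(2) Suc by simp
    ultimately have "Poly_Mapping.keys (orbit_boundary (- dA)) \<subseteq> orbit_cells (A \<inter> B) q"
      unfolding orbit_cells_def by auto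
    moreover have "orbit_boundary (orbit_boundary (- dA)) = 0"
      by (rule orbit_boundary_boundary) (use dAB(1) orbit_cells_sub[of A p] in auto)
    ultimately show ?thesis
      using AB x bdx unfolding Suc cone_acyclic_def by blast
  qed
  then obtain d0 c0 where 0: "Poly_Mapping.keys d0 \<subseteq> orbit_cells (A \<inter> B) p" "singular_chain (Suc p) (MW (A \<inter> B)) c0"
     "orbit_boundary (- dA) = orbit_boundary d0" "x = \<Phi> d0 + chain_boundary (Suc p) c0" by blast
  have sub0: "Poly_Mapping.keys d0 \<subseteq> orbit_cells A p" "Poly_Mapping.keys d0 \<subseteq> orbit_cells B p"
    using 0(1) unfolding orbit_cells_def by blast+
  have c0: "singular_chain (Suc p) (MW A) c0" "singular_chain (Suc p) (MW B) c0"
    using W_chain_mono[OF 0(2)] by auto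
  \<comment> \<open>Moving d0 and c0 from one side to the other turns both pieces into cone cycles,
    over A and over B, without changing their sum.\<close>
  have oA: "orbit_boundary (dA + d0) = 0" using 0(3) by (simp add: eq_neg_iff_add_eq_0 neg_eq_iff_add_eq_0)
  moreover have "orbit_boundary (dB - d0) = orbit_boundary d - orbit_boundary (dA + d0)"
    using dAB(3) by (auto simp: algebra_simps)
  ultimately have oB: "orbit_boundary (dB - d0) = 0" using bd(1) by simp
  have bA: "chain_boundary (Suc p) (a - c0) = \<Phi> (dA + d0)"
    using 0(4) by (simp add: x_def chain_boundary_diff algebra_simps)
  have bB: "chain_boundary (Suc p) (b + c0) = \<Phi> (dB - d0)"
    using 0(4) by (simp add: x' chain_boundary_add algebra_simps)
  have kA: "Poly_Mapping.keys (dA + d0) \<subseteq> orbit_cells A p" using dAB(1) sub0(1) by (rule keys_add_subset)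
  have kB: "Poly_Mapping.keys (dB - d0) \<subseteq> orbit_cells B p" using dAB(2) sub0(2) by (rule keys_diff_subset)
  obtain d1 c1 where 1: "Poly_Mapping.keys d1 \<subseteq> orbit_cells A (Suc p)" "singular_chain (Suc (Suc p)) (MW A) c1"
      "dA + d0 = orbit_boundary d1" "a - c0 = \<Phi> d1 + chain_boundary (Suc (Suc p)) c1"
    using A(2) singular_chain_diff[OF abe(1) c0(1)] kA oA bA unfolding cone_acyclic_def by blast
  obtain d2 c2 where 2: "Poly_Mapping.keys d2 \<subseteq> orbit_cells B (Suc p)" "singular_chain (Suc (Suc p)) (MW B) c2"
      "dB - d0 = orbit_boundary d2" "b + c0 = \<Phi> d2 + chain_boundary (Suc (Suc p)) c2"
    using B(2) singular_chain_add[OF abe(2) c0(2)] kB oB bB unfolding cone_acyclic_def by blast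
  have "singular_chain (Suc (Suc p)) (MW (A \<union> B)) (c1 + c2 + e)"
    using W_chain_mono[OF 1(2), of "A \<union> B"] W_chain_mono[OF 2(2), of "A \<union> B"] abe(3)
    by (intro singular_chain_add) auto
  moreover have "d = orbit_boundary (d1 + d2)"
  proof -
    have "d = (dA + d0) + (dB - d0)" using dAB(3) by simp
    then show ?thesis by (simp only: 1(3) 2(3) orbit_boundary_simps)
  qed
  moreover have "c = \<Phi> (d1 + d2) + chain_boundary (Suc (Suc p)) (c1 + c2 + e)"
  proof -
    have "c = (a - c0) + (b + c0) + chain_boundary (Suc (Suc p)) e" using abe(4) by simp
    then show ?thesis by (simp only: 1(4) 2(4) chain_boundary_add \<Phi>_simps) (simp only: ac_simps)
  qed
  ultimately show "\<exists>d' c'. Poly_Mapping.keys d' \<subseteq> orbit_cells (A \<union> B) (Suc p) \<and> singular_chain (Suc (Suc p)) (MW (A \<union> B)) c' \<and>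
                 d = orbit_boundary d' \<and> c = \<Phi> d' + chain_boundary (Suc (Suc p)) c'" using key[OF 1(1) 2(1)] by blast
qed

text \<open>Induction on the number of cells. Removing the orbit of a cell c of maximal dimension
  leaves an invariant subcomplex, since no remaining cell has a face in that orbit; A is its union
  with the closed cell of c, and the intersection of the two misses c.\<close>

lemma cone_acyclic_subcomplex: "subcomplex A \<Longrightarrow> cone_acyclic A"
proof (induction "card A" arbitrary: A rule: less_induct)
  case less
  have finA: "finite A" using less.prems finite_cells finite_subset unfolding subcomplex_def by blast
  show ?case
  proof (cases "A = {}")
    case True then show ?thesis by (simp add: cone_acyclic_empty)
  next
    case False
    let ?cards = "(\<lambda>d. card (fst d)) ` A"
    have "Max ?cards \<in> ?cards" using finA False by (intro Max_in) auto
    then obtain c where c: "c \<in> A" "Max ?cards = card (fst c)" by (rule imageE)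
    have max: "card (fst d) \<le> card (fst c)" if "d \<in> A" for d
      unfolding c(2)[symmetric] using finA that by (intro Max_ge) auto
    note c = c(1)
    have cc: "c \<in> cells" using c less.prems by (auto simp: subcomplex_def)
    let ?O = "(\<lambda>g. reflect_cell g c) ` \<Gamma>"
    let ?A = "A - ?O"
    have cO: "c \<in> ?O" using reflect_cell_empty[OF cc] \<Gamma>_empty by (metis imageI)
    have sub: "subcomplex ?A"
      unfolding subcomplex_def
    proof (intro conjI ballI subsetI)
      show "d \<in> cells" if "d \<in> ?A" for d using that less.prems by (auto simp: subcomplex_def)
      show "e \<in> ?A" if d: "d \<in> ?A" and e: "e \<in> faces d" for d e
      proof
        show "e \<in> A" using d e less.prems by (auto simp: subcomplex_def)
        show "e \<notin> ?O"
        proof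
          assume "e \<in> ?O"
          then have fe: "fst e = fst c" by auto
          have dc: "d \<in> cells" using d less.prems by (auto simp: subcomplex_def)
          have "fst c \<subseteq> fst d" "finite (fst d)" using e fe cellsD(3)[OF dc] unfolding faces_iff by auto
          then have "fst d = fst c" using max[of d] d by (metis DiffD1 card_seteq)
          then have "e = d" using e fe cellsD(2)[OF dc] unfolding faces_iff by (auto intro!: prod_eqI)
          then show False using \<open>e \<in> ?O\<close> d by blast
        qed
      qed
      show "reflect_cell g d \<in> ?A" if d: "d \<in> ?A" and g: "g \<in> \<Gamma>" for d g
      proof
        show "reflect_cell g d \<in> A" using d g less.prems by (auto simp: subcomplex_def)
        have dc: "d \<in> cells" using d less.prems by (auto simp: subcomplex_def)
        show "reflect_cell g d \<notin> ?O"
        proof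
          assume "reflect_cell g d \<in> ?O"
          then obtain h where h: "h \<in> \<Gamma>" "reflect_cell g d = reflect_cell h c" by blast
          have "reflect_cell g (reflect_cell g d) = d"
            by (simp add: reflect_cell_comp reflect_cell_empty[OF dc])
          then have "d = reflect_cell (sym_diff g h) c" by (simp add: h(2) reflect_cell_comp)
          then show False using \<Gamma>_sym_diff[OF g h(1)] d by blast
        qed
      qed
    qed
    have clA: "closed_cell c \<subseteq> A" by (rule closed_cell_subset[OF less.prems c])
    have O_cl: "?O \<subseteq> closed_cell c"
      using faces_refl[OF cellsD(2)[OF cc]] unfolding closed_cell_def by blast
    have AA: "A = ?A \<union> closed_cell c" using clA O_cl by blast
    have lt: "card ?A < card A" "card (?A \<inter> closed_cell c) < card A"
      using c cO finA by (auto intro!: psubset_card_mono)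
    have scl: "subcomplex (closed_cell c)" by (rule subcomplex_closed_cell[OF cc])
    show ?thesis
      by (subst AA, rule cone_acyclic_Un[OF sub less.hyps[OF lt(1) sub] scl cone_acyclic_closed_cell[OF cc]
            less.hyps[OF lt(2) subcomplex_Int[OF sub scl]]])
  qed
qed

lemma MW_cells: "MW cells = M"
  by (simp add: W_cells)

text \<open>Singular chains are free on the singular simplices, so acyclicity of the cone over all
  of M suffices for a contraction. Both homotopies are kept explicit because cochains are evaluated
  on them later.\<close>

lemma orbit_complex_homotopy_inverse:
  obtains \<psi> h k
  where "\<And>p x. singular_chain p M x \<Longrightarrow> Poly_Mapping.keys (frag_extend (\<psi> p) x) \<subseteq> orbit_cells cells p"
    and "\<And>p x. singular_chain p M x \<Longrightarrow> singular_chain (Suc p) M (frag_extend (h p) x)"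
    and "\<And>p x. Poly_Mapping.keys x \<subseteq> orbit_cells cells p \<Longrightarrow>
           Poly_Mapping.keys (frag_extend (k p) x) \<subseteq> orbit_cells cells (Suc p)"
    and "\<And>p x. singular_chain p M x \<Longrightarrow>
          orbit_boundary (frag_extend (\<psi> p) x) = frag_extend (\<psi> (p - 1)) (chain_boundary p x)"
    and "\<And>p x. singular_chain p M x \<Longrightarrow>
          chain_boundary (Suc p) (frag_extend (h p) x) + frag_extend (h (p - 1)) (chain_boundary p x)
            = x - \<Phi> (frag_extend (\<psi> p) x)"
    and "\<And>p x. Poly_Mapping.keys x \<subseteq> orbit_cells cells p \<Longrightarrow>
          orbit_boundary (frag_extend (k p) x) + frag_extend (k (p - 1)) (orbit_boundary x)
            = x - frag_extend (\<psi> p) (\<Phi> x)"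
proof (rule acyclic_mapping_cone_homotopy_inverse[where C = "\<lambda>p. singular_simplex_set p M" and
    bdC = chain_boundary and E = "orbit_cells cells" and bdE = orbit_boundary and \<Phi> = \<Phi>,
    folded singular_chain_def])
  have ac: "cone_acyclic cells" by (rule cone_acyclic_subcomplex[OF subcomplex_cells])
  note ac = ac[unfolded cone_acyclic_def MW_cells]
  show "chain_boundary 0 x = 0" for x :: "(nat \<Rightarrow> real) set chain" by (simp add: chain_boundary_def)
  show "\<exists>d' c'. Poly_Mapping.keys d' \<subseteq> orbit_cells cells 0 \<and> singular_chain 1 M c' \<and> c = \<Phi> d' + chain_boundary 1 c'"
    if "singular_chain 0 M c" for c using ac that by blast
  show "\<exists>d' c'. Poly_Mapping.keys d' \<subseteq> orbit_cells cells (Suc p) \<and> singular_chain (Suc (Suc p)) M c' \<and>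
            d = orbit_boundary d' \<and> c = \<Phi> d' + chain_boundary (Suc (Suc p)) c'"
    if "singular_chain (Suc p) M c" "Poly_Mapping.keys d \<subseteq> orbit_cells cells p"
      "orbit_boundary d = 0" "chain_boundary (Suc p) c = \<Phi> d" for p c d using ac that by blast
  show "singular_chain p M (\<Phi> x)" if "Poly_Mapping.keys x \<subseteq> orbit_cells cells p" for p x
    using singular_chain_\<Phi>[OF subcomplex_cells that] by (simp add: MW_cells)
  show "orbit_boundary (orbit_boundary x) = 0" if "Poly_Mapping.keys x \<subseteq> orbit_cells cells (Suc p)" for p x
    by (rule orbit_boundary_boundary) (use that orbit_cells_sub in blast)
  fix \<psi> h k
  assume "\<And>p x. singular_chain p M x \<Longrightarrow> Poly_Mapping.keys (frag_extend (\<psi> p) x) \<subseteq> orbit_cells cells p"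
    and "\<And>p x. singular_chain p M x \<Longrightarrow> singular_chain (Suc p) M (frag_extend (h p) x)"
    and "\<And>p x. Poly_Mapping.keys x \<subseteq> orbit_cells cells p \<Longrightarrow>
           Poly_Mapping.keys (frag_extend (k p) x) \<subseteq> orbit_cells cells (Suc p)"
    and "\<And>p x. singular_chain p M x \<Longrightarrow>
          orbit_boundary (frag_extend (\<psi> p) x) = frag_extend (\<psi> (p - 1)) (chain_boundary p x)"
    and "\<And>p x. singular_chain p M x \<Longrightarrow>
          chain_boundary (Suc p) (frag_extend (h p) x) + frag_extend (h (p - 1)) (chain_boundary p x)
            = x - \<Phi> (frag_extend (\<psi> p) x)"
    and "\<And>p x. Poly_Mapping.keys x \<subseteq> orbit_cells cells p \<Longrightarrow>
          orbit_boundary (frag_extend (k p) x) + frag_extend (k (p - 1)) (orbit_boundary x)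
            = x - frag_extend (\<psi> p) (\<Phi> x)"
  then show thesis by (rule that)
qed (auto simp: chain_boundary_diff singular_chain_boundary_alt chain_boundary_boundary_alt
       orbit_boundary_0 keys_orbit_boundary[OF subcomplex_cells] boundary_\<Phi>)

end

section \<open>Decomposition by characters\<close>

lemma sum_Pow_insert:
  assumes "finite A" "a \<notin> A"
  shows "sum f (Pow (insert a A)) = (\<Sum>B\<in>Pow A. f B + f (insert a B))"
proof -
  have "sum f (Pow (insert a A)) = sum f (Pow A) + sum f (insert a ` Pow A)"
    unfolding Pow_insert using assms by (intro sum.union_disjoint) auto
  also have "sum f (insert a ` Pow A) = (\<Sum>B\<in>Pow A. f (insert a B))"
  proof (subst sum.reindex)
    have "B = insert a B - {a}" if "B \<in> Pow A" for B using that assms(2) by blast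
    then show "inj_on (insert a) (Pow A)" by (metis inj_onI)
  qed (simp add: o_def)
  finally show ?thesis by (simp add: sum.distrib)
qed

text \<open>The value at \<epsilon> of the character given by \<omega>. It is symmetric in the two
  sets, so sums over either variable can be evaluated by \<open>sum_character\<close>.\<close>

definition character :: "nat set \<Rightarrow> nat set \<Rightarrow> int" where
  "character \<omega> \<epsilon> = (-1) ^ card (\<epsilon> \<inter> \<omega>)"

lemma character_sq [simp]: "character \<omega> \<epsilon> * character \<omega> \<epsilon> = 1"
  by (simp add: character_def flip: power_mult_distrib)

lemma character_insert: "finite \<epsilon> \<Longrightarrow> i \<notin> \<epsilon> \<Longrightarrow> i \<in> \<omega> \<Longrightarrow> character \<omega> (insert i \<epsilon>) = - character \<omega> \<epsilon>"
  by (simp add: character_def)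

lemma character_mult:
  assumes "finite \<epsilon>"
  shows "character \<omega> \<epsilon> * character \<omega>' \<epsilon> = character (sym_diff \<omega> \<omega>') \<epsilon>"
proof -
  have "\<epsilon> \<inter> sym_diff \<omega> \<omega>' = sym_diff (\<epsilon> \<inter> \<omega>) (\<epsilon> \<inter> \<omega>')" by blast
  then show ?thesis using minus_one_power_card_sym_diff[of "\<epsilon> \<inter> \<omega>" "\<epsilon> \<inter> \<omega>'"] assms
    by (simp add: character_def)
qed

text \<open>Orthogonality: an element of A in \<omega> pairs the subsets with and without it, with
  opposite values.\<close>

lemma sum_character:
  "finite A \<Longrightarrow> (\<Sum>\<epsilon>\<in>Pow A. character \<omega> \<epsilon>) = (if A \<inter> \<omega> = {} then 2 ^ card A else 0)"
proof (induction A rule: finite_induct)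
  case empty
  then show ?case by (simp add: character_def)
next
  case (insert a A)
  have "(\<Sum>\<epsilon>\<in>Pow (insert a A). character \<omega> \<epsilon>) = (\<Sum>\<epsilon>\<in>Pow A. (if a \<in> \<omega> then 0 else 2) * character \<omega> \<epsilon>)"
    unfolding sum_Pow_insert[OF insert.hyps]
  proof (rule sum.cong[OF refl])
    fix \<epsilon> assume "\<epsilon> \<in> Pow A"
    then have "finite \<epsilon>" "a \<notin> \<epsilon>" using insert.hyps finite_subset by blast+
    then show "character \<omega> \<epsilon> + character \<omega> (insert a \<epsilon>) = (if a \<in> \<omega> then 0 else 2) * character \<omega> \<epsilon>"
      by (simp add: character_def)
  qed
  also have "\<dots> = (if a \<in> \<omega> then 0 else 2) * (\<Sum>\<epsilon>\<in>Pow A. character \<omega> \<epsilon>)"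
    by (simp add: sum_distrib_left)
  finally show ?case using insert by simp
qed

text \<open>The orientation sign counts g inside \<sigma>, the change of the character counts g
  inside \<omega> off \<sigma>. As \<sigma> \<subseteq> \<omega>, together they count g inside
  \<omega>, so a reflection affects the weighted cells by one common sign.\<close>

lemma character_reflect:
  assumes "finite \<epsilon>" "finite g" "\<sigma> \<inter> \<epsilon> = {}" "\<sigma> \<subseteq> \<omega>"
  shows "reflect_sign g (\<sigma>, \<epsilon>) * character \<omega> (sym_diff \<epsilon> g - \<sigma>) = (-1) ^ card (\<omega> \<inter> g) * character \<omega> \<epsilon>"
proof -
  have u: "sym_diff (\<epsilon> \<inter> \<omega>) (\<omega> \<inter> g) = ((sym_diff \<epsilon> g - \<sigma>) \<inter> \<omega>) \<union> (g \<inter> \<sigma>)"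
    using assms(3,4) by blast
  have "(-1 :: int) ^ card (\<epsilon> \<inter> \<omega>) * (-1) ^ card (\<omega> \<inter> g) = (-1) ^ card (((sym_diff \<epsilon> g - \<sigma>) \<inter> \<omega>) \<union> (g \<inter> \<sigma>))"
    unfolding u[symmetric] using assms(1,2) by (intro minus_one_power_card_sym_diff[symmetric]) auto
  also have "card (((sym_diff \<epsilon> g - \<sigma>) \<inter> \<omega>) \<union> (g \<inter> \<sigma>)) = card ((sym_diff \<epsilon> g - \<sigma>) \<inter> \<omega>) + card (g \<inter> \<sigma>)"
    using assms(1,2) by (intro card_Un_disjoint) auto
  finally show ?thesis by (simp add: character_def reflect_sign_def power_add mult.commute)
qed

lemma simplicial_boundary_simps [simp]:
  "simplicial_boundary 0 = 0"
  "simplicial_boundary (a - b) = simplicial_boundary a - simplicial_boundary b"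
  by (simp_all add: simplicial_boundary_def frag_extend_diff)

lemma simplicial_boundary_of:
  "simplicial_boundary (frag_of \<sigma>) = (\<Sum>v\<in>\<sigma>. frag_cmul (position_sign \<sigma> v) (frag_of (\<sigma> - {v})))"
  by (simp add: simplicial_boundary_def position_sign_def)

text \<open>R is the group of all characters trivial on \<Gamma>; the two directions are separate
  assumptions because they serve different purposes, descent to orbits and vanishing.\<close>

locale dual_reflection_group = free_reflection_group +
  fixes R :: "nat set set"
  assumes R_sub: "R \<subseteq> Pow {1..m}"
    and R_even: "\<omega> \<in> R \<Longrightarrow> g \<in> \<Gamma> \<Longrightarrow> even (card (\<omega> \<inter> g))"
    and R_odd: "\<omega> \<subseteq> {1..m} \<Longrightarrow> \<omega> \<notin> R \<Longrightarrow> \<exists>g\<in>\<Gamma>. odd (card (\<omega> \<inter> g))"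
begin

text \<open>Indexed by the number of vertices, one more than the dimension of the simplex, to agree
  with the dimension of the cells.\<close>

definition simplices :: "nat set \<Rightarrow> nat \<Rightarrow> nat set set" where
  "simplices \<omega> p = {\<sigma> \<in> K. \<sigma> \<subseteq> \<omega> \<and> card \<sigma> = p}"

lemma finite_\<Gamma>: "g \<in> \<Gamma> \<Longrightarrow> finite g"
  using \<Gamma>_sub finite_subset[of g "{1..m}"] by blast

lemma finite_R: "finite R"
  using R_sub by (rule finite_subset) simp

lemma simplexD: "\<sigma> \<in> K \<Longrightarrow> finite \<sigma> \<and> \<sigma> \<subseteq> {1..m}"
  using K_sub finite_subset[of \<sigma> "{1..m}"] by blast

definition cell_sum :: "nat set \<Rightarrow> nat set \<Rightarrow> (cell \<Rightarrow>\<^sub>0 int)" where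
  "cell_sum \<omega> \<sigma> = (\<Sum>\<epsilon>\<in>Pow ({1..m} - \<sigma>). frag_cmul (character \<omega> \<epsilon>) (frag_of (\<sigma>, \<epsilon>)))"

definition \<theta> :: "nat set \<Rightarrow> (nat set \<Rightarrow>\<^sub>0 int) \<Rightarrow> (cell \<Rightarrow>\<^sub>0 int)" where
  "\<theta> \<omega> = frag_extend (\<lambda>\<sigma>. to_reps (cell_sum \<omega> \<sigma>))"

text \<open>The transpose of \<open>cell_sum\<close>, used as an inverse of \<theta> up to a power
  of 2.\<close>

definition \<theta>' :: "nat set \<Rightarrow> (cell \<Rightarrow>\<^sub>0 int) \<Rightarrow> (nat set \<Rightarrow>\<^sub>0 int)" where
  "\<theta>' \<omega> = frag_extend (\<lambda>(\<sigma>, \<epsilon>). if \<sigma> \<subseteq> \<omega> then frag_cmul (character \<omega> \<epsilon>) (frag_of \<sigma>) else 0)"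

lemma \<theta>_simps [simp]:
  "\<theta> \<omega> 0 = 0" "\<theta> \<omega> (a - b) = \<theta> \<omega> a - \<theta> \<omega> b" "\<theta> \<omega> (frag_cmul n a) = frag_cmul n (\<theta> \<omega> a)"
  "\<theta> \<omega> (frag_of \<sigma>) = to_reps (cell_sum \<omega> \<sigma>)"
  by (simp_all add: \<theta>_def frag_extend_diff frag_extend_cmul)

lemma \<theta>_sum: "finite S \<Longrightarrow> \<theta> \<omega> (sum f S) = (\<Sum>x\<in>S. \<theta> \<omega> (f x))"
  by (simp add: \<theta>_def frag_extend_sum o_def)

lemma \<theta>'_simps [simp]:
  "\<theta>' \<omega> 0 = 0" "\<theta>' \<omega> (a - b) = \<theta>' \<omega> a - \<theta>' \<omega> b" "\<theta>' \<omega> (frag_cmul n a) = frag_cmul n (\<theta>' \<omega> a)"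
  "\<theta>' \<omega> (frag_of (\<sigma>, \<epsilon>)) = (if \<sigma> \<subseteq> \<omega> then frag_cmul (character \<omega> \<epsilon>) (frag_of \<sigma>) else 0)"
  by (simp_all add: \<theta>'_def frag_extend_diff frag_extend_cmul)

lemma \<theta>'_sum: "finite S \<Longrightarrow> \<theta>' \<omega> (sum f S) = (\<Sum>x\<in>S. \<theta>' \<omega> (f x))"
  by (simp add: \<theta>'_def frag_extend_sum o_def)

lemma keys_cell_sum:
  "\<sigma> \<in> K \<Longrightarrow> Poly_Mapping.keys (cell_sum \<omega> \<sigma>) \<subseteq> {c. card (fst c) = card \<sigma>} \<inter> cells"
  unfolding cell_sum_def
  by (intro order_trans[OF keys_sum] UN_least order_trans[OF keys_cmul]) (auto simp: cells_def)

lemma keys_\<theta>: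
  assumes "Poly_Mapping.keys x \<subseteq> simplices \<omega> p"
  shows "Poly_Mapping.keys (\<theta> \<omega> x) \<subseteq> orbit_cells cells p"
  unfolding \<theta>_def
proof (rule keys_frag_extend_subset[OF assms])
  fix \<sigma> assume "\<sigma> \<in> simplices \<omega> p"
  then show "Poly_Mapping.keys (to_reps (cell_sum \<omega> \<sigma>)) \<subseteq> orbit_cells cells p"
    using keys_to_reps_card[OF subcomplex_cells keys_cell_sum] by (auto simp: simplices_def)
qed

lemma keys_\<theta>':
  assumes "Poly_Mapping.keys x \<subseteq> orbit_cells cells p"
  shows "Poly_Mapping.keys (\<theta>' \<omega> x) \<subseteq> simplices \<omega> p"
  unfolding \<theta>'_def
proof (rule keys_frag_extend_subset[OF assms])
  fix c assume "c \<in> orbit_cells cells p"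
  then have "fst c \<in> K" "card (fst c) = p" using cellsD(1) by (auto simp: orbit_cells_def)
  then show "Poly_Mapping.keys (case c of (\<sigma>, \<epsilon>) \<Rightarrow> if \<sigma> \<subseteq> \<omega> then frag_cmul (character \<omega> \<epsilon>) (frag_of \<sigma>) else 0)
      \<subseteq> simplices \<omega> p"
    by (cases c) (auto simp: simplices_def)
qed

text \<open>The cells parallel to \<sigma> - {i} come in pairs differing in coordinate i. As i \<in>
  \<omega>, their weights are opposite, so each pair forms a difference of facets as in the cube
  boundary. The weight is negative on the facet at 1, where the boundary is positive; hence the
  overall sign.\<close>

lemma cube_boundary_cell_sum:
  assumes \<sigma>: "\<sigma> \<in> K" "\<sigma> \<subseteq> \<omega>"
  shows "cube_boundary (cell_sum \<omega> \<sigma>) = - (\<Sum>i\<in>\<sigma>. frag_cmul (position_sign \<sigma> i) (cell_sum \<omega> (\<sigma> - {i})))"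
proof -
  let ?P = "Pow ({1..m} - \<sigma>)"
  let ?t = "\<lambda>i \<epsilon>. frag_cmul (character \<omega> \<epsilon>) (frag_of (\<sigma> - {i}, insert i \<epsilon>) - frag_of (\<sigma> - {i}, \<epsilon>))"
  have fin: "finite \<sigma>" "\<sigma> \<subseteq> {1..m}" using simplexD[OF \<sigma>(1)] by auto
  have cs: "cell_sum \<omega> (\<sigma> - {i}) = - (\<Sum>\<epsilon>\<in>?P. ?t i \<epsilon>)" if i: "i \<in> \<sigma>" for i
  proof -
    have "{1..m} - (\<sigma> - {i}) = insert i ({1..m} - \<sigma>)" using i fin(2) by blast
    then have "cell_sum \<omega> (\<sigma> - {i}) = (\<Sum>\<epsilon>\<in>?P. frag_cmul (character \<omega> \<epsilon>) (frag_of (\<sigma> - {i}, \<epsilon>)) +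
        frag_cmul (character \<omega> (insert i \<epsilon>)) (frag_of (\<sigma> - {i}, insert i \<epsilon>)))"
      unfolding cell_sum_def using i by (simp only:) (subst sum_Pow_insert, auto)
    also have "\<dots> = (\<Sum>\<epsilon>\<in>?P. - ?t i \<epsilon>)"
    proof (rule sum.cong[OF refl])
      fix \<epsilon> assume \<epsilon>: "\<epsilon> \<in> ?P"
      then have "finite \<epsilon>" "i \<notin> \<epsilon>" using i finite_subset[of \<epsilon> "{1..m}"] by auto
      then have "character \<omega> (insert i \<epsilon>) = - character \<omega> \<epsilon>" using \<sigma>(2) i by (intro character_insert) auto
      then show "frag_cmul (character \<omega> \<epsilon>) (frag_of (\<sigma> - {i}, \<epsilon>)) +
        frag_cmul (character \<omega> (insert i \<epsilon>)) (frag_of (\<sigma> - {i}, insert i \<epsilon>)) = - ?t i \<epsilon>"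
        by (simp add: frag_cmul_diff flip: minus_frag_cmul)
    qed
    finally show ?thesis by (simp only: sum_negf)
  qed
  have "cube_boundary (cell_sum \<omega> \<sigma>) = (\<Sum>\<epsilon>\<in>?P. \<Sum>i\<in>\<sigma>. frag_cmul (position_sign \<sigma> i) (?t i \<epsilon>))"
    unfolding cell_sum_def
    by (simp add: cube_boundary_sum cube_boundary_of frag_cmul_sum mult.commute)
  also have "\<dots> = (\<Sum>i\<in>\<sigma>. \<Sum>\<epsilon>\<in>?P. frag_cmul (position_sign \<sigma> i) (?t i \<epsilon>))" by (rule sum.swap)
  also have "\<dots> = (\<Sum>i\<in>\<sigma>. - frag_cmul (position_sign \<sigma> i) (cell_sum \<omega> (\<sigma> - {i})))"
  proof (rule sum.cong[OF refl])
    fix i assume "i \<in> \<sigma>"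
    from cs[OF this] have "(\<Sum>\<epsilon>\<in>?P. ?t i \<epsilon>) = - cell_sum \<omega> (\<sigma> - {i})" by simp
    then have "frag_cmul (position_sign \<sigma> i) (\<Sum>\<epsilon>\<in>?P. ?t i \<epsilon>) = frag_cmul (position_sign \<sigma> i) (- cell_sum \<omega> (\<sigma> - {i}))"
      by (rule arg_cong)
    then show "(\<Sum>\<epsilon>\<in>?P. frag_cmul (position_sign \<sigma> i) (?t i \<epsilon>)) = - frag_cmul (position_sign \<sigma> i) (cell_sum \<omega> (\<sigma> - {i}))"
      using frag_cmul_diff[of "position_sign \<sigma> i" 0 "cell_sum \<omega> (\<sigma> - {i})"] by (simp only: frag_cmul_sum) simp
  qed
  also have "\<dots> = - (\<Sum>i\<in>\<sigma>. frag_cmul (position_sign \<sigma> i) (cell_sum \<omega> (\<sigma> - {i})))" by (rule sum_negf)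
  finally show ?thesis .
qed

lemma orbit_boundary_\<theta>:
  assumes "Poly_Mapping.keys x \<subseteq> simplices \<omega> p"
  shows "orbit_boundary (\<theta> \<omega> x) = - \<theta> \<omega> (simplicial_boundary x)"
proof (rule frag_additive_eqI[OF assms, where f = "\<lambda>x. orbit_boundary (\<theta> \<omega> x)" and g = "\<lambda>x. - \<theta> \<omega> (simplicial_boundary x)"])
  fix \<sigma> assume "\<sigma> \<in> simplices \<omega> p"
  then have \<sigma>: "\<sigma> \<in> K" "\<sigma> \<subseteq> \<omega>" by (auto simp: simplices_def)
  have fin: "finite \<sigma>" using simplexD[OF \<sigma>(1)] by blast
  have "orbit_boundary (\<theta> \<omega> (frag_of \<sigma>)) = to_reps (cube_boundary (cell_sum \<omega> \<sigma>))"
    using orbit_boundary_to_reps[of "cell_sum \<omega> \<sigma>"] keys_cell_sum[OF \<sigma>(1)] by (simp add: orbit_boundary_def)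
  also have "\<dots> = - \<theta> \<omega> (simplicial_boundary (frag_of \<sigma>))"
    by (simp add: cube_boundary_cell_sum[OF \<sigma>] simplicial_boundary_of \<theta>_sum[OF fin] to_reps_sum[OF fin])
  finally show "orbit_boundary (\<theta> \<omega> (frag_of \<sigma>)) = - \<theta> \<omega> (simplicial_boundary (frag_of \<sigma>))" .
qed auto

text \<open>For \<omega> trivial on \<Gamma>, the weight of a cell changes along its orbit by
  exactly the orientation sign, so \<theta>' descends to orbits.\<close>

lemma \<theta>'_to_reps:
  assumes \<omega>: "\<omega> \<in> R" and x: "Poly_Mapping.keys x \<subseteq> cells"
  shows "\<theta>' \<omega> (to_reps x) = \<theta>' \<omega> x"
proof (rule frag_additive_eqI[OF x, where f = "\<lambda>x. \<theta>' \<omega> (to_reps x)" and g = "\<theta>' \<omega>"])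
  fix c assume c: "c \<in> cells"
  obtain \<sigma> \<epsilon> where ce: "c = (\<sigma>, \<epsilon>)" by (cases c)
  let ?g = "to_rep c"
  have g: "?g \<in> \<Gamma>" by (rule to_rep)
  have "to_reps (frag_of c) = reflect_chain ?g (frag_of c)"
    by (simp add: to_reps_of reflect_chain_of to_rep(2))
  then have *: "to_reps (frag_of c) = frag_cmul (reflect_sign ?g (\<sigma>, \<epsilon>)) (frag_of (\<sigma>, sym_diff \<epsilon> ?g - \<sigma>))"
    by (simp add: reflect_chain_of ce reflect_cell_def)
  have fin: "finite \<epsilon>" "\<sigma> \<inter> \<epsilon> = {}" using cellsD(2,5)[OF c] finite_subset[of \<epsilon> "{1..m}"] by (auto simp: ce)
  show "\<theta>' \<omega> (to_reps (frag_of c)) = \<theta>' \<omega> (frag_of c)"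
    using character_reflect[OF fin(1) finite_\<Gamma>[OF g] fin(2), of \<omega>] R_even[OF \<omega> g]
    unfolding * by (simp add: ce)
qed auto

text \<open>Orthogonality over the cells parallel to \<sigma>. If \<omega> and \<omega>' both
  contain \<sigma>, they are distinct exactly when they differ off \<sigma>, where the character sum
  can see it.\<close>

lemma \<theta>'_\<theta>:
  assumes \<omega>: "\<omega> \<in> R" "\<omega>' \<in> R" and x: "Poly_Mapping.keys x \<subseteq> simplices \<omega> p"
  shows "\<theta>' \<omega>' (\<theta> \<omega> x) = (if \<omega> = \<omega>' then frag_cmul (2 ^ (m - p)) x else 0)"
proof (rule frag_additive_eqI[OF x, where f = "\<lambda>x. \<theta>' \<omega>' (\<theta> \<omega> x)"
      and g = "\<lambda>x. if \<omega> = \<omega>' then frag_cmul (2 ^ (m - p)) x else 0"])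
  fix \<sigma> assume "\<sigma> \<in> simplices \<omega> p"
  then have \<sigma>: "\<sigma> \<in> K" "\<sigma> \<subseteq> \<omega>" "card \<sigma> = p" by (auto simp: simplices_def)
  have fin: "finite \<sigma>" "\<sigma> \<subseteq> {1..m}" using simplexD[OF \<sigma>(1)] by auto
  let ?A = "{1..m} - \<sigma>"
  have cA: "card ?A = m - p" using fin \<sigma>(3) by (simp add: card_Diff_subset)
  have "\<theta>' \<omega>' (\<theta> \<omega> (frag_of \<sigma>)) = \<theta>' \<omega>' (cell_sum \<omega> \<sigma>)"
    using \<theta>'_to_reps[OF \<omega>(2)] keys_cell_sum[OF \<sigma>(1)] by simp
  also have "\<dots> = (if \<omega> = \<omega>' then frag_cmul (2 ^ (m - p)) (frag_of \<sigma>) else 0)"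
  proof (cases "\<sigma> \<subseteq> \<omega>'")
    case True
    have "\<theta>' \<omega>' (cell_sum \<omega> \<sigma>) = (\<Sum>\<epsilon>\<in>Pow ?A. frag_cmul (character \<omega> \<epsilon> * character \<omega>' \<epsilon>) (frag_of \<sigma>))"
      using True by (simp add: cell_sum_def \<theta>'_sum)
    also have "\<dots> = (\<Sum>\<epsilon>\<in>Pow ?A. frag_cmul (character (sym_diff \<omega> \<omega>') \<epsilon>) (frag_of \<sigma>))"
    proof (rule sum.cong[OF refl])
      fix \<epsilon> assume "\<epsilon> \<in> Pow ?A"
      then have "finite \<epsilon>" using finite_subset[of \<epsilon> "{1..m}"] by auto
      then show "frag_cmul (character \<omega> \<epsilon> * character \<omega>' \<epsilon>) (frag_of \<sigma>) = frag_cmul (character (sym_diff \<omega> \<omega>') \<epsilon>) (frag_of \<sigma>)"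
        by (simp only: character_mult)
    qed
    also have "\<dots> = frag_cmul (\<Sum>\<epsilon>\<in>Pow ?A. character (sym_diff \<omega> \<omega>') \<epsilon>) (frag_of \<sigma>)"
    proof -
      have "finite S \<Longrightarrow> (\<Sum>\<epsilon>\<in>S. frag_cmul (f \<epsilon>) a) = frag_cmul (\<Sum>\<epsilon>\<in>S. f \<epsilon>) a" for S :: "nat set set" and f and a :: "nat set \<Rightarrow>\<^sub>0 int"
        by (induction S rule: finite_induct) (simp_all add: frag_cmul_distrib)
      then show ?thesis by simp
    qed
    also have "(\<Sum>\<epsilon>\<in>Pow ?A. character (sym_diff \<omega> \<omega>') \<epsilon>) = (if ?A \<inter> sym_diff \<omega> \<omega>' = {} then 2 ^ card ?A else 0)"
      by (rule sum_character) simp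
    also have "?A \<inter> sym_diff \<omega> \<omega>' = {} \<longleftrightarrow> \<omega> = \<omega>'"
      using \<sigma>(2) True R_sub \<omega> by blast
    finally show ?thesis unfolding cA by (cases "\<omega> = \<omega>'") simp_all
  next
    case False
    then have "\<theta>' \<omega>' (cell_sum \<omega> \<sigma>) = 0" by (simp add: cell_sum_def \<theta>'_sum)
    moreover have "\<omega> \<noteq> \<omega>'" using False \<sigma>(2) by blast
    ultimately show ?thesis by simp
  qed
  finally show "\<theta>' \<omega>' (\<theta> \<omega> (frag_of \<sigma>)) = (if \<omega> = \<omega>' then frag_cmul (2 ^ (m - p)) (frag_of \<sigma>) else 0)" .
qed (auto simp: frag_cmul_diff)

text \<open>An element of \<open>\<Gamma>\<close> on which \<open>\<omega>\<close> is nontrivial maps the sum to its negative.\<close>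

lemma to_reps_cell_sum_0:
  assumes \<sigma>: "\<sigma> \<in> K" "\<sigma> \<subseteq> \<omega>" and \<omega>: "\<omega> \<subseteq> {1..m}" "\<omega> \<notin> R"
  shows "to_reps (cell_sum \<omega> \<sigma>) = 0"
proof (rule self_negative_frag_0)
  obtain g where g: "g \<in> \<Gamma>" "odd (card (\<omega> \<inter> g))" using R_odd[OF \<omega>] by blast
  let ?P = "Pow ({1..m} - \<sigma>)"
  let ?r = "\<lambda>\<epsilon>. sym_diff \<epsilon> g - \<sigma>"
  have rP: "?r \<epsilon> \<in> ?P" "?r (?r \<epsilon>) = \<epsilon>" if "\<epsilon> \<in> ?P" for \<epsilon> using that g(1) \<Gamma>_sub by blast+
  have "to_reps (cell_sum \<omega> \<sigma>) = to_reps (reflect_chain g (cell_sum \<omega> \<sigma>))"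
    using keys_cell_sum[OF \<sigma>(1)] g(1) by (intro to_reps_reflect[symmetric]) auto
  also have "reflect_chain g (cell_sum \<omega> \<sigma>) = - cell_sum \<omega> \<sigma>"
  proof -
    have "reflect_chain g (cell_sum \<omega> \<sigma>) = (\<Sum>\<epsilon>\<in>?P. frag_cmul (- character \<omega> (?r \<epsilon>)) (frag_of (\<sigma>, ?r \<epsilon>)))"
      unfolding cell_sum_def
    proof (subst reflect_chain_sum, simp, rule sum.cong[OF refl])
      fix \<epsilon> assume \<epsilon>: "\<epsilon> \<in> ?P"
      have fin: "finite \<epsilon>" "\<sigma> \<inter> \<epsilon> = {}" using \<epsilon> finite_subset[of \<epsilon> "{1..m}"] by auto
      have "reflect_sign g (\<sigma>, \<epsilon>) * character \<omega> (?r \<epsilon>) = - character \<omega> \<epsilon>"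
        using character_reflect[OF fin(1) finite_\<Gamma>[OF g(1)] fin(2) \<sigma>(2)] g(2) by simp
      then have "reflect_sign g (\<sigma>, \<epsilon>) * (reflect_sign g (\<sigma>, \<epsilon>) * character \<omega> (?r \<epsilon>)) = reflect_sign g (\<sigma>, \<epsilon>) * - character \<omega> \<epsilon>"
        by simp
      then have "character \<omega> \<epsilon> * reflect_sign g (\<sigma>, \<epsilon>) = - character \<omega> (?r \<epsilon>)"
        by (simp add: mult.commute flip: mult.assoc)
      then show "reflect_chain g (frag_cmul (character \<omega> \<epsilon>) (frag_of (\<sigma>, \<epsilon>))) = frag_cmul (- character \<omega> (?r \<epsilon>)) (frag_of (\<sigma>, ?r \<epsilon>))"
        by (simp add: reflect_chain_of reflect_cell_def del: minus_frag_cmul)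
    qed
    also have "\<dots> = (\<Sum>\<epsilon>\<in>?P. frag_cmul (- character \<omega> \<epsilon>) (frag_of (\<sigma>, \<epsilon>)))"
      by (rule sum.reindex_bij_witness[of _ ?r ?r]) (use rP in auto)
    also have "\<dots> = - cell_sum \<omega> \<sigma>"
      unfolding cell_sum_def sum_negf[symmetric] by simp
    finally show ?thesis .
  qed
  finally show "to_reps (cell_sum \<omega> \<sigma>) = - to_reps (cell_sum \<omega> \<sigma>)" by simp
qed

text \<open>Orthogonality in the other variable. Sets outside R contribute zero and may be added, so
  the sum runs over all \<omega> between \<sigma> and [m]; summing their characters singles out c
  among its parallel cells.\<close>

lemma sum_\<theta>_\<theta>':
  assumes x: "Poly_Mapping.keys x \<subseteq> orbit_cells cells p"
  shows "(\<Sum>\<omega>\<in>R. \<theta> \<omega> (\<theta>' \<omega> x)) = frag_cmul (2 ^ (m - p)) x"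
proof (rule frag_additive_eqI[OF x, where f = "\<lambda>x. \<Sum>\<omega>\<in>R. \<theta> \<omega> (\<theta>' \<omega> x)" and g = "frag_cmul (2 ^ (m - p))"])
  fix c assume "c \<in> orbit_cells cells p"
  then have c: "c \<in> cells" "c \<in> reps" "card (fst c) = p" by (auto simp: orbit_cells_def)
  obtain \<sigma> \<epsilon> where ce: "c = (\<sigma>, \<epsilon>)" by (cases c)
  have \<sigma>: "\<sigma> \<in> K" "finite \<sigma>" "\<sigma> \<subseteq> {1..m}" "card \<sigma> = p" and \<epsilon>: "\<epsilon> \<subseteq> {1..m} - \<sigma>"
    using cellsD[OF c(1)] c(3) by (auto simp: ce)
  let ?A = "{1..m} - \<sigma>"
  let ?U = "{\<omega> \<in> Pow {1..m}. \<sigma> \<subseteq> \<omega>}"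
  have finU: "finite ?U" by simp
  have "(\<Sum>\<omega>\<in>R. \<theta> \<omega> (\<theta>' \<omega> (frag_of c))) = (\<Sum>\<omega>\<in>R \<inter> ?U. frag_cmul (character \<omega> \<epsilon>) (to_reps (cell_sum \<omega> \<sigma>)))"
    using R_sub finite_R by (intro sum.mono_neutral_cong_right) (auto simp: ce)
  also have "\<dots> = (\<Sum>\<omega>\<in>?U. frag_cmul (character \<omega> \<epsilon>) (to_reps (cell_sum \<omega> \<sigma>)))"
    using to_reps_cell_sum_0[OF \<sigma>(1)] finU by (intro sum.mono_neutral_left) auto
  also have "\<dots> = (\<Sum>\<omega>'\<in>Pow ?A. frag_cmul (character (\<omega>' \<union> \<sigma>) \<epsilon>) (to_reps (cell_sum (\<omega>' \<union> \<sigma>) \<sigma>)))"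
    by (rule sum.reindex_bij_witness[of _ "\<lambda>\<omega>'. \<omega>' \<union> \<sigma>" "\<lambda>\<omega>. \<omega> - \<sigma>"]) (use \<sigma>(3) in \<open>auto simp: Un_absorb2\<close>)
  also have "\<dots> = (\<Sum>\<omega>'\<in>Pow ?A. \<Sum>\<delta>\<in>Pow ?A. frag_cmul (character (sym_diff \<epsilon> \<delta>) \<omega>') (to_reps (frag_of (\<sigma>, \<delta>))))"
  proof (rule sum.cong[OF refl])
    fix \<omega>' assume \<omega>': "\<omega>' \<in> Pow ?A"
    then have fin\<omega>: "finite \<omega>'" using finite_subset[of \<omega>' "{1..m}"] by auto
    have swap: "character (\<omega>' \<union> \<sigma>) \<delta> = character \<delta> \<omega>'" if "\<delta> \<in> Pow ?A" for \<delta>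
    proof -
      have "\<delta> \<inter> (\<omega>' \<union> \<sigma>) = \<omega>' \<inter> \<delta>" using that by blast
      then show ?thesis by (simp add: character_def)
    qed
    have "frag_cmul (character (\<omega>' \<union> \<sigma>) \<epsilon>) (to_reps (cell_sum (\<omega>' \<union> \<sigma>) \<sigma>)) =
       (\<Sum>\<delta>\<in>Pow ?A. frag_cmul (character (\<omega>' \<union> \<sigma>) \<epsilon> * character (\<omega>' \<union> \<sigma>) \<delta>) (to_reps (frag_of (\<sigma>, \<delta>))))"
      by (simp add: cell_sum_def to_reps_sum frag_cmul_sum)
    also have "\<dots> = (\<Sum>\<delta>\<in>Pow ?A. frag_cmul (character (sym_diff \<epsilon> \<delta>) \<omega>') (to_reps (frag_of (\<sigma>, \<delta>))))"
    proof (rule sum.cong[OF refl])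
      fix \<delta> assume \<delta>: "\<delta> \<in> Pow ?A"
      have "character (\<omega>' \<union> \<sigma>) \<epsilon> * character (\<omega>' \<union> \<sigma>) \<delta> = character (sym_diff \<epsilon> \<delta>) \<omega>'"
        using swap[OF \<delta>] swap[of \<epsilon>] \<epsilon> character_mult[OF fin\<omega>, of \<epsilon> \<delta>] by simp
      then show "frag_cmul (character (\<omega>' \<union> \<sigma>) \<epsilon> * character (\<omega>' \<union> \<sigma>) \<delta>) (to_reps (frag_of (\<sigma>, \<delta>)))
         = frag_cmul (character (sym_diff \<epsilon> \<delta>) \<omega>') (to_reps (frag_of (\<sigma>, \<delta>)))" by (simp only:)
    qed
    finally show "frag_cmul (character (\<omega>' \<union> \<sigma>) \<epsilon>) (to_reps (cell_sum (\<omega>' \<union> \<sigma>) \<sigma>)) =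
       (\<Sum>\<delta>\<in>Pow ?A. frag_cmul (character (sym_diff \<epsilon> \<delta>) \<omega>') (to_reps (frag_of (\<sigma>, \<delta>))))" .
  qed
  also have "\<dots> = (\<Sum>\<delta>\<in>Pow ?A. \<Sum>\<omega>'\<in>Pow ?A. frag_cmul (character (sym_diff \<epsilon> \<delta>) \<omega>') (to_reps (frag_of (\<sigma>, \<delta>))))"
    by (rule sum.swap)
  also have "\<dots> = (\<Sum>\<delta>\<in>Pow ?A. if \<delta> = \<epsilon> then frag_cmul (2 ^ (m - p)) (to_reps (frag_of (\<sigma>, \<epsilon>))) else 0)"
  proof (rule sum.cong[OF refl])
    fix \<delta> assume \<delta>: "\<delta> \<in> Pow ?A"
    have "finite S \<Longrightarrow> (\<Sum>\<epsilon>\<in>S. frag_cmul (f \<epsilon>) a) = frag_cmul (\<Sum>\<epsilon>\<in>S. f \<epsilon>) a" for S :: "nat set set" and f and a :: "cell \<Rightarrow>\<^sub>0 int"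
      by (induction S rule: finite_induct) (simp_all add: frag_cmul_distrib)
    then have "(\<Sum>\<omega>'\<in>Pow ?A. frag_cmul (character (sym_diff \<epsilon> \<delta>) \<omega>') (to_reps (frag_of (\<sigma>, \<delta>)))) =
      frag_cmul (\<Sum>\<omega>'\<in>Pow ?A. character (sym_diff \<epsilon> \<delta>) \<omega>') (to_reps (frag_of (\<sigma>, \<delta>)))" by simp
    also have "(\<Sum>\<omega>'\<in>Pow ?A. character (sym_diff \<epsilon> \<delta>) \<omega>') = (if ?A \<inter> sym_diff \<epsilon> \<delta> = {} then 2 ^ card ?A else 0)"
      by (rule sum_character) simp
    also have "?A \<inter> sym_diff \<epsilon> \<delta> = {} \<longleftrightarrow> \<delta> = \<epsilon>" using \<delta> \<epsilon> by blast
    also have "card ?A = m - p" using \<sigma> by (simp add: card_Diff_subset)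
    finally show "(\<Sum>\<omega>'\<in>Pow ?A. frag_cmul (character (sym_diff \<epsilon> \<delta>) \<omega>') (to_reps (frag_of (\<sigma>, \<delta>)))) =
      (if \<delta> = \<epsilon> then frag_cmul (2 ^ (m - p)) (to_reps (frag_of (\<sigma>, \<epsilon>))) else 0)" by auto
  qed
  also have "\<dots> = frag_cmul (2 ^ (m - p)) (to_reps (frag_of (\<sigma>, \<epsilon>)))" using \<epsilon> by simp
  also have "to_reps (frag_of (\<sigma>, \<epsilon>)) = frag_of c" using to_reps_rep[OF c(2)] by (simp add: ce)
  finally show "(\<Sum>\<omega>\<in>R. \<theta> \<omega> (\<theta>' \<omega> (frag_of c))) = frag_cmul (2 ^ (m - p)) (frag_of c)" .
qed (auto simp: sum_subtractf frag_cmul_diff)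

end

section \<open>Cohomology of free complexes\<close>

definition additive :: "('a::ab_group_add \<Rightarrow> 'b::ab_group_add) \<Rightarrow> bool" where
  "additive f \<longleftrightarrow> (\<forall>x y. f (x - y) = f x - f y)"

lemma additive_frag_extend: "additive (frag_extend f)"
  by (simp add: additive_def frag_extend_diff)

lemma additiveD:
  assumes "additive f"
  shows "f (x - y) = f x - f y" "f 0 = 0" "f (- x) = - f x" "f (x + y) = f x + f y"
proof -
  show d: "f (x - y) = f x - f y" for x y using assms by (simp add: additive_def)
  show 0: "f 0 = 0" using d[of 0 0] by simp
  show m: "f (- x) = - f x" for x using d[of 0 x] 0 by simp
  show "f (x + y) = f x + f y" using d[of x "- y"] m by simp
qed

lemma hom_compose_additive:
  assumes "f \<in> hom (free_Abelian_group S) G" "additive t"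
    and "\<And>x. Poly_Mapping.keys x \<subseteq> T \<Longrightarrow> Poly_Mapping.keys (t x) \<subseteq> S"
  shows "(\<lambda>x. f (t x)) \<in> hom (free_Abelian_group T) G"
proof (rule homI)
  fix x y assume "x \<in> carrier (free_Abelian_group T)" "y \<in> carrier (free_Abelian_group T)"
  then show "f (t (x \<otimes>\<^bsub>free_Abelian_group T\<^esub> y)) = f (t x) \<otimes>\<^bsub>G\<^esub> f (t y)"
    using assms(1,3) by (simp add: additiveD[OF assms(2)] hom_mult[OF assms(1), simplified])
next
  fix x assume "x \<in> carrier (free_Abelian_group T)"
  then show "f (t x) \<in> carrier G" using assms(3) hom_in_carrier[OF assms(1)] by simp
qed

text \<open>Elements of \<open>hom_group\<close> are extensional; this lets cochains be built as
  unrestricted functions and cut down at the end.\<close>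

lemma hom_restrict_iff:
  "(\<lambda>x\<in>carrier A. f x) \<in> hom A G \<longleftrightarrow> f \<in> hom A G" if "group A"
proof -
  interpret A: group A by fact
  show ?thesis by (auto simp: hom_def Pi_def)
qed

context comm_group
begin

lemma hom_free_Abelian:
  assumes f: "f \<in> hom (free_Abelian_group S) G"
    and xy: "Poly_Mapping.keys x \<subseteq> S" "Poly_Mapping.keys y \<subseteq> S"
  shows "f x \<in> carrier G" "f 0 = \<one>" "f (x + y) = f x \<otimes> f y" "f (- x) = inv (f x)" "f (x - y) = f x \<otimes> inv (f y)"
    "f (frag_cmul (int n) x) = f x [^] n"
proof -
  interpret F: group_hom "free_Abelian_group S" G f
    using f by (simp add: group_hom_def group_hom_axioms_def is_group)
  show "f x \<in> carrier G" using F.hom_closed xy by simp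
  show "f 0 = \<one>" using F.hom_one by simp
  have add: "f (x + y) = f x \<otimes> f y" if "Poly_Mapping.keys x \<subseteq> S" "Poly_Mapping.keys y \<subseteq> S" for x y
    using F.hom_mult[of x y] that by simp
  then show "f (x + y) = f x \<otimes> f y" using xy .
  have inv: "f (- x) = inv (f x)" if "Poly_Mapping.keys x \<subseteq> S" for x using F.hom_inv[of x] that by simp
  then show "f (- x) = inv (f x)" using xy(1) .
  show "f (x - y) = f x \<otimes> inv (f y)" using add[of x "- y"] inv[of y] xy by simp
  show "f (frag_cmul (int n) x) = f x [^] n" using F.hom_nat_pow[of x n] xy by simp
qed

lemma hom_free_Abelian_sum:
  assumes f: "f \<in> hom (free_Abelian_group S) G" and "finite I" "\<And>i. i \<in> I \<Longrightarrow> Poly_Mapping.keys (x i) \<subseteq> S"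
  shows "f (\<Sum>i\<in>I. x i) = finprod G (\<lambda>i. f (x i)) I"
  using assms(2,3)
proof (induction I rule: finite_induct)
  case empty
  show ?case using hom_free_Abelian(2)[OF f, of 0 0] by simp
next
  case (insert i I)
  have "Poly_Mapping.keys (sum x I) \<subseteq> S" using keys_sum[of x I] insert.prems by blast
  then show ?case
    using insert hom_free_Abelian(1,3)[OF f] by (simp add: Pi_def)
qed

lemma hom_free_Abelian_finprod:
  assumes "finite I" "\<And>i. i \<in> I \<Longrightarrow> f i \<in> hom A G" "group A"
  shows "(\<lambda>x. finprod G (\<lambda>i. f i x) I) \<in> hom A G"
proof (rule homI)
  have fc: "f i x \<in> carrier G" if "i \<in> I" "x \<in> carrier A" for i x
    using hom_in_carrier[OF assms(2)[OF that(1)] that(2)] .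
  fix x assume x: "x \<in> carrier A"
  then show "finprod G (\<lambda>i. f i x) I \<in> carrier G" using fc by (intro finprod_closed) auto
  fix y assume y: "y \<in> carrier A"
  have "finprod G (\<lambda>i. f i (x \<otimes>\<^bsub>A\<^esub> y)) I = finprod G (\<lambda>i. f i x \<otimes> f i y) I"
    using fc x y hom_mult[OF assms(2)] by (intro finprod_cong') auto
  also have "\<dots> = finprod G (\<lambda>i. f i x) I \<otimes> finprod G (\<lambda>i. f i y) I"
    using fc x y by (intro finprod_multf) auto
  finally show "finprod G (\<lambda>i. f i (x \<otimes>\<^bsub>A\<^esub> y)) I = finprod G (\<lambda>i. f i x) I \<otimes> finprod G (\<lambda>i. f i y) I" .
qed

lemma hom_free_Abelian_eqI:
  assumes "f \<in> hom (free_Abelian_group S) G" "g \<in> hom (free_Abelian_group S) G"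
    and "\<And>s. s \<in> S \<Longrightarrow> f (frag_of s) = g (frag_of s)" and "Poly_Mapping.keys x \<subseteq> S"
  shows "f x = g x"
proof (rule free_Abelian_group_induct[OF assms(4)])
  show "f 0 = g 0"
    using hom_free_Abelian(2)[OF assms(1), of 0 0] hom_free_Abelian(2)[OF assms(2), of 0 0] by simp
  show "f (x - y) = g (x - y)"
    if "Poly_Mapping.keys x \<subseteq> S" "Poly_Mapping.keys y \<subseteq> S" "f x = g x" "f y = g y" for x y
    using hom_free_Abelian(5)[OF assms(1) that(1,2)] hom_free_Abelian(5)[OF assms(2) that(1,2)] that by simp
qed (rule assms(3))

lemma comm_group_hom_group:
  assumes A: "group A" shows "comm_group (hom_group A G)"
proof (rule comm_groupI)
  interpret A: group A by fact
  fix f g h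
  assume f: "f \<in> carrier (hom_group A G)"
  then have fh: "f \<in> hom A G" "f \<in> extensional (carrier A)" by (auto simp: hom_group_def)
  note fc = hom_in_carrier[OF fh(1)]
  show "\<one>\<^bsub>hom_group A G\<^esub> \<otimes>\<^bsub>hom_group A G\<^esub> f = f"
    using fh(2) fc by (auto simp: hom_group_def extensional_def fun_eq_iff)
  have "(\<lambda>a\<in>carrier A. inv (f a)) \<in> hom A G"
    unfolding hom_restrict_iff[OF A]
    by (rule homI) (auto simp: fc hom_mult[OF fh(1)] inv_mult)
  then have "(\<lambda>a\<in>carrier A. inv (f a)) \<in> carrier (hom_group A G)" by (auto simp: hom_group_def)
  moreover have "(\<lambda>a\<in>carrier A. inv (f a)) \<otimes>\<^bsub>hom_group A G\<^esub> f = \<one>\<^bsub>hom_group A G\<^esub>"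
    using fc by (auto simp: hom_group_def fun_eq_iff)
  ultimately show "\<exists>y\<in>carrier (hom_group A G). y \<otimes>\<^bsub>hom_group A G\<^esub> f = \<one>\<^bsub>hom_group A G\<^esub>" by blast
  assume g: "g \<in> carrier (hom_group A G)"
  then have gh: "g \<in> hom A G" by (auto simp: hom_group_def)
  note gc = hom_in_carrier[OF gh]
  have "(\<lambda>a\<in>carrier A. f a \<otimes> g a) \<in> hom A G"
    unfolding hom_restrict_iff[OF A]
    by (rule homI) (auto simp: fc gc hom_mult[OF fh(1)] hom_mult[OF gh] m_ac)
  then show "f \<otimes>\<^bsub>hom_group A G\<^esub> g \<in> carrier (hom_group A G)" by (auto simp: hom_group_def)
  show "f \<otimes>\<^bsub>hom_group A G\<^esub> g = g \<otimes>\<^bsub>hom_group A G\<^esub> f"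
    using fc gc m_comm by (auto simp: hom_group_def fun_eq_iff)
  assume h: "h \<in> carrier (hom_group A G)"
  then have hc: "a \<in> carrier A \<Longrightarrow> h a \<in> carrier G" for a using hom_in_carrier by (fastforce simp: hom_group_def)
  show "f \<otimes>\<^bsub>hom_group A G\<^esub> g \<otimes>\<^bsub>hom_group A G\<^esub> h = f \<otimes>\<^bsub>hom_group A G\<^esub> (g \<otimes>\<^bsub>hom_group A G\<^esub> h)"
    using fc gc hc m_assoc by (auto simp: hom_group_def fun_eq_iff)
next
  interpret A: group A by fact
  show "\<one>\<^bsub>hom_group A G\<^esub> \<in> carrier (hom_group A G)"
    by (auto simp: hom_group_def hom_def)
qed

end

text \<open>Supports and the vanishing square are demanded only around degree p, which is all that
  cohomology in degree p sees.\<close>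

definition chain_complex_at ::
    "(int \<Rightarrow> 'a set) \<Rightarrow> (int \<Rightarrow> ('a \<Rightarrow>\<^sub>0 int) \<Rightarrow> ('a \<Rightarrow>\<^sub>0 int)) \<Rightarrow> int \<Rightarrow> bool" where
  "chain_complex_at S d p \<longleftrightarrow>
     (\<forall>q. additive (d q)) \<and>
     (\<forall>x. Poly_Mapping.keys x \<subseteq> S p \<longrightarrow> Poly_Mapping.keys (d p x) \<subseteq> S (p - 1)) \<and>
     (\<forall>x. Poly_Mapping.keys x \<subseteq> S (p + 1) \<longrightarrow> Poly_Mapping.keys (d (p + 1) x) \<subseteq> S p) \<and>
     (\<forall>x. Poly_Mapping.keys x \<subseteq> S (p + 1) \<longrightarrow> d p (d (p + 1) x) = 0)"

locale free_cochains = comm_group G for G :: "'g monoid" (structure) +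
  fixes S :: "int \<Rightarrow> 'a set" and d :: "int \<Rightarrow> ('a \<Rightarrow>\<^sub>0 int) \<Rightarrow> ('a \<Rightarrow>\<^sub>0 int)" and p :: int
  assumes complex: "chain_complex_at S d p"
begin

abbreviation C where "C \<equiv> \<lambda>q. free_Abelian_group (S q)"

abbreviation Z where "Z \<equiv> cocycle_group C d G p"

definition B where "B = coboundary C d (p - 1) ` carrier (hom_group (C (p - 1)) G)"

lemma additive_d: "additive (d q)"
  using complex by (simp add: chain_complex_at_def)

lemma keys_d: "Poly_Mapping.keys x \<subseteq> S p \<Longrightarrow> Poly_Mapping.keys (d p x) \<subseteq> S (p - 1)"
  "Poly_Mapping.keys x \<subseteq> S (p + 1) \<Longrightarrow> Poly_Mapping.keys (d (p + 1) x) \<subseteq> S p"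
  using complex by (auto simp: chain_complex_at_def)

lemma cocycle_iff:
  "f \<in> carrier Z \<longleftrightarrow> f \<in> hom (C p) G \<and> f \<in> extensional (carrier (C p)) \<and>
     (\<forall>x. Poly_Mapping.keys x \<subseteq> S (p + 1) \<longrightarrow> f (d (p + 1) x) = \<one>)"
proof -
  have "coboundary C d p f = (\<lambda>x\<in>carrier (C (p + 1)). \<one>) \<longleftrightarrow>
      (\<forall>x. Poly_Mapping.keys x \<subseteq> S (p + 1) \<longrightarrow> f (d (p + 1) x) = \<one>)"
    by (auto simp: coboundary_def fun_eq_iff restrict_def)
  then show ?thesis by (simp add: cocycle_group_def Coset.kernel_def hom_group_def)
qed

text \<open>The primitive b may be any homomorphism; restricting it to the carrier gives the
  extensional one that \<open>hom_group\<close> demands.\<close>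

lemma coboundary_iff:
  "f \<in> B \<longleftrightarrow> f \<in> extensional (carrier (C p)) \<and>
     (\<exists>b\<in>hom (C (p - 1)) G. \<forall>x. Poly_Mapping.keys x \<subseteq> S p \<longrightarrow> f x = b (d p x))"
proof
  assume "f \<in> B"
  then obtain b where "b \<in> hom (C (p - 1)) G" "f = (\<lambda>c\<in>carrier (C p). b (d p c))"
    by (auto simp: B_def coboundary_def hom_group_def)
  then show "f \<in> extensional (carrier (C p)) \<and>
     (\<exists>b\<in>hom (C (p - 1)) G. \<forall>x. Poly_Mapping.keys x \<subseteq> S p \<longrightarrow> f x = b (d p x))" by auto
next
  assume R: "f \<in> extensional (carrier (C p)) \<and>
     (\<exists>b\<in>hom (C (p - 1)) G. \<forall>x. Poly_Mapping.keys x \<subseteq> S p \<longrightarrow> f x = b (d p x))"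
  then obtain b where b: "b \<in> hom (C (p - 1)) G" "\<And>x. Poly_Mapping.keys x \<subseteq> S p \<Longrightarrow> f x = b (d p x)" by blast
  define b' where "b' = (\<lambda>x\<in>carrier (C (p - 1)). b x)"
  have "b' \<in> carrier (hom_group (C (p - 1)) G)"
    using b(1) by (simp add: b'_def hom_group_def hom_restrict_iff)
  moreover have "f = coboundary C d (p - 1) b'"
  proof (rule extensionalityI[of _ "carrier (C p)"])
    fix x assume "x \<in> carrier (C p)"
    then show "f x = coboundary C d (p - 1) b' x"
      using b(2) keys_d(1) by (simp add: coboundary_def b'_def)
  qed (use R in \<open>auto simp: coboundary_def\<close>)
  ultimately show "f \<in> B" unfolding B_def by blast
qed

lemma Z_simps [simp]: "f \<otimes>\<^bsub>Z\<^esub> g = (\<lambda>a\<in>carrier (C p). f a \<otimes> g a)" "\<one>\<^bsub>Z\<^esub> = (\<lambda>a\<in>carrier (C p). \<one>)"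
  by (simp_all add: cocycle_group_def hom_group_def)

lemma comm_group_Z: "comm_group Z"
proof -
  interpret H: comm_group "hom_group (C p) G" by (rule comm_group_hom_group) simp
  have "subgroup (carrier Z) (hom_group (C p) G)"
  proof (rule H.subgroupI)
    show "carrier Z \<subseteq> carrier (hom_group (C p) G)"
      using cocycle_iff by (auto simp: hom_group_def)
    have "(\<lambda>x\<in>carrier (C p). \<one>) \<in> hom (C p) G" using H.one_closed by (simp add: hom_group_def)
    then have "(\<lambda>x\<in>carrier (C p). \<one>) \<in> carrier Z"
      unfolding cocycle_iff using keys_d(2) by simp
    then show "carrier Z \<noteq> {}" by (metis empty_iff)
  next
    fix f assume f: "f \<in> carrier Z"
    let ?i = "\<lambda>a\<in>carrier (C p). inv (f a)"
    have fh: "f \<in> hom (C p) G" using f by (simp add: cocycle_iff)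
    note fc = hom_in_carrier[OF fh]
    have i: "?i \<in> hom (C p) G"
      by (subst hom_restrict_iff, simp) (rule homI, auto simp: hom_free_Abelian[OF fh] inv_mult)
    have "inv\<^bsub>hom_group (C p) G\<^esub> f = ?i"
    proof (rule H.inv_equality)
      show "?i \<otimes>\<^bsub>hom_group (C p) G\<^esub> f = \<one>\<^bsub>hom_group (C p) G\<^esub>"
        using fc by (auto simp: hom_group_def fun_eq_iff)
      show "f \<in> carrier (hom_group (C p) G)" "?i \<in> carrier (hom_group (C p) G)"
        using i f cocycle_iff by (auto simp: hom_group_def)
    qed
    moreover have "?i \<in> carrier Z"
      using i f keys_d(2) by (auto simp: cocycle_iff)
    ultimately show "inv\<^bsub>hom_group (C p) G\<^esub> f \<in> carrier Z" by simp
    fix g assume g: "g \<in> carrier Z"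
    have "f \<otimes>\<^bsub>hom_group (C p) G\<^esub> g \<in> carrier (hom_group (C p) G)"
      using f g cocycle_iff by (intro H.m_closed) (auto simp: hom_group_def)
    then show "f \<otimes>\<^bsub>hom_group (C p) G\<^esub> g \<in> carrier Z"
      using f g keys_d(2) by (auto simp: cocycle_iff hom_group_def)
  qed
  then have "comm_group ((hom_group (C p) G)\<lparr>carrier := carrier Z\<rparr>)"
    using H.subgroup_imp_group H.m_comm subgroup.mem_carrier
    by (intro group.group_comm_groupI) (auto simp: subgroup.mem_carrier)
  moreover have "(hom_group (C p) G)\<lparr>carrier := carrier Z\<rparr> = Z" by (simp add: cocycle_group_def)
  ultimately show ?thesis by simp
qed

sublocale Z: comm_group Z
  by (rule comm_group_Z)

lemma B_subset: "B \<subseteq> carrier Z"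
proof
  fix f assume f: "f \<in> B"
  then obtain b where b: "b \<in> hom (C (p - 1)) G" "\<And>x. Poly_Mapping.keys x \<subseteq> S p \<Longrightarrow> f x = b (d p x)"
    using coboundary_iff by blast
  have "(\<lambda>x. b (d p x)) \<in> hom (C p) G"
    by (rule hom_compose_additive[OF b(1) additive_d keys_d(1)])
  moreover have "f = (\<lambda>x\<in>carrier (C p). b (d p x))"
    by (rule extensionalityI[of _ "carrier (C p)"]) (use f b(2) coboundary_iff in auto)
  ultimately have "f \<in> hom (C p) G" by (simp only: hom_restrict_iff[OF group_free_Abelian_group])
  moreover have "f (d (p + 1) x) = \<one>" if "Poly_Mapping.keys x \<subseteq> S (p + 1)" for x
    using b(2)[OF keys_d(2)[OF that]] that complex hom_free_Abelian(2)[OF b(1), of 0 0]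
    by (simp add: chain_complex_at_def)
  moreover have "f \<in> extensional (carrier (C p))" using f by (simp only: coboundary_iff)
  ultimately show "f \<in> carrier Z" unfolding cocycle_iff by (intro conjI allI impI)
qed

lemma subgroup_B: "subgroup B Z"
proof (rule Z.subgroupI[OF B_subset])
  have "(\<lambda>x\<in>carrier (C p). \<one>) \<in> B"
    unfolding coboundary_iff by (intro conjI bexI[of _ "\<lambda>x. \<one>"]) (auto simp: hom_def)
  then show "B \<noteq> {}" by blast
next
  fix f assume f: "f \<in> B"
  obtain b where b: "b \<in> hom (C (p - 1)) G" "\<And>x. Poly_Mapping.keys x \<subseteq> S p \<Longrightarrow> f x = b (d p x)"
    using f coboundary_iff by blast
  have fZ: "f \<in> carrier Z" using f B_subset by blast
  have fh: "f \<in> hom (C p) G" using fZ cocycle_iff by blast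
  have bi: "(\<lambda>x. inv (b x)) \<in> hom (C (p - 1)) G"
    by (rule homI) (auto simp: hom_free_Abelian[OF b(1)] inv_mult)
  have iZ: "(\<lambda>a\<in>carrier (C p). inv (f a)) \<in> B"
    unfolding coboundary_iff by (intro conjI bexI[OF _ bi]) (auto simp: b(2))
  have "inv\<^bsub>Z\<^esub> f = (\<lambda>a\<in>carrier (C p). inv (f a))"
  proof (rule Z.inv_equality)
    show "(\<lambda>a\<in>carrier (C p). inv (f a)) \<otimes>\<^bsub>Z\<^esub> f = \<one>\<^bsub>Z\<^esub>"
      using hom_in_carrier[OF fh] by (auto simp: fun_eq_iff)
  qed (use fZ iZ B_subset in auto)
  then show "inv\<^bsub>Z\<^esub> f \<in> B" using iZ by simp
  fix g assume g: "g \<in> B"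
  obtain b' where b': "b' \<in> hom (C (p - 1)) G" "\<And>x. Poly_Mapping.keys x \<subseteq> S p \<Longrightarrow> g x = b' (d p x)"
    using g coboundary_iff by blast
  have "(\<lambda>x. b x \<otimes> b' x) \<in> hom (C (p - 1)) G"
    by (rule homI) (auto simp: hom_free_Abelian[OF b(1)] hom_free_Abelian[OF b'(1)] m_ac)
  then show "f \<otimes>\<^bsub>Z\<^esub> g \<in> B"
    unfolding coboundary_iff by (intro conjI bexI[of _ "\<lambda>x. b x \<otimes> b' x"]) (auto simp: b(2) b'(2))
qed

lemma normal_B: "B \<lhd> Z"
  by (rule Z.subgroup_imp_normal[OF subgroup_B])

lemma cohomology_eq: "cohomology_group C d G p = Z Mod B"
  by (simp add: cohomology_group_def B_def)

lemma group_cohomology: "group (cohomology_group C d G p)"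
  unfolding cohomology_eq by (rule normal.factorgroup_is_group[OF normal_B])

end

text \<open>The isomorphism sends the class of f to the family of classes of f composed with
  \<Theta> i, and is obtained from the first isomorphism theorem on cocycles. \<open>cocycle\<close>
  and \<open>cobound\<close> make it well defined, \<open>surj\<close> and \<open>inj\<close> are
  surjectivity and injectivity on classes. In this form \<Theta> i may shift degrees and commute
  with boundaries only up to sign.\<close>

lemma cohomology_iso_sum_groupI:
  fixes G :: "'g monoid" and S :: "int \<Rightarrow> 'a set" and T :: "'i \<Rightarrow> int \<Rightarrow> 'b set"
  assumes S: "free_cochains G S d p" and T: "\<And>i. i \<in> I \<Longrightarrow> free_cochains G (T i) dT p'"
    and fin: "finite I"
    and \<Theta>: "\<And>i. additive (\<Theta> i)"
    and keys: "\<And>i x. i \<in> I \<Longrightarrow> Poly_Mapping.keys x \<subseteq> T i p' \<Longrightarrow> Poly_Mapping.keys (\<Theta> i x) \<subseteq> S p"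
    and cocycle: "\<And>i f x. i \<in> I \<Longrightarrow> f \<in> hom (free_Abelian_group (S p)) G \<Longrightarrow>
        (\<And>x. Poly_Mapping.keys x \<subseteq> S (p + 1) \<Longrightarrow> f (d (p + 1) x) = \<one>\<^bsub>G\<^esub>) \<Longrightarrow>
        Poly_Mapping.keys x \<subseteq> T i (p' + 1) \<Longrightarrow> f (\<Theta> i (dT (p' + 1) x)) = \<one>\<^bsub>G\<^esub>"
    and cobound: "\<And>i b. i \<in> I \<Longrightarrow> b \<in> hom (free_Abelian_group (S (p - 1))) G \<Longrightarrow>
        \<exists>b'\<in>hom (free_Abelian_group (T i (p' - 1))) G.
          \<forall>x. Poly_Mapping.keys x \<subseteq> T i p' \<longrightarrow> b (d p (\<Theta> i x)) = b' (dT p' x)"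
    and surj: "\<And>h. (\<And>i. i \<in> I \<Longrightarrow> h i \<in> hom (free_Abelian_group (T i p')) G) \<Longrightarrow>
        (\<And>i x. i \<in> I \<Longrightarrow> Poly_Mapping.keys x \<subseteq> T i (p' + 1) \<Longrightarrow> h i (dT (p' + 1) x) = \<one>\<^bsub>G\<^esub>) \<Longrightarrow>
        \<exists>f\<in>hom (free_Abelian_group (S p)) G.
          (\<forall>x. Poly_Mapping.keys x \<subseteq> S (p + 1) \<longrightarrow> f (d (p + 1) x) = \<one>\<^bsub>G\<^esub>) \<and>
          (\<forall>i\<in>I. \<exists>b\<in>hom (free_Abelian_group (T i (p' - 1))) G.
             \<forall>x. Poly_Mapping.keys x \<subseteq> T i p' \<longrightarrow> f (\<Theta> i x) = b (dT p' x) \<otimes>\<^bsub>G\<^esub> h i x)"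
    and inj: "\<And>f. f \<in> hom (free_Abelian_group (S p)) G \<Longrightarrow>
        (\<And>x. Poly_Mapping.keys x \<subseteq> S (p + 1) \<Longrightarrow> f (d (p + 1) x) = \<one>\<^bsub>G\<^esub>) \<Longrightarrow>
        (\<And>i. i \<in> I \<Longrightarrow> \<exists>b\<in>hom (free_Abelian_group (T i (p' - 1))) G.
             \<forall>x. Poly_Mapping.keys x \<subseteq> T i p' \<longrightarrow> f (\<Theta> i x) = b (dT p' x)) \<Longrightarrow>
        \<exists>b\<in>hom (free_Abelian_group (S (p - 1))) G. \<forall>x. Poly_Mapping.keys x \<subseteq> S p \<longrightarrow> f x = b (d p x)"
  shows "cohomology_group (\<lambda>q. free_Abelian_group (S q)) d G p
       \<cong> sum_group I (\<lambda>i. cohomology_group (\<lambda>q. free_Abelian_group (T i q)) dT G p')"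
proof -
  interpret S: free_cochains G S d p by (rule S)
  let ?Z = "\<lambda>i. cocycle_group (\<lambda>q. free_Abelian_group (T i q)) dT G p'"
  let ?H = "\<lambda>i. cohomology_group (\<lambda>q. free_Abelian_group (T i q)) dT G p'"
  define BT where "BT i = free_cochains.B G (T i) dT p'" for i
  define res where "res i f = (\<lambda>x\<in>carrier (free_Abelian_group (T i p')). f (\<Theta> i x))" for i and f :: "('a \<Rightarrow>\<^sub>0 int) \<Rightarrow> 'g"
  define cls where "cls i z = BT i #>\<^bsub>?Z i\<^esub> z" for i z
  define h where "h f = (\<lambda>i\<in>I. cls i (res i f))" for f
  have HT: "?H i = ?Z i Mod BT i" if "i \<in> I" for i
    using free_cochains.cohomology_eq[OF T[OF that]] by (simp add: BT_def)
  have grpT: "group (?H i)" if "i \<in> I" for i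
    using free_cochains.group_cohomology[OF T[OF that]] .
  have cls_hom: "cls i \<in> hom (?Z i) (?H i)" if "i \<in> I" for i
    unfolding cls_def HT[OF that] BT_def
    by (rule normal.r_coset_hom_Mod[OF free_cochains.normal_B[OF T[OF that]]])
  have resZ: "res i f \<in> carrier (?Z i)" if i: "i \<in> I" and f: "f \<in> carrier S.Z" for i f
  proof -
    interpret T: free_cochains G "T i" dT p' by (rule T[OF i])
    have fh: "f \<in> hom (free_Abelian_group (S p)) G"
      "\<And>x. Poly_Mapping.keys x \<subseteq> S (p + 1) \<Longrightarrow> f (d (p + 1) x) = \<one>\<^bsub>G\<^esub>"
      using f S.cocycle_iff by blast+
    have "res i f \<in> hom (free_Abelian_group (T i p')) G"
      unfolding res_def hom_restrict_iff[OF group_free_Abelian_group]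
      by (rule hom_compose_additive[OF fh(1) \<Theta> keys[OF i]])
    moreover have "res i f (dT (p' + 1) x) = \<one>\<^bsub>G\<^esub>" if x: "Poly_Mapping.keys x \<subseteq> T i (p' + 1)" for x
      using cocycle[OF i fh x] T.keys_d(2)[OF x] by (simp add: res_def)
    moreover have "res i f \<in> extensional (carrier (free_Abelian_group (T i p')))" by (simp only: res_def restrict_extensional)
    ultimately show ?thesis unfolding T.cocycle_iff by (intro conjI allI impI)
  qed
  have res_mult: "res i (f \<otimes>\<^bsub>S.Z\<^esub> g) = res i f \<otimes>\<^bsub>?Z i\<^esub> res i g" if i: "i \<in> I" for i f g
  proof -
    interpret T: free_cochains G "T i" dT p' by (rule T[OF i])
    show ?thesis using keys[OF i] by (auto simp: res_def fun_eq_iff)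
  qed
  have resB: "res i f \<in> BT i \<longleftrightarrow> (\<exists>b\<in>hom (free_Abelian_group (T i (p' - 1))) G.
             \<forall>x. Poly_Mapping.keys x \<subseteq> T i p' \<longrightarrow> f (\<Theta> i x) = b (dT p' x))" if i: "i \<in> I" for i f
  proof -
    interpret T: free_cochains G "T i" dT p' by (rule T[OF i])
    have "res i f \<in> extensional (carrier (free_Abelian_group (T i p')))" by (simp only: res_def restrict_extensional)
    then show ?thesis unfolding BT_def T.coboundary_iff by (simp add: res_def)
  qed
  \<comment> \<open>For finite I the direct sum is the full product, so membership may be checked
    one coordinate at a time.\<close>
  have cs: "carrier (sum_group I ?H) = (\<Pi>\<^sub>E i\<in>I. carrier (?H i))"
    using fin by (subst carrier_sum_group[OF grpT]) auto
  have hh: "h \<in> hom S.Z (sum_group I ?H)"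
  proof (rule homI)
    fix f assume f: "f \<in> carrier S.Z"
    show "h f \<in> carrier (sum_group I ?H)"
      unfolding cs h_def by (rule restrict_PiE_iff[THEN iffD2]) (use hom_in_carrier[OF cls_hom resZ[OF _ f]] in blast)
    fix g assume g: "g \<in> carrier S.Z"
    show "h (f \<otimes>\<^bsub>S.Z\<^esub> g) = h f \<otimes>\<^bsub>sum_group I ?H\<^esub> h g"
      unfolding mult_sum_group h_def
    proof (rule restrict_ext)
      fix i assume i: "i \<in> I"
      have "cls i (res i (f \<otimes>\<^bsub>S.Z\<^esub> g)) = cls i (res i f) \<otimes>\<^bsub>?H i\<^esub> cls i (res i g)"
        unfolding res_mult[OF i] by (rule hom_mult[OF cls_hom[OF i] resZ[OF i f] resZ[OF i g]])
      then show "cls i (res i (f \<otimes>\<^bsub>S.Z\<^esub> g)) = (\<lambda>i\<in>I. cls i (res i f)) i \<otimes>\<^bsub>?H i\<^esub> (\<lambda>i\<in>I. cls i (res i g)) i"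
        using i by (simp only: restrict_apply')
    qed
  qed
  interpret h: group_hom S.Z "sum_group I ?H" h
    using hh grpT by (auto simp: group_hom_def group_hom_axioms_def S.Z.is_group)
  have onto: "h ` carrier S.Z = carrier (sum_group I ?H)"
  proof
    show "h ` carrier S.Z \<subseteq> carrier (sum_group I ?H)" using h.hom_closed by blast
    show "carrier (sum_group I ?H) \<subseteq> h ` carrier S.Z"
    proof
      fix y assume "y \<in> carrier (sum_group I ?H)"
      then have y: "y \<in> (\<Pi>\<^sub>E i\<in>I. carrier (?H i))" using cs by simp
      have "\<exists>z\<in>carrier (?Z i). y i = cls i z" if i: "i \<in> I" for i
      proof -
        have "y i \<in> carrier (?Z i Mod BT i)" using y i HT[OF i] by (metis PiE_mem)
        then show ?thesis by (auto simp: FactGroup_def RCOSETS_def cls_def)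
      qed
      then obtain z where z: "\<And>i. i \<in> I \<Longrightarrow> z i \<in> carrier (?Z i)" "\<And>i. i \<in> I \<Longrightarrow> y i = cls i (z i)" by metis
      have zh: "z i \<in> hom (free_Abelian_group (T i p')) G"
        "Poly_Mapping.keys x \<subseteq> T i (p' + 1) \<Longrightarrow> z i (dT (p' + 1) x) = \<one>\<^bsub>G\<^esub>" if i: "i \<in> I" for i x
        using z(1)[OF i] unfolding free_cochains.cocycle_iff[OF T[OF i]] by simp_all
      have "\<exists>f\<in>hom (free_Abelian_group (S p)) G.
          (\<forall>x. Poly_Mapping.keys x \<subseteq> S (p + 1) \<longrightarrow> f (d (p + 1) x) = \<one>\<^bsub>G\<^esub>) \<and>
          (\<forall>i\<in>I. \<exists>b\<in>hom (free_Abelian_group (T i (p' - 1))) G.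
             \<forall>x. Poly_Mapping.keys x \<subseteq> T i p' \<longrightarrow> f (\<Theta> i x) = b (dT p' x) \<otimes>\<^bsub>G\<^esub> z i x)"
        by (rule surj[OF zh])
      then obtain f where f: "f \<in> hom (free_Abelian_group (S p)) G"
         "\<forall>x. Poly_Mapping.keys x \<subseteq> S (p + 1) \<longrightarrow> f (d (p + 1) x) = \<one>\<^bsub>G\<^esub>"
         "\<forall>i\<in>I. \<exists>b\<in>hom (free_Abelian_group (T i (p' - 1))) G.
             \<forall>x. Poly_Mapping.keys x \<subseteq> T i p' \<longrightarrow> f (\<Theta> i x) = b (dT p' x) \<otimes>\<^bsub>G\<^esub> z i x"
        by (elim bexE conjE)
      define f' where "f' = (\<lambda>x\<in>carrier (free_Abelian_group (S p)). f x)"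
      have f'h: "f' \<in> hom (free_Abelian_group (S p)) G"
        unfolding f'_def hom_restrict_iff[OF group_free_Abelian_group] by (rule f(1))
      have f'Z: "f' \<in> carrier S.Z"
        unfolding S.cocycle_iff
      proof (intro conjI allI impI)
        show "f' (d (p + 1) x) = \<one>\<^bsub>G\<^esub>" if "Poly_Mapping.keys x \<subseteq> S (p + 1)" for x
          using f(2) that S.keys_d(2)[OF that] by (simp add: f'_def)
      qed (rule f'h, simp only: f'_def restrict_extensional)
      have "y i = cls i (res i f')" if i: "i \<in> I" for i
      proof -
        interpret T: free_cochains G "T i" dT p' by (rule T[OF i])
        obtain b where b: "b \<in> hom (free_Abelian_group (T i (p' - 1))) G"
            "\<And>x. Poly_Mapping.keys x \<subseteq> T i p' \<Longrightarrow> f (\<Theta> i x) = b (dT p' x) \<otimes>\<^bsub>G\<^esub> z i x"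
          using bspec[OF f(3) i] by (elim bexE) blast
        define \<beta> where "\<beta> = (\<lambda>x\<in>carrier (free_Abelian_group (T i p')). b (dT p' x))"
        have \<beta>: "\<beta> \<in> BT i"
          unfolding BT_def T.coboundary_iff using b(1) by (auto simp: \<beta>_def)
        have "res i f' = \<beta> \<otimes>\<^bsub>?Z i\<^esub> z i"
          using b(2) keys[OF i] by (auto simp: res_def f'_def \<beta>_def fun_eq_iff)
        then have "res i f' \<in> BT i #>\<^bsub>?Z i\<^esub> z i" using \<beta> unfolding r_coset_def by blast
        then show ?thesis
          unfolding z(2)[OF i] cls_def BT_def
          by (rule T.Z.repr_independence[OF _ z(1)[OF i] T.subgroup_B])
      qed
      then have "y i = h f' i" for i
        using PiE_arb[OF y, of i] by (cases "i \<in> I") (simp_all add: h_def)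
      then have "y = h f'" by (rule ext)
      then show "y \<in> h ` carrier S.Z" using f'Z by (rule image_eqI)
    qed
  qed
  have ker: "Coset.kernel S.Z (sum_group I ?H) h = S.B"
  proof (intro equalityI subsetI)
    have one: "cls i (res i f) = \<one>\<^bsub>?H i\<^esub> \<longleftrightarrow> res i f \<in> BT i" if i: "i \<in> I" and f: "f \<in> carrier S.Z" for i f
    proof -
      interpret T: free_cochains G "T i" dT p' by (rule T[OF i])
      have "\<one>\<^bsub>?H i\<^esub> = BT i" by (simp add: HT[OF i])
      then show ?thesis unfolding cls_def BT_def
        using T.Z.coset_join1[OF _ resZ[OF i f] T.subgroup_B] T.Z.coset_join2[OF resZ[OF i f] T.subgroup_B] by auto
    qed
    {
      fix f assume "f \<in> Coset.kernel S.Z (sum_group I ?H) h"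
      then have fZ: "f \<in> carrier S.Z" and hf: "h f = (\<lambda>i\<in>I. \<one>\<^bsub>?H i\<^esub>)"
        by (auto simp: Coset.kernel_def)
      have co: "cls i (res i f) = \<one>\<^bsub>?H i\<^esub>" if i: "i \<in> I" for i
        using fun_cong[OF hf, of i] i by (simp only: h_def restrict_apply')
      have bi: "\<exists>b\<in>hom (free_Abelian_group (T i (p' - 1))) G.
             \<forall>x. Poly_Mapping.keys x \<subseteq> T i p' \<longrightarrow> f (\<Theta> i x) = b (dT p' x)" if "i \<in> I" for i
        unfolding resB[OF that, symmetric] one[OF that fZ, symmetric] by (rule co[OF that])
      have fh: "f \<in> hom (free_Abelian_group (S p)) G"
        "Poly_Mapping.keys x \<subseteq> S (p + 1) \<Longrightarrow> f (d (p + 1) x) = \<one>\<^bsub>G\<^esub>" for x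
        using fZ unfolding S.cocycle_iff by simp_all
      have fe: "f \<in> extensional (carrier (free_Abelian_group (S p)))" using fZ by (simp only: S.cocycle_iff)
      show "f \<in> S.B"
        unfolding S.coboundary_iff by (intro conjI fe inj[OF fh bi])
    }
    fix f assume fB: "f \<in> S.B"
    then have fZ: "f \<in> carrier S.Z" using S.B_subset by blast
    obtain b where b: "b \<in> hom (free_Abelian_group (S (p - 1))) G" "\<And>x. Poly_Mapping.keys x \<subseteq> S p \<Longrightarrow> f x = b (d p x)"
      using fB S.coboundary_iff by blast
    have "res i f \<in> BT i" if i: "i \<in> I" for i
      using cobound[OF i b(1)] b(2) keys[OF i] unfolding resB[OF i] by metis
    then have "h f = (\<lambda>i\<in>I. \<one>\<^bsub>?H i\<^esub>)" unfolding h_def using one[OF _ fZ] by (auto intro: restrict_ext)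
    then show "f \<in> Coset.kernel S.Z (sum_group I ?H) h" using fZ by (auto simp: Coset.kernel_def)
  qed
  show ?thesis
    using h.FactGroup_iso[OF onto] unfolding ker S.cohomology_eq .
qed

section \<open>Coefficients in which two is invertible\<close>

lemma keys_simplicial_boundary:
  assumes "Poly_Mapping.keys x \<subseteq> {\<sigma> \<in> L. finite \<sigma> \<and> int (card \<sigma>) = q + 1}"
    and down: "\<And>\<sigma> \<tau>. \<sigma> \<in> L \<Longrightarrow> \<tau> \<subseteq> \<sigma> \<Longrightarrow> \<tau> \<in> L"
  shows "Poly_Mapping.keys (simplicial_boundary x) \<subseteq> {\<sigma> \<in> L. finite \<sigma> \<and> int (card \<sigma>) = q}"
  unfolding simplicial_boundary_def
proof (rule keys_frag_extend_subset[OF assms(1)])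
  fix \<sigma> assume \<sigma>: "\<sigma> \<in> {\<sigma> \<in> L. finite \<sigma> \<and> int (card \<sigma>) = q + 1}"
  have "\<sigma> - {v} \<in> {\<sigma> \<in> L. finite \<sigma> \<and> int (card \<sigma>) = q}" if v: "v \<in> \<sigma>" for v
  proof -
    have "card \<sigma> = Suc (card (\<sigma> - {v}))" using \<sigma> v by (intro card.remove) auto
    then show ?thesis using \<sigma> down[of \<sigma> "\<sigma> - {v}"] by auto
  qed
  then show "Poly_Mapping.keys (\<Sum>v\<in>\<sigma>. frag_cmul ((-1) ^ card {u \<in> \<sigma>. u < v}) (frag_of (\<sigma> - {v})))
      \<subseteq> {\<sigma> \<in> L. finite \<sigma> \<and> int (card \<sigma>) = q}"
    by (intro order_trans[OF keys_sum] UN_least order_trans[OF keys_cmul]) simp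
qed

lemma simplicial_boundary_boundary:
  assumes "Poly_Mapping.keys x \<subseteq> {\<sigma>. finite \<sigma>}"
  shows "simplicial_boundary (simplicial_boundary x) = 0"
proof (rule frag_additive_eqI[OF assms, where f = "\<lambda>x. simplicial_boundary (simplicial_boundary x)" and g = "\<lambda>_. 0"])
  fix \<sigma> :: "nat set" assume "\<sigma> \<in> {\<sigma>. finite \<sigma>}"
  then have fin: "finite \<sigma>" by simp
  have sb_sum: "simplicial_boundary (sum f S) = (\<Sum>i\<in>S. simplicial_boundary (f i))" if "finite S" for f and S :: "nat set"
    using frag_extend_sum[OF that] by (simp add: simplicial_boundary_def o_def)
  have sb_cmul: "simplicial_boundary (frag_cmul n y) = frag_cmul n (simplicial_boundary y)" for n y
    by (simp add: simplicial_boundary_def frag_extend_cmul)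
  have "simplicial_boundary (simplicial_boundary (frag_of \<sigma>)) =
    (\<Sum>i\<in>\<sigma>. frag_cmul (position_sign \<sigma> i) (\<Sum>j\<in>\<sigma> - {i}. frag_cmul (position_sign (\<sigma> - {i}) j) (frag_of (\<sigma> - {i} - {j}))))"
    by (simp only: simplicial_boundary_of sb_sum[OF fin] sb_cmul)
  also have "\<dots> = 0"
    by (rule alternating_double_sum_0[OF fin]) (rule arg_cong[where f = frag_of], blast)
  finally show "simplicial_boundary (simplicial_boundary (frag_of \<sigma>)) = 0" .
qed auto

text \<open>Doubling is a bijection: this is the common property of the rationals and of \<int>/q
  for odd q on which the decomposition rests.\<close>

locale uniquely_two_divisible = comm_group G for G :: "'g monoid" (structure) +
  assumes double_surj: "x \<in> carrier G \<Longrightarrow> \<exists>y\<in>carrier G. y \<otimes> y = x"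
    and double_inj: "x \<in> carrier G \<Longrightarrow> x \<otimes> x = \<one> \<Longrightarrow> x = \<one>"
begin

lemma pow_two_power_Suc:
  assumes "x \<in> carrier G"
  shows "x [^] (2 ^ Suc N :: nat) = x [^] (2 ^ N :: nat) \<otimes> x [^] (2 ^ N :: nat)"
  unfolding nat_pow_mult[OF assms] by (simp only: power_Suc mult_2)

lemma hom_mult_pointwise:
  assumes "f \<in> hom (free_Abelian_group S) G" "g \<in> hom (free_Abelian_group S) G"
  shows "(\<lambda>x. f x \<otimes> g x) \<in> hom (free_Abelian_group S) G"
  by (rule homI) (auto simp: hom_free_Abelian[OF assms(1)] hom_free_Abelian[OF assms(2)] m_ac)

lemma hom_inv_pointwise:
  assumes "f \<in> hom (free_Abelian_group S) G"
  shows "(\<lambda>x. inv (f x)) \<in> hom (free_Abelian_group S) G"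
  by (rule homI) (auto simp: hom_free_Abelian[OF assms] inv_mult)

lemma root_exists: "x \<in> carrier G \<Longrightarrow> \<exists>y\<in>carrier G. y [^] (2 ^ N :: nat) = x"
proof (induction N arbitrary: x)
  case 0
  then show ?case by (intro bexI[of _ x]) simp_all
next
  case (Suc N)
  obtain z where z: "z \<in> carrier G" "z \<otimes> z = x" using double_surj[OF Suc.prems] by blast
  obtain y where y: "y \<in> carrier G" "y [^] (2 ^ N :: nat) = z" using Suc.IH[OF z(1)] by blast
  have "y [^] (2 ^ Suc N :: nat) = x" by (simp only: pow_two_power_Suc[OF y(1)] y z)
  then show ?case using y(1) by blast
qed

lemma pow_two_power_eq_one: "x \<in> carrier G \<Longrightarrow> x [^] (2 ^ N :: nat) = \<one> \<Longrightarrow> x = \<one>"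
proof (induction N)
  case (Suc N)
  have "x [^] (2 ^ N :: nat) \<otimes> x [^] (2 ^ N :: nat) = \<one>"
    using Suc.prems(2) by (simp only: pow_two_power_Suc[OF Suc.prems(1)])
  then have "x [^] (2 ^ N :: nat) = \<one>" using double_inj[OF nat_pow_closed[OF Suc.prems(1)]] by blast
  then show ?case by (rule Suc.IH[OF Suc.prems(1)])
qed simp

lemma pow_two_power_inj:
  assumes "x \<in> carrier G" "y \<in> carrier G" "x [^] (2 ^ N :: nat) = y [^] (2 ^ N :: nat)"
  shows "x = y"
proof -
  have xy: "x \<otimes> inv y \<in> carrier G" using assms by simp
  have "(x \<otimes> inv y) [^] (2 ^ N :: nat) \<otimes> y [^] (2 ^ N :: nat) = (x \<otimes> inv y \<otimes> y) [^] (2 ^ N :: nat)"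
    using assms by (intro nat_pow_distrib[symmetric]) auto
  also have "\<dots> = \<one> \<otimes> y [^] (2 ^ N :: nat)" using assms by (simp add: m_assoc)
  finally have "(x \<otimes> inv y) [^] (2 ^ N :: nat) = \<one>"
    by (simp only: right_cancel[OF nat_pow_closed[OF assms(2)] nat_pow_closed[OF xy] one_closed])
  then have "x \<otimes> inv y = \<one>" by (rule pow_two_power_eq_one[OF xy])
  then have "x \<otimes> inv y \<otimes> y = y" using assms by simp
  then show ?thesis using assms by (simp add: m_assoc)
qed

text \<open>Roots are chosen on basis elements and extended by freeness; since powers are
  homomorphisms in a commutative group, the identity spreads from the basis to all chains.\<close>

lemma hom_root_exists:
  assumes f: "f \<in> hom (free_Abelian_group S) G"
  obtains e where "e \<in> hom (free_Abelian_group S) G"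
    "\<And>x. Poly_Mapping.keys x \<subseteq> S \<Longrightarrow> e x [^] (2 ^ N :: nat) = f x"
proof -
  have "\<exists>y\<in>carrier G. y [^] (2 ^ N :: nat) = f (frag_of s)" if "s \<in> S" for s
    using root_exists hom_in_carrier[OF f, of "frag_of s"] that by simp
  then obtain r where r: "\<And>s. s \<in> S \<Longrightarrow> r s \<in> carrier G \<and> r s [^] (2 ^ N :: nat) = f (frag_of s)" by metis
  then have "r ` S \<subseteq> carrier G" by blast
  then obtain e where e: "e \<in> hom (free_Abelian_group S) G" "\<And>s. s \<in> S \<Longrightarrow> e (frag_of s) = r s"
    using free_Abelian_group_universal by metis
  have "e x [^] (2 ^ N :: nat) = f x" if x: "Poly_Mapping.keys x \<subseteq> S" for x
  proof (rule hom_free_Abelian_eqI[OF _ f _ x, of "\<lambda>x. e x [^] (2 ^ N :: nat)"])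
    show "(\<lambda>x. e x [^] (2 ^ N :: nat)) \<in> hom (free_Abelian_group S) G"
      by (rule homI) (auto simp: hom_free_Abelian[OF e(1)] nat_pow_distrib)
  qed (use e(2) r in auto)
  then show thesis using that e(1) by blast
qed

end

context dual_reflection_group
begin

lemma additive_maps: "additive \<Phi>" "additive (\<theta> \<omega>)" "additive (\<theta>' \<omega>)" "additive orbit_boundary"
    "additive simplicial_boundary" "additive (\<lambda>x. \<Phi> (\<theta> \<omega> x))" "additive (\<lambda>x. - \<Phi> (\<theta> \<omega> x))"
  by (simp_all add: additive_def)

lemma singular_chain_\<Phi>_cells:
  "Poly_Mapping.keys x \<subseteq> orbit_cells cells q \<Longrightarrow> singular_chain q M (\<Phi> x)"
  using singular_chain_\<Phi>[OF subcomplex_cells] by (simp add: MW_cells)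

lemma keys_simplicial_boundary_simplices:
  assumes "Poly_Mapping.keys x \<subseteq> simplices \<omega> (Suc q)"
  shows "Poly_Mapping.keys (simplicial_boundary x) \<subseteq> simplices \<omega> q"
proof -
  let ?L = "{\<sigma> \<in> K. \<sigma> \<subseteq> \<omega>}"
  have "Poly_Mapping.keys (simplicial_boundary x) \<subseteq> {\<sigma> \<in> ?L. finite \<sigma> \<and> int (card \<sigma>) = int q}"
  proof (rule keys_simplicial_boundary)
    show "Poly_Mapping.keys x \<subseteq> {\<sigma> \<in> ?L. finite \<sigma> \<and> int (card \<sigma>) = int q + 1}"
      using assms simplexD by (auto simp: simplices_def)
  qed (use K_down in blast)
  then show ?thesis by (auto simp: simplices_def)
qed

lemma simplicial_boundary_0:
  assumes "Poly_Mapping.keys x \<subseteq> simplices \<omega> 0"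
  shows "simplicial_boundary x = 0"
proof (rule frag_additive_eqI[OF assms, where f = simplicial_boundary and g = "\<lambda>_. 0"])
  fix \<sigma> assume "\<sigma> \<in> simplices \<omega> 0"
  then have "\<sigma> = {}" using simplexD[of \<sigma>] by (simp add: simplices_def)
  then show "simplicial_boundary (frag_of \<sigma>) = 0" by (simp add: simplicial_boundary_of)
qed auto

end

section \<open>Cochains on orbit cells and cochains on full subcomplexes\<close>

locale dual_reflection_group_coefficients =
  dual_reflection_group m K \<Gamma> R + uniquely_two_divisible G
  for m K \<Gamma> R and G :: "'g monoid" (structure)
begin

text \<open>A power of 2 times any orbit chain is a sum of images of the maps \<theta>, and G has no
  2-torsion.\<close>

lemma hom_vanishes_if_on_\<theta>:
  assumes u: "u \<in> hom (free_Abelian_group (orbit_cells cells q)) G"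
    and 0: "\<And>\<omega> y. \<omega> \<in> R \<Longrightarrow> Poly_Mapping.keys y \<subseteq> simplices \<omega> q \<Longrightarrow> u (\<theta> \<omega> y) = \<one>"
    and x: "Poly_Mapping.keys x \<subseteq> orbit_cells cells q"
  shows "u x = \<one>"
proof -
  have "u x [^] (2 ^ (m - q) :: nat) = u (frag_cmul (int (2 ^ (m - q))) x)"
    by (rule hom_free_Abelian(6)[OF u x x, symmetric])
  also have "\<dots> = u (\<Sum>\<omega>\<in>R. \<theta> \<omega> (\<theta>' \<omega> x))" by (simp add: sum_\<theta>_\<theta>'[OF x])
  also have "\<dots> = finprod G (\<lambda>\<omega>. u (\<theta> \<omega> (\<theta>' \<omega> x))) R"
    using keys_\<theta>[OF keys_\<theta>'[OF x]] by (intro hom_free_Abelian_sum[OF u finite_R])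
  also have "\<dots> = \<one>" using 0[OF _ keys_\<theta>'[OF x]] by (intro finprod_one_eqI) auto
  finally show ?thesis using pow_two_power_eq_one hom_free_Abelian(1)[OF u x x] by blast
qed

text \<open>The product of all h \<omega> composed with \<theta>' \<omega> restricts along \<theta>
  \<omega> to the 2^(m-q)-th power of h \<omega>, by orthogonality; extracting a root removes the
  exponent.\<close>

lemma hom_extends_from_\<theta>:
  assumes h: "\<And>\<omega>. \<omega> \<in> R \<Longrightarrow> h \<omega> \<in> hom (free_Abelian_group (simplices \<omega> q)) G"
  obtains e where "e \<in> hom (free_Abelian_group (orbit_cells cells q)) G"
    "\<And>\<omega> y. \<omega> \<in> R \<Longrightarrow> Poly_Mapping.keys y \<subseteq> simplices \<omega> q \<Longrightarrow> e (\<theta> \<omega> y) = h \<omega> y"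
proof -
  let ?F = "\<lambda>x. finprod G (\<lambda>\<omega>. h \<omega> (\<theta>' \<omega> x)) R"
  have "?F \<in> hom (free_Abelian_group (orbit_cells cells q)) G"
    by (intro hom_free_Abelian_finprod finite_R hom_compose_additive[OF h additive_maps(3) keys_\<theta>']) simp_all
  then obtain e where e: "e \<in> hom (free_Abelian_group (orbit_cells cells q)) G"
     "\<And>x. Poly_Mapping.keys x \<subseteq> orbit_cells cells q \<Longrightarrow> e x [^] (2 ^ (m - q) :: nat) = ?F x"
    using hom_root_exists by blast
  have "e (\<theta> \<omega> y) = h \<omega> y" if \<omega>: "\<omega> \<in> R" and y: "Poly_Mapping.keys y \<subseteq> simplices \<omega> q" for \<omega> y
  proof (rule pow_two_power_inj)
    have ty: "Poly_Mapping.keys (\<theta> \<omega> y) \<subseteq> orbit_cells cells q" by (rule keys_\<theta>[OF y])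
    show "e (\<theta> \<omega> y) \<in> carrier G" by (rule hom_free_Abelian(1)[OF e(1) ty ty])
    show hy: "h \<omega> y \<in> carrier G" by (rule hom_free_Abelian(1)[OF h[OF \<omega>] y y])
    have "e (\<theta> \<omega> y) [^] (2 ^ (m - q) :: nat) = ?F (\<theta> \<omega> y)" by (rule e(2)[OF ty])
    also have "\<dots> = finprod G (\<lambda>\<omega>'. if \<omega> = \<omega>' then h \<omega> y [^] (2 ^ (m - q) :: nat) else \<one>) R"
    proof (intro finprod_cong' refl)
      fix \<omega>' assume \<omega>': "\<omega>' \<in> R"
      have "h \<omega> (frag_cmul (int (2 ^ (m - q))) y) = h \<omega> y [^] (2 ^ (m - q) :: nat)"
        by (rule hom_free_Abelian(6)[OF h[OF \<omega>] y y])
      moreover have "h \<omega>' 0 = \<one>" using hom_free_Abelian(2)[OF h[OF \<omega>'], of 0 0] by simp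
      ultimately show "h \<omega>' (\<theta>' \<omega>' (\<theta> \<omega> y)) = (if \<omega> = \<omega>' then h \<omega> y [^] (2 ^ (m - q) :: nat) else \<one>)"
        unfolding \<theta>'_\<theta>[OF \<omega> \<omega>' y] by auto
    qed (use hy in auto)
    also have "\<dots> = h \<omega> y [^] (2 ^ (m - q) :: nat)"
      using finprod_singleton[OF \<omega> finite_R, of "\<lambda>_. h \<omega> y [^] (2 ^ (m - q) :: nat)"] hy by simp
    finally show "e (\<theta> \<omega> y) [^] (2 ^ (m - q) :: nat) = h \<omega> y [^] (2 ^ (m - q) :: nat)" .
  qed
  then show thesis using that e(1) by blast
qed

text \<open>Whether the extension is a cocycle need only be tested on the images of \<theta>, where
  its coboundary is, up to sign, that of the given h \<omega>.\<close>

lemma orbit_cochain_surj: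
  assumes h: "\<And>\<omega>. \<omega> \<in> R \<Longrightarrow> h \<omega> \<in> hom (free_Abelian_group (simplices \<omega> q)) G"
    and cocycle: "\<And>\<omega> y. \<omega> \<in> R \<Longrightarrow> Poly_Mapping.keys y \<subseteq> simplices \<omega> (Suc q) \<Longrightarrow> h \<omega> (simplicial_boundary y) = \<one>"
  obtains e where "e \<in> hom (free_Abelian_group (orbit_cells cells q)) G"
    "\<And>x. Poly_Mapping.keys x \<subseteq> orbit_cells cells (Suc q) \<Longrightarrow> e (orbit_boundary x) = \<one>"
    "\<And>\<omega> y. \<omega> \<in> R \<Longrightarrow> Poly_Mapping.keys y \<subseteq> simplices \<omega> q \<Longrightarrow> e (\<theta> \<omega> y) = h \<omega> y"
proof -
  obtain e where e: "e \<in> hom (free_Abelian_group (orbit_cells cells q)) G"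
    "\<And>\<omega> y. \<omega> \<in> R \<Longrightarrow> Poly_Mapping.keys y \<subseteq> simplices \<omega> q \<Longrightarrow> e (\<theta> \<omega> y) = h \<omega> y"
    using hom_extends_from_\<theta>[OF h] by blast
  have "e (orbit_boundary x) = \<one>" if x: "Poly_Mapping.keys x \<subseteq> orbit_cells cells (Suc q)" for x
  proof (rule hom_vanishes_if_on_\<theta>[OF _ _ x, of "\<lambda>x. e (orbit_boundary x)"])
    show "(\<lambda>x. e (orbit_boundary x)) \<in> hom (free_Abelian_group (orbit_cells cells (Suc q))) G"
      by (rule hom_compose_additive[OF e(1) additive_maps(4) keys_orbit_boundary[OF subcomplex_cells]])
    fix \<omega> and y :: "nat set \<Rightarrow>\<^sub>0 int" assume \<omega>: "\<omega> \<in> R" and y: "Poly_Mapping.keys y \<subseteq> simplices \<omega> (Suc q)"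
    have bdy: "Poly_Mapping.keys (simplicial_boundary y) \<subseteq> simplices \<omega> q"
      by (rule keys_simplicial_boundary_simplices[OF y])
    have "e (orbit_boundary (\<theta> \<omega> y)) = inv (e (\<theta> \<omega> (simplicial_boundary y)))"
      unfolding orbit_boundary_\<theta>[OF y] by (rule hom_free_Abelian(4)[OF e(1) keys_\<theta>[OF bdy] keys_\<theta>[OF bdy]])
    then show "e (orbit_boundary (\<theta> \<omega> y)) = \<one>" using e(2)[OF \<omega> bdy] cocycle[OF \<omega> y] by simp
  qed
  then show thesis using that e by blast
qed

text \<open>The isomorphism restricts singular cocycles along \<Phi> composed with \<theta>
  \<omega>. For surjectivity, a family of simplicial cocycles extends exactly to the orbit complex
  and is then pulled back along \<psi>, with an error controlled by k. For injectivity, the given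
  primitives are glued on orbit cells and carried over by \<psi>, with the correction h.\<close>

lemma singular_cohomology_M:
  "singular_cohomology p M G
     \<cong> sum_group R (\<lambda>\<omega>. reduced_simplicial_cohomology (p - 1) (full_subcomplex K \<omega>) G)"
proof -
  define S where "S q = (if q < 0 then {} else singular_simplex_set (nat q) M)" for q
  define T where "T \<omega> q = {\<sigma> \<in> full_subcomplex K \<omega>. finite \<sigma> \<and> int (card \<sigma>) = q + 1}" for \<omega> and q :: int
  have S_eq: "singular_chain_groups M = (\<lambda>q. free_Abelian_group (S q))"
    by (auto simp: singular_chain_groups_def chain_group_def S_def)
  have T_eq: "simplicial_chain_groups (full_subcomplex K \<omega>) = (\<lambda>q. free_Abelian_group (T \<omega> q))" for \<omega>
    by (auto simp: simplicial_chain_groups_def T_def)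
  have keys_S: "Poly_Mapping.keys x \<subseteq> S (int q) \<longleftrightarrow> singular_chain q M x" for x q
    by (simp add: S_def singular_chain_def)
  \<comment> \<open>Simplices with q vertices have dimension q - 1; for q = 0 this is the empty
    simplex in degree -1.\<close>
  have T_nat: "T \<omega> (int q - 1) = simplices \<omega> q" for \<omega> q
    using simplexD by (auto simp: T_def full_subcomplex_def simplices_def)
  have down: "\<tau> \<in> full_subcomplex K \<omega>" if "\<sigma> \<in> full_subcomplex K \<omega>" "\<tau> \<subseteq> \<sigma>" for \<omega> \<sigma> \<tau>
    using that K_down by (auto simp: full_subcomplex_def)
  have T_bd: "Poly_Mapping.keys (simplicial_boundary x) \<subseteq> T \<omega> (q - 1)" if "Poly_Mapping.keys x \<subseteq> T \<omega> q" for x \<omega> q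
    using keys_simplicial_boundary[OF that[unfolded T_def] down] by (simp add: T_def)
  have S_complex: "chain_complex_at S (\<lambda>q. chain_boundary (nat q)) p"
    unfolding chain_complex_at_def
  proof (intro conjI allI impI)
    show "additive (chain_boundary (nat q) :: (nat \<Rightarrow> real) set chain \<Rightarrow> _)" for q
      by (simp add: additive_def chain_boundary_diff)
    fix x
    have *: "Poly_Mapping.keys (chain_boundary (nat q) x) \<subseteq> S (q - 1)" if "Poly_Mapping.keys x \<subseteq> S q" for q
    proof (cases "q \<le> 0")
      case True
      then show ?thesis by (simp add: chain_boundary_def)
    next
      case False
      define r where "r = nat (q - 1)"
      have q: "nat q = Suc r" "q = int (Suc r)" "q - 1 = int r" using False by (simp_all add: r_def)
      have "singular_chain (Suc r) M x" using that unfolding q(2) keys_S .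
      then show ?thesis unfolding q(1,3) keys_S by (rule singular_chain_boundary_alt)
    qed
    show "Poly_Mapping.keys (chain_boundary (nat p) x) \<subseteq> S (p - 1)" if "Poly_Mapping.keys x \<subseteq> S p" by (rule *[OF that])
    assume x: "Poly_Mapping.keys x \<subseteq> S (p + 1)"
    show "Poly_Mapping.keys (chain_boundary (nat (p + 1)) x) \<subseteq> S p" using *[OF x] by simp
    show "chain_boundary (nat p) (chain_boundary (nat (p + 1)) x) = 0"
    proof (cases "p \<ge> 0")
      case True
      then have q: "p + 1 = int (Suc (nat p))" "nat (p + 1) = Suc (nat p)" by simp_all
      have "singular_chain (Suc (nat p)) M x" using x unfolding q(1) keys_S .
      then show ?thesis unfolding q(2) by (rule chain_boundary_boundary_alt)
    qed (simp add: chain_boundary_def)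
  qed
  have T_complex: "chain_complex_at (T \<omega>) (\<lambda>_. simplicial_boundary) (p - 1)" for \<omega>
    unfolding chain_complex_at_def
  proof (intro conjI allI impI)
    fix x
    show "Poly_Mapping.keys (simplicial_boundary x) \<subseteq> T \<omega> (p - 1 - 1)" if "Poly_Mapping.keys x \<subseteq> T \<omega> (p - 1)"
      by (rule T_bd[OF that])
    show "Poly_Mapping.keys (simplicial_boundary x) \<subseteq> T \<omega> (p - 1)" if "Poly_Mapping.keys x \<subseteq> T \<omega> (p - 1 + 1)"
      using T_bd[OF that] by simp
    show "simplicial_boundary (simplicial_boundary x) = 0" if "Poly_Mapping.keys x \<subseteq> T \<omega> (p - 1 + 1)"
      by (rule simplicial_boundary_boundary) (use that in \<open>auto simp: T_def\<close>)
  qed (rule additive_maps(5))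
  have trivial_hom: "(\<lambda>_. \<one>) \<in> hom (free_Abelian_group Y) G" for Y :: "'y set" by (simp add: hom_def)
  have trivial_hom': "(\<lambda>_. \<one>) \<in> hom (free_Abelian_group Y) G" for Y :: "'z set" by (simp add: hom_def)
  have T_neg: "T \<omega> (q - 1) = {}" if "q < 0" for \<omega> q using that by (auto simp: T_def)
  have keys_\<Theta>: "Poly_Mapping.keys (\<Phi> (\<theta> \<omega> x)) \<subseteq> S q" if x: "Poly_Mapping.keys x \<subseteq> T \<omega> (q - 1)" for \<omega> x q
  proof (cases q rule: int_cases2)
    case (nonneg n)
    then show ?thesis
      using singular_chain_\<Phi>_cells[OF keys_\<theta>] x keys_S T_nat by simp
  next
    case (nonpos n)
    show ?thesis
    proof (cases "n = 0")
      case True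
      then show ?thesis
        using singular_chain_\<Phi>_cells[OF keys_\<theta>, of x \<omega> 0] x keys_S[of _ 0] T_nat[of \<omega> 0] nonpos by simp
    next
      case False
      then have "x = 0" using x T_neg[of q \<omega>] nonpos by simp
      then show ?thesis by simp
    qed
  qed
  have bd_\<Theta>: "chain_boundary (nat q) (\<Phi> (\<theta> \<omega> x)) = - \<Phi> (\<theta> \<omega> (simplicial_boundary x))"
    if x: "Poly_Mapping.keys x \<subseteq> T \<omega> (q - 1)" for \<omega> x q
  proof (cases "q < 0")
    case True
    then have "x = 0" using x T_neg[of q \<omega>] by simp
    then show ?thesis by simp
  next
    case False
    then have "q = int (nat q)" by simp
    then have "Poly_Mapping.keys x \<subseteq> simplices \<omega> (nat q)" using x T_nat by metis
    then show ?thesis using boundary_\<Phi>[OF keys_\<theta>] orbit_boundary_\<theta> by simp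
  qed
  obtain \<psi> h k
  where \<psi>: "\<And>p x. singular_chain p M x \<Longrightarrow> Poly_Mapping.keys (frag_extend (\<psi> p) x) \<subseteq> orbit_cells cells p"
    and hh: "\<And>p x. singular_chain p M x \<Longrightarrow> singular_chain (Suc p) M (frag_extend (h p) x)"
    and k: "\<And>p x. Poly_Mapping.keys x \<subseteq> orbit_cells cells p \<Longrightarrow>
           Poly_Mapping.keys (frag_extend (k p) x) \<subseteq> orbit_cells cells (Suc p)"
    and \<psi>_bd: "\<And>p x. singular_chain p M x \<Longrightarrow>
          orbit_boundary (frag_extend (\<psi> p) x) = frag_extend (\<psi> (p - 1)) (chain_boundary p x)"
    and h_bd: "\<And>p x. singular_chain p M x \<Longrightarrow>
          chain_boundary (Suc p) (frag_extend (h p) x) + frag_extend (h (p - 1)) (chain_boundary p x)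
            = x - \<Phi> (frag_extend (\<psi> p) x)"
    and k_bd: "\<And>p x. Poly_Mapping.keys x \<subseteq> orbit_cells cells p \<Longrightarrow>
          orbit_boundary (frag_extend (k p) x) + frag_extend (k (p - 1)) (orbit_boundary x)
            = x - frag_extend (\<psi> p) (\<Phi> x)"
    by (rule orbit_complex_homotopy_inverse) blast
  show ?thesis
    unfolding singular_cohomology_def reduced_simplicial_cohomology_def S_eq T_eq
  proof (rule cohomology_iso_sum_groupI[where \<Theta> = "\<lambda>\<omega> x. \<Phi> (\<theta> \<omega> x)"])
    show "free_cochains G S (\<lambda>q. chain_boundary (nat q)) p"
      using S_complex by (simp add: free_cochains_def free_cochains_axioms_def comm_group_axioms)
    show "free_cochains G (T \<omega>) (\<lambda>_. simplicial_boundary) (p - 1)" for \<omega>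
      using T_complex by (simp add: free_cochains_def free_cochains_axioms_def comm_group_axioms)
    show "finite R" by (rule finite_R)
    show "additive (\<lambda>x. \<Phi> (\<theta> \<omega> x))" for \<omega> by (rule additive_maps)
  next
    show "Poly_Mapping.keys (\<Phi> (\<theta> \<omega> x)) \<subseteq> S p" if "Poly_Mapping.keys x \<subseteq> T \<omega> (p - 1)" for \<omega> x
      by (rule keys_\<Theta>[OF that])
  next
    fix \<omega> f and x :: "nat set \<Rightarrow>\<^sub>0 int" assume f: "f \<in> hom (free_Abelian_group (S p)) G"
      "\<And>x. Poly_Mapping.keys x \<subseteq> S (p + 1) \<Longrightarrow> f (chain_boundary (nat (p + 1)) x) = \<one>"
      and "Poly_Mapping.keys x \<subseteq> T \<omega> (p - 1 + 1)"
    then have x: "Poly_Mapping.keys x \<subseteq> T \<omega> (p + 1 - 1)" by simp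
    have "\<Phi> (\<theta> \<omega> (simplicial_boundary x)) = chain_boundary (nat (p + 1)) (- \<Phi> (\<theta> \<omega> x))"
      using bd_\<Theta>[OF x] by (simp add: chain_boundary_minus)
    then show "f (\<Phi> (\<theta> \<omega> (simplicial_boundary x))) = \<one>"
      using f(2)[of "- \<Phi> (\<theta> \<omega> x)"] keys_\<Theta>[OF x] by simp
  next
    fix \<omega> b assume b: "b \<in> hom (free_Abelian_group (S (p - 1))) G"
    have "(\<lambda>w. b (- \<Phi> (\<theta> \<omega> w))) \<in> hom (free_Abelian_group (T \<omega> (p - 1 - 1))) G"
      by (rule hom_compose_additive[OF b additive_maps(7)]) (use keys_\<Theta>[of _ \<omega> "p - 1"] in simp)
    then show "\<exists>b'\<in>hom (free_Abelian_group (T \<omega> (p - 1 - 1))) G.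
          \<forall>x. Poly_Mapping.keys x \<subseteq> T \<omega> (p - 1) \<longrightarrow> b (chain_boundary (nat p) (\<Phi> (\<theta> \<omega> x))) = b' (simplicial_boundary x)"
      using bd_\<Theta> by (intro bexI[of _ "\<lambda>w. b (- \<Phi> (\<theta> \<omega> w))"]) simp_all
  next
    fix z assume z: "\<And>i. i \<in> R \<Longrightarrow> z i \<in> hom (free_Abelian_group (T i (p - 1))) G"
        "\<And>i x. i \<in> R \<Longrightarrow> Poly_Mapping.keys x \<subseteq> T i (p - 1 + 1) \<Longrightarrow> z i (simplicial_boundary x) = \<one>"
    show "\<exists>f\<in>hom (free_Abelian_group (S p)) G.
          (\<forall>x. Poly_Mapping.keys x \<subseteq> S (p + 1) \<longrightarrow> f (chain_boundary (nat (p + 1)) x) = \<one>) \<and>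
          (\<forall>i\<in>R. \<exists>b\<in>hom (free_Abelian_group (T i (p - 1 - 1))) G.
             \<forall>x. Poly_Mapping.keys x \<subseteq> T i (p - 1) \<longrightarrow> f (\<Phi> (\<theta> i x)) = b (simplicial_boundary x) \<otimes> z i x)"
    proof (cases "p < 0")
      case True
      have "z i 0 = \<one>" if "i \<in> R" for i using hom_free_Abelian(2)[OF z(1)[OF that], of 0 0] by simp
      then show ?thesis
        using T_neg[OF True]
        by (intro bexI[OF _ trivial_hom] conjI allI impI ballI bexI[OF _ trivial_hom']) simp_all
    next
      case False
      define n where "n = nat p"
      have p: "p = int n" using False by (simp add: n_def)
      have Tp: "T i (p - 1) = simplices i n" "T i (p - 1 + 1) = simplices i (Suc n)" for i
        using T_nat[of i n] T_nat[of i "Suc n"] by (simp_all add: p)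
      obtain e where e: "e \<in> hom (free_Abelian_group (orbit_cells cells n)) G"
        "\<And>x. Poly_Mapping.keys x \<subseteq> orbit_cells cells (Suc n) \<Longrightarrow> e (orbit_boundary x) = \<one>"
        "\<And>\<omega> y. \<omega> \<in> R \<Longrightarrow> Poly_Mapping.keys y \<subseteq> simplices \<omega> n \<Longrightarrow> e (\<theta> \<omega> y) = z \<omega> y"
        using orbit_cochain_surj[OF z[unfolded Tp]] by blast
      let ?f = "\<lambda>c. e (frag_extend (\<psi> n) c)"
      have f: "?f \<in> hom (free_Abelian_group (S p)) G"
        by (rule hom_compose_additive[OF e(1) additive_frag_extend]) (use \<psi> keys_S p in simp)
      have f_cocycle: "?f (chain_boundary (nat (p + 1)) c) = \<one>" if c: "Poly_Mapping.keys c \<subseteq> S (p + 1)" for c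
      proof -
        have sc: "singular_chain (Suc n) M c" using c keys_S[of c "Suc n"] by (simp add: p add.commute)
        have "nat (p + 1) = Suc n" by (simp add: p nat_add_distrib)
        then show ?thesis using \<psi>_bd[OF sc] e(2)[OF \<psi>[OF sc]] by simp
      qed
      have "\<exists>b\<in>hom (free_Abelian_group (T i (p - 1 - 1))) G.
             \<forall>x. Poly_Mapping.keys x \<subseteq> T i (p - 1) \<longrightarrow> ?f (\<Phi> (\<theta> i x)) = b (simplicial_boundary x) \<otimes> z i x"
        if i: "i \<in> R" for i
      proof -
        \<comment> \<open>The homotopy k has two terms. The cocycle e kills the boundary of k, and k
          of the boundary yields this primitive; the sign in \<open>orbit_boundary_\<theta>\<close>
          makes it positive. For n = 0 its source is the zero group, so the truncated n - 1 does not
          matter.\<close>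
        let ?b = "\<lambda>w. e (frag_extend (k (n - 1)) (\<theta> i w))"
        have kw: "Poly_Mapping.keys (frag_extend (k (n - 1)) (\<theta> i w)) \<subseteq> orbit_cells cells n"
          if "Poly_Mapping.keys w \<subseteq> T i (p - 1 - 1)" for w
        proof (cases n)
          case 0
          then have "w = 0" using that T_neg[of "p - 1"] p by simp
          then show ?thesis by simp
        next
          case (Suc r)
          then have "Poly_Mapping.keys w \<subseteq> simplices i r" using that T_nat[of i r] p by simp
          then show ?thesis using k[OF keys_\<theta>] Suc by simp
        qed
        have b: "?b \<in> hom (free_Abelian_group (T i (p - 1 - 1))) G"
          by (rule hom_compose_additive[OF e(1) _ kw]) (simp_all add: additive_def frag_extend_diff)
        have "?f (\<Phi> (\<theta> i x)) = ?b (simplicial_boundary x) \<otimes> z i x" if "Poly_Mapping.keys x \<subseteq> T i (p - 1)" for x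
        proof -
          have x: "Poly_Mapping.keys x \<subseteq> simplices i n" using that Tp by simp
          have tx: "Poly_Mapping.keys (\<theta> i x) \<subseteq> orbit_cells cells n" by (rule keys_\<theta>[OF x])
          let ?u = "orbit_boundary (frag_extend (k n) (\<theta> i x))"
          let ?v = "frag_extend (k (n - 1)) (\<theta> i (simplicial_boundary x))"
          have ku: "Poly_Mapping.keys ?u \<subseteq> orbit_cells cells n"
            by (rule keys_orbit_boundary[OF subcomplex_cells k[OF tx]])
          have kv: "Poly_Mapping.keys ?v \<subseteq> orbit_cells cells n"
            by (rule kw) (rule T_bd, use that in simp)
          have "frag_extend (\<psi> n) (\<Phi> (\<theta> i x)) = \<theta> i x - ?u + ?v"
            using k_bd[OF tx] unfolding orbit_boundary_\<theta>[OF x] by (simp add: frag_extend_minus algebra_simps)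
          then have "?f (\<Phi> (\<theta> i x)) = e (\<theta> i x) \<otimes> inv (e ?u) \<otimes> e ?v"
            using hom_free_Abelian(3)[OF e(1) keys_diff_subset[OF tx ku] kv] hom_free_Abelian(5)[OF e(1) tx ku] by simp
          also have "\<dots> = z i x \<otimes> e ?v"
            using e(2)[OF k[OF tx]] e(3)[OF i x] hom_free_Abelian(1)[OF e(1) tx tx] by simp
          also have "\<dots> = e ?v \<otimes> z i x"
            using e(3)[OF i x] hom_free_Abelian(1)[OF e(1) tx tx] hom_free_Abelian(1)[OF e(1) kv kv] by (intro m_comm) simp_all
          finally show ?thesis .
        qed
        then show ?thesis by (intro bexI[OF _ b] allI impI)
      qed
      note restricts = this
      show ?thesis
      proof (intro bexI[OF _ f] conjI ballI allI impI)
        show "?f (chain_boundary (nat (p + 1)) c) = \<one>" if "Poly_Mapping.keys c \<subseteq> S (p + 1)" for c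
          by (rule f_cocycle[OF that])
      qed (rule restricts)
    qed
  next
    fix f assume f: "f \<in> hom (free_Abelian_group (S p)) G"
        "\<And>x. Poly_Mapping.keys x \<subseteq> S (p + 1) \<Longrightarrow> f (chain_boundary (nat (p + 1)) x) = \<one>"
      and ex: "\<And>i. i \<in> R \<Longrightarrow> \<exists>b\<in>hom (free_Abelian_group (T i (p - 1 - 1))) G.
             \<forall>x. Poly_Mapping.keys x \<subseteq> T i (p - 1) \<longrightarrow> f (\<Phi> (\<theta> i x)) = b (simplicial_boundary x)"
    show "\<exists>b\<in>hom (free_Abelian_group (S (p - 1))) G. \<forall>x. Poly_Mapping.keys x \<subseteq> S p \<longrightarrow> f x = b (chain_boundary (nat p) x)"
    proof (cases "p < 0")
      case True
      have "f 0 = \<one>" using hom_free_Abelian(2)[OF f(1), of 0 0] by simp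
      then show ?thesis using True by (intro bexI[OF _ trivial_hom]) (simp add: S_def)
    next
      case False
      define n where "n = nat p"
      have p: "p = int n" using False by (simp add: n_def)
      have Tp: "T i (p - 1) = simplices i n" for i using T_nat[of i n] by (simp add: p)
      have Sp: "Poly_Mapping.keys x \<subseteq> S p \<longleftrightarrow> singular_chain n M x" for x using keys_S[of x n] by (simp add: p)
      have "\<exists>b. \<forall>i\<in>R. b i \<in> hom (free_Abelian_group (T i (p - 1 - 1))) G \<and>
             (\<forall>x. Poly_Mapping.keys x \<subseteq> T i (p - 1) \<longrightarrow> f (\<Phi> (\<theta> i x)) = b i (simplicial_boundary x))"
        using ex by (intro bchoice) blast
      then obtain b where b: "\<And>i. i \<in> R \<Longrightarrow> b i \<in> hom (free_Abelian_group (T i (p - 1 - 1))) G"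
        and fb: "\<And>i x. i \<in> R \<Longrightarrow> Poly_Mapping.keys x \<subseteq> simplices i n \<Longrightarrow> f (\<Phi> (\<theta> i x)) = b i (simplicial_boundary x)"
        unfolding Tp by blast
      \<comment> \<open>The orbit cells of dimension n - 1, empty in degree -1, which the natural
        number n - 1 cannot express.\<close>
      define E0 where "E0 = (if n = 0 then {} else orbit_cells cells (n - 1))"
      have f\<Phi>: "(\<lambda>x. f (\<Phi> x)) \<in> hom (free_Abelian_group (orbit_cells cells n)) G"
        by (rule hom_compose_additive[OF f(1) additive_maps(1)]) (simp only: Sp singular_chain_\<Phi>_cells)
      have bd0: "Poly_Mapping.keys (orbit_boundary x) \<subseteq> E0" if "Poly_Mapping.keys x \<subseteq> orbit_cells cells n" for x
        using that orbit_boundary_0[of x cells] keys_orbit_boundary[OF subcomplex_cells, of x "n - 1"]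
        by (cases n) (simp_all add: E0_def)
      \<comment> \<open>Glueing the primitives: b0 restricts to b i along each \<theta> i. Since the
        boundary anticommutes with \<theta>, f on \<Phi> plus b0 on the boundary then cancels on all
        images of \<theta>, hence on all orbit chains.\<close>
      have "\<exists>b0\<in>hom (free_Abelian_group E0) G. \<forall>i\<in>R. \<forall>y. Poly_Mapping.keys y \<subseteq> simplices i n \<longrightarrow>
          f (\<Phi> (\<theta> i y)) \<otimes> b0 (orbit_boundary (\<theta> i y)) = \<one>"
      proof (cases n)
        case 0
        have "f (\<Phi> (\<theta> i y)) = \<one>" if i: "i \<in> R" and y: "Poly_Mapping.keys y \<subseteq> simplices i n" for i y
        proof -
          have "simplicial_boundary y = 0" by (rule simplicial_boundary_0) (use y 0 in simp)
          then show ?thesis using fb[OF i y] hom_free_Abelian(2)[OF b[OF i], of 0 0] by simp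
        qed
        then show ?thesis by (intro bexI[OF _ trivial_hom']) simp
      next
        case (Suc r)
        have Tr: "T i (p - 1 - 1) = simplices i r" for i using T_nat[of i r] by (simp add: p Suc)
        obtain b0 where b0: "b0 \<in> hom (free_Abelian_group (orbit_cells cells r)) G"
          "\<And>\<omega> y. \<omega> \<in> R \<Longrightarrow> Poly_Mapping.keys y \<subseteq> simplices \<omega> r \<Longrightarrow> b0 (\<theta> \<omega> y) = b \<omega> y"
          using hom_extends_from_\<theta>[OF b[unfolded Tr]] by blast
        have "f (\<Phi> (\<theta> i y)) \<otimes> b0 (orbit_boundary (\<theta> i y)) = \<one>"
          if i: "i \<in> R" and y: "Poly_Mapping.keys y \<subseteq> simplices i n" for i y
        proof -
          have bdy: "Poly_Mapping.keys (simplicial_boundary y) \<subseteq> simplices i r"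
            by (rule keys_simplicial_boundary_simplices) (use y Suc in simp)
          have "b0 (orbit_boundary (\<theta> i y)) = inv (b i (simplicial_boundary y))"
            unfolding orbit_boundary_\<theta>[OF y]
            using hom_free_Abelian(4)[OF b0(1) keys_\<theta>[OF bdy] keys_\<theta>[OF bdy]] b0(2)[OF i bdy] by simp
          moreover have "b i (simplicial_boundary y) \<in> carrier G"
            using hom_free_Abelian(1)[OF b[OF i, unfolded Tr] bdy bdy] .
          ultimately show ?thesis using fb[OF i y] by simp
        qed
        then show ?thesis using b0(1) by (intro bexI[of _ b0]) (simp_all add: E0_def Suc)
      qed
      then obtain b0 where b0: "b0 \<in> hom (free_Abelian_group E0) G"
        and fb0: "\<And>i y. i \<in> R \<Longrightarrow> Poly_Mapping.keys y \<subseteq> simplices i n \<Longrightarrow>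
          f (\<Phi> (\<theta> i y)) \<otimes> b0 (orbit_boundary (\<theta> i y)) = \<one>" by blast
      have u: "(\<lambda>x. f (\<Phi> x) \<otimes> b0 (orbit_boundary x)) \<in> hom (free_Abelian_group (orbit_cells cells n)) G"
        by (rule hom_mult_pointwise[OF f\<Phi> hom_compose_additive[OF b0 additive_maps(4) bd0]])
      have u1: "f (\<Phi> x) \<otimes> b0 (orbit_boundary x) = \<one>" if "Poly_Mapping.keys x \<subseteq> orbit_cells cells n" for x
        by (rule hom_vanishes_if_on_\<theta>[OF u fb0 that])
      have kS: "Poly_Mapping.keys (frag_extend (\<psi> (n - 1)) w) \<subseteq> E0 \<and> Poly_Mapping.keys (frag_extend (h (n - 1)) w) \<subseteq> S p"
        if w: "Poly_Mapping.keys w \<subseteq> S (p - 1)" for w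
      proof (cases n)
        case 0
        then have "w = 0" using w p by (simp add: S_def)
        then show ?thesis by simp
      next
        case (Suc r)
        then have "singular_chain r M w" using w keys_S[of w r] p by simp
        then show ?thesis using \<psi>[of r w] hh[of r w] Suc unfolding Sp by (simp add: E0_def)
      qed
      \<comment> \<open>A chain c equals \<Phi>(\<psi> c) plus the boundary of h(c) plus h of the
        boundary of c. The cocycle f kills the middle term, and on the first it is the inverse of b0
        at the boundary of \<psi> c, which is \<psi> of the boundary of c. What remains depends on
        the boundary of c only, through this formula.\<close>
      let ?b = "\<lambda>w. inv (b0 (frag_extend (\<psi> (n - 1)) w)) \<otimes> f (frag_extend (h (n - 1)) w)"
      have bh: "?b \<in> hom (free_Abelian_group (S (p - 1))) G"
        using kS by (intro hom_mult_pointwise hom_inv_pointwise hom_compose_additive[OF b0 additive_frag_extend]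
            hom_compose_additive[OF f(1) additive_frag_extend]) blast+
      have "f c = ?b (chain_boundary (nat p) c)" if "Poly_Mapping.keys c \<subseteq> S p" for c
      proof -
        have c: "singular_chain n M c" using that Sp by simp
        let ?x = "frag_extend (\<psi> n) c" and ?y = "chain_boundary (Suc n) (frag_extend (h n) c)"
          and ?w = "chain_boundary n c"
        have kw: "Poly_Mapping.keys ?w \<subseteq> S (p - 1)"
          using S_complex that unfolding chain_complex_at_def by (simp add: p)
        have kx: "Poly_Mapping.keys ?x \<subseteq> orbit_cells cells n" by (rule \<psi>[OF c])
        have k1: "Poly_Mapping.keys (\<Phi> ?x) \<subseteq> S p" unfolding Sp by (rule singular_chain_\<Phi>_cells[OF kx])
        have k2: "Poly_Mapping.keys ?y \<subseteq> S p" unfolding Sp by (rule singular_chain_boundary_alt[OF hh[OF c]])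
        have k3: "Poly_Mapping.keys (frag_extend (h (n - 1)) ?w) \<subseteq> S p" using kS[OF kw] by blast
        have "c = \<Phi> ?x + ?y + frag_extend (h (n - 1)) ?w" using h_bd[OF c] by (simp add: algebra_simps)
        then have "f c = f (\<Phi> ?x + ?y + frag_extend (h (n - 1)) ?w)" by (rule arg_cong)
        also have "\<dots> = f (\<Phi> ?x) \<otimes> f ?y \<otimes> f (frag_extend (h (n - 1)) ?w)"
          using hom_free_Abelian(3)[OF f(1) keys_add_subset[OF k1 k2] k3] hom_free_Abelian(3)[OF f(1) k1 k2] by simp
        also have "f ?y = \<one>"
        proof -
          have "Poly_Mapping.keys (frag_extend (h n) c) \<subseteq> S (p + 1)"
            using hh[OF c] keys_S[of _ "Suc n"] by (simp add: p add.commute)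
          moreover have "nat (p + 1) = Suc n" by (simp add: p nat_add_distrib)
          ultimately show ?thesis using f(2) by metis
        qed
        also have "f (\<Phi> ?x) = inv (b0 (orbit_boundary ?x))"
          using u1[OF kx] hom_free_Abelian(1)[OF f(1) k1 k1] hom_free_Abelian(1)[OF b0 bd0[OF kx] bd0[OF kx]]
          by (metis inv_equality inv_inv)
        also have "orbit_boundary ?x = frag_extend (\<psi> (n - 1)) ?w" by (rule \<psi>_bd[OF c])
        finally have "f c = inv (b0 (frag_extend (\<psi> (n - 1)) ?w)) \<otimes> \<one> \<otimes> f (frag_extend (h (n - 1)) ?w)" .
        moreover have "b0 (frag_extend (\<psi> (n - 1)) ?w) \<in> carrier G"
          using hom_free_Abelian(1)[OF b0] kS[OF kw] by blast
        ultimately show ?thesis by (simp add: p)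
      qed
      then show ?thesis by (intro bexI[OF _ bh] allI impI)
    qed
  qed
qed

end

section \<open>Duality between kernel and row space\<close>

text \<open>The orthogonal complement for the bilinear form over \<int>\<open>\<^sub>2\<close> given
  by the parity of intersections.\<close>

definition annihilator :: "'a set \<Rightarrow> 'a set set \<Rightarrow> 'a set set" where
  "annihilator I F = {g. g \<subseteq> I \<and> (\<forall>r\<in>F. even (card (r \<inter> g)))}"

lemma annihilator_sub: "annihilator I F \<subseteq> Pow I"
  unfolding annihilator_def by blast

lemma even_card_sym_diff:
  assumes "finite A" "finite B"
  shows "even (card (sym_diff A B)) \<longleftrightarrow> (even (card A) \<longleftrightarrow> even (card B))"
proof -
  have "(-1 :: int) ^ card (sym_diff A B) = (-1) ^ (card A + card B)"
    unfolding power_add by (rule minus_one_power_card_sym_diff[OF assms])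
  moreover have "(-1 :: int) ^ s = (-1) ^ t \<Longrightarrow> even s \<longleftrightarrow> even t" for s t :: nat
    by (simp add: minus_one_power_iff split: if_splits)
  ultimately have "even (card (sym_diff A B)) \<longleftrightarrow> even (card A + card B)" by blast
  then show ?thesis by (simp only: even_add)
qed

lemma annihilator_sym_diff:
  assumes "finite I" "g \<in> annihilator I F" "h \<in> annihilator I F"
  shows "sym_diff g h \<in> annihilator I F"
proof -
  have gh: "g \<subseteq> I" "h \<subseteq> I" "\<And>r. r \<in> F \<Longrightarrow> even (card (r \<inter> g)) \<and> even (card (r \<inter> h))"
    using assms(2,3) by (auto simp: annihilator_def)
  have "even (card (r \<inter> sym_diff g h))" if r: "r \<in> F" for r
  proof -
    have "r \<inter> sym_diff g h = sym_diff (r \<inter> g) (r \<inter> h)" by blast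
    moreover have "finite (r \<inter> g)" "finite (r \<inter> h)" using gh assms(1) finite_subset by blast+
    ultimately show ?thesis using even_card_sym_diff[of "r \<inter> g" "r \<inter> h"] gh(3)[OF r] by simp
  qed
  then show ?thesis using gh(1,2) unfolding annihilator_def by blast
qed

text \<open>Both sides count the sum of \<open>(-1)^|r \<inter> g|\<close> over all \<open>r \<in> F\<close> and \<open>g \<subseteq> I\<close>.\<close>

lemma card_annihilator:
  fixes F :: "nat set set"
  assumes I: "finite I" and F: "F \<subseteq> Pow I" "{} \<in> F" "\<And>r s. r \<in> F \<Longrightarrow> s \<in> F \<Longrightarrow> sym_diff r s \<in> F"
  shows "card F * card (annihilator I F) = 2 ^ card I"
proof -
  have finF: "finite F" using F(1) I finite_subset by blast
  have annP: "annihilator I F \<subseteq> Pow I" by (auto simp: annihilator_def)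
  have sumF: "(\<Sum>r\<in>F. character r g) = (if g \<in> annihilator I F then int (card F) else 0)" if g: "g \<in> Pow I" for g
  proof (cases "g \<in> annihilator I F")
    case True
    then have "(\<Sum>r\<in>F. character r g) = (\<Sum>r\<in>F. 1)"
      by (intro sum.cong refl) (auto simp: annihilator_def character_def Int_commute)
    then show ?thesis using True by simp
  next
    case False
    then obtain s where s: "s \<in> F" "odd (card (s \<inter> g))" using g by (auto simp: annihilator_def)
    have fing: "finite g" using g I finite_subset by blast
    \<comment> \<open>Translation by s permutes F and negates every summand, so the sum is its own
      negative.\<close>
    have ss: "sym_diff (sym_diff r s) s = r" for r by blast
    have "(\<Sum>r\<in>F. character r g) = (\<Sum>r\<in>F. character (sym_diff r s) g)"
      by (rule sum.reindex_bij_witness[of _ "\<lambda>r. sym_diff r s" "\<lambda>r. sym_diff r s"]) (simp_all only: ss F(3)[OF _ s(1)])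
    also have "\<dots> = (\<Sum>r\<in>F. - character r g)"
    proof (rule sum.cong[OF refl])
      fix r
      have "character s g = -1" using s(2) by (simp add: character_def Int_commute)
      then show "character (sym_diff r s) g = - character r g" using character_mult[OF fing, of r s] by simp
    qed
    finally show ?thesis using False by (simp add: sum_negf)
  qed
  have "int (card F * card (annihilator I F)) = (\<Sum>g\<in>Pow I. if g \<in> annihilator I F then int (card F) else 0)"
    using I annP by (simp add: sum.If_cases Int_absorb1 mult.commute)
  also have "\<dots> = (\<Sum>g\<in>Pow I. \<Sum>r\<in>F. character r g)" using sumF by simp
  also have "\<dots> = (\<Sum>r\<in>F. \<Sum>g\<in>Pow I. character r g)" by (rule sum.swap)
  also have "\<dots> = (\<Sum>r\<in>F. if r = {} then 2 ^ card I else 0)"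
  proof (rule sum.cong[OF refl])
    fix r assume "r \<in> F"
    then have "I \<inter> r = {} \<longleftrightarrow> r = {}" using F(1) by blast
    then show "(\<Sum>g\<in>Pow I. character r g) = (if r = {} then 2 ^ card I else 0)" using sum_character[OF I] by simp
  qed
  also have "\<dots> = int (2 ^ card I)" using finF F(2) by simp
  finally show ?thesis by (simp only: of_nat_eq_iff)
qed

text \<open>The counting formula for F and for its annihilator gives F and its double annihilator
  the same size, and one inclusion is clear.\<close>

lemma annihilator_annihilator:
  fixes F :: "nat set set"
  assumes I: "finite I" and F: "F \<subseteq> Pow I" "{} \<in> F" "\<And>r s. r \<in> F \<Longrightarrow> s \<in> F \<Longrightarrow> sym_diff r s \<in> F"
  shows "annihilator I (annihilator I F) = F"
proof -
  let ?A = "annihilator I F"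
  have A: "?A \<subseteq> Pow I" "{} \<in> ?A" by (rule annihilator_sub) (simp add: annihilator_def)
  have fin: "finite (annihilator I ?A)" by (rule finite_subset[OF annihilator_sub]) (simp add: I)
  have sub: "F \<subseteq> annihilator I ?A"
  proof
    fix r assume r: "r \<in> F"
    have "even (card (g \<inter> r))" if "g \<in> ?A" for g
      using that r unfolding annihilator_def by (subst Int_commute) blast
    then show "r \<in> annihilator I ?A" using r F(1) unfolding annihilator_def[of I ?A] by blast
  qed
  have 1: "card F * card ?A = 2 ^ card I" by (rule card_annihilator[OF I F])
  have "card ?A * card (annihilator I ?A) = 2 ^ card I"
    by (rule card_annihilator[OF I A annihilator_sym_diff[OF I]])
  then have "card (annihilator I ?A) * card ?A = card F * card ?A" using 1 by (simp only: mult.commute)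
  moreover have "card ?A \<noteq> 0"
  proof
    assume "card ?A = 0"
    then show False using 1 by simp
  qed
  ultimately have "card F = card (annihilator I ?A)" by simp
  then show ?thesis by (rule card_subset_eq[OF fin sub, symmetric])
qed

section \<open>Vectors over \<int>\<open>\<^sub>2\<close> as sets\<close>

lemma of_nat_bit_eq_0_iff: "(of_nat k :: bit) = 0 \<longleftrightarrow> even k"
  by (induction k) auto

lemma vec_support_add:
  assumes "u \<in> carrier_vec m" "v \<in> carrier_vec m"
  shows "vec_support (u + v) = sym_diff (vec_support u) (vec_support v)"
proof -
  have add: "(x + y \<noteq> 0) \<longleftrightarrow> ((x \<noteq> 0) \<noteq> (y \<noteq> 0))" for x y :: bit by (cases x; cases y) auto
  have "i \<in> vec_support (u + v) \<longleftrightarrow> i \<in> sym_diff (vec_support u) (vec_support v)" for i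
    using assms add[of "vec_index u (i - 1)" "vec_index v (i - 1)"] by (auto simp: vec_support_def)
  then show ?thesis by blast
qed

lemma scalar_prod_bit:
  assumes "u \<in> carrier_vec m" "v \<in> carrier_vec m"
  shows "u \<bullet> v = of_nat (card (vec_support u \<inter> vec_support v))"
proof -
  have "u \<bullet> v = (\<Sum>i\<in>{0..<m}. vec_index u i * vec_index v i)"
    using assms by (simp add: scalar_prod_def)
  also have "\<dots> = (\<Sum>i\<in>{1..m}. vec_index u (i - 1) * vec_index v (i - 1))"
    by (rule sum.reindex_bij_witness[of _ "\<lambda>i. i - 1" Suc]) auto
  also have "\<dots> = (\<Sum>i\<in>vec_support u \<inter> vec_support v. 1)"
  proof (rule sum.mono_neutral_cong_right)
    have one: "x \<noteq> 0 \<Longrightarrow> x = 1" for x :: bit by (cases x) auto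
    show "vec_index u (i - 1) * vec_index v (i - 1) = 1" if "i \<in> vec_support u \<inter> vec_support v" for i
      using that one[of "vec_index u (i - 1)"] one[of "vec_index v (i - 1)"] by (simp add: vec_support_def)
  qed (use assms in \<open>auto simp: vec_support_def\<close>)
  finally show ?thesis by simp
qed

section \<open>The coefficient groups\<close>

lemma uniquely_two_divisible_rat_group: "uniquely_two_divisible rat_group"
proof -
  have "\<exists>y\<in>carrier rat_group. y \<otimes>\<^bsub>rat_group\<^esub> x = \<one>\<^bsub>rat_group\<^esub>" for x
    by (intro bexI[of _ "- x"]) (simp_all add: rat_group_def)
  then interpret comm_group rat_group
    by (intro comm_groupI) (simp_all add: rat_group_def)
  show ?thesis
  proof
    show "\<exists>y\<in>carrier rat_group. y \<otimes>\<^bsub>rat_group\<^esub> y = x" for x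
      by (intro bexI[of _ "x / 2"]) (simp_all add: rat_group_def)
  qed (simp add: rat_group_def)
qed

lemma uniquely_two_divisible_integer_mod_group:
  assumes q: "odd q" shows "uniquely_two_divisible (integer_mod_group q)"
proof -
  have pos: "q > 0" using q by (cases q) auto
  interpret comm_group "integer_mod_group q" by (rule abelian_integer_mod_group)
  show ?thesis
  proof
    fix x assume x: "x \<in> carrier (integer_mod_group q)"
    \<comment> \<open>For odd q this is an inverse of 2 modulo q.\<close>
    let ?h = "(int q + 1) div 2"
    have h: "?h + ?h = int q + 1" using q by presburger
    have "(x * ?h mod int q + x * ?h mod int q) mod int q = (x * (?h + ?h)) mod int q"
      by (simp only: mod_add_eq distrib_left)
    also have "\<dots> = (x + x * int q) mod int q" unfolding h by (simp only: distrib_left mult_1_right add.commute[of x])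
    also have "\<dots> = x" using x pos by (simp add: carrier_integer_mod_group)
    finally have half: "(x * ?h mod int q + x * ?h mod int q) mod int q = x" .
    show "\<exists>y\<in>carrier (integer_mod_group q). y \<otimes>\<^bsub>integer_mod_group q\<^esub> y = x"
    proof (rule bexI)
      show "x * ?h mod int q \<otimes>\<^bsub>integer_mod_group q\<^esub> (x * ?h mod int q) = x"
        unfolding mult_integer_mod_group by (rule half)
      show "x * ?h mod int q \<in> carrier (integer_mod_group q)"
        using pos by (simp add: carrier_integer_mod_group)
    qed
    assume "x \<otimes>\<^bsub>integer_mod_group q\<^esub> x = \<one>\<^bsub>integer_mod_group q\<^esub>"
    then have "int q dvd 2 * x" by (simp add: mod_eq_0_iff_dvd)
    moreover have "coprime (int q) 2" using q by simp
    ultimately have "int q dvd x" by (simp add: coprime_dvd_mult_right_iff)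
    then show "x = \<one>\<^bsub>integer_mod_group q\<^esub>"
      using x pos by (auto simp: carrier_integer_mod_group dest: zdvd_imp_le)
  qed
qed

section \<open>The kernel and the row space of the characteristic matrix\<close>

context
  fixes n m :: nat and K :: "nat set set" and lam :: "nat \<Rightarrow> bit vec"
  assumes K: "simplicial_complex_on m K"
    and lam: "\<forall>i\<in>{1..m}. lam i \<in> carrier_vec n"
    and indpt: "\<forall>\<sigma>\<in>K. lin_indpt_family n lam \<sigma>"
begin

lemma char_matrix_carrier: "char_matrix n m lam \<in> carrier_mat n m"
  using mat_of_cols_carrier(1)[of n "map lam [1..<Suc m]"] by (simp add: char_matrix_def del: upt_Suc)

lemma char_matrix_index: "j < n \<Longrightarrow> i < m \<Longrightarrow> char_matrix n m lam $$ (j, i) = vec_index (lam (Suc i)) j"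
  by (simp add: char_matrix_def mat_of_cols_index nth_append del: upt_Suc)

definition kernel_sets :: "nat set set" where
  "kernel_sets = vec_support ` mat_kernel (char_matrix n m lam)"

lemmas kernel_iff = mat_kernel[OF char_matrix_carrier]

text \<open>Turns the inverse of the support bijection into an image, on which closure under sums
  can be checked.\<close>

lemma row_subsets_iff:
  "\<omega> \<in> row_subsets n m lam \<longleftrightarrow> (\<exists>w\<in>vec_space.row_space m (char_matrix n m lam). \<omega> = vec_support w)"
proof -
  have sub: "vec_space.row_space m (char_matrix n m lam) \<subseteq> carrier_vec m"
    using vec_space.row_space_eq[OF char_matrix_carrier] char_matrix_carrier by auto
  have inj: "inj_on vec_support (carrier_vec m)" and im: "vec_support ` carrier_vec m = Pow {1..m}"
    using bij_betw_vec_support[of m] by (auto simp: bij_betw_def)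
  show ?thesis
  proof
    assume "\<omega> \<in> row_subsets n m lam"
    then have \<omega>: "\<omega> \<in> vec_support ` carrier_vec m"
      "inv_into (carrier_vec m) vec_support \<omega> \<in> vec_space.row_space m (char_matrix n m lam)"
      unfolding im by (auto simp: row_subsets_def)
    show "\<exists>w\<in>vec_space.row_space m (char_matrix n m lam). \<omega> = vec_support w"
      using f_inv_into_f[OF \<omega>(1)] by (intro bexI[OF _ \<omega>(2)]) simp
  next
    assume "\<exists>w\<in>vec_space.row_space m (char_matrix n m lam). \<omega> = vec_support w"
    then obtain w where w: "w \<in> vec_space.row_space m (char_matrix n m lam)" "\<omega> = vec_support w" by blast
    then have "w \<in> carrier_vec m" using sub by blast
    then show "\<omega> \<in> row_subsets n m lam"
      using w im inv_into_f_f[OF inj] by (auto simp: row_subsets_def)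
  qed
qed

lemma row_space_iff:
  "w \<in> vec_space.row_space m (char_matrix n m lam) \<longleftrightarrow> (\<exists>y\<in>carrier_vec n. w = (char_matrix n m lam)\<^sup>T *\<^sub>v y)"
  using vec_space.row_space_eq[OF char_matrix_carrier] char_matrix_carrier by auto

lemma row_subsets_iff_transpose:
  "\<omega> \<in> row_subsets n m lam \<longleftrightarrow> (\<exists>y\<in>carrier_vec n. \<omega> = vec_support ((char_matrix n m lam)\<^sup>T *\<^sub>v y))"
  unfolding row_subsets_iff Bex_def row_space_iff by blast

text \<open>Nonzero coefficients over \<int>\<open>\<^sub>2\<close> are 1, so a kernel vector with
  support g says that the columns indexed by g sum to zero. If g is a nonempty subset of \<sigma>,
  this contradicts independence; injectivity of \<open>lam\<close> on \<sigma> identifies the sum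
  over indices with the sum over the set of vectors.\<close>

lemma kernel_sets_free:
  assumes g: "g \<in> kernel_sets" and \<sigma>: "\<sigma> \<in> K" "g \<subseteq> \<sigma>"
  shows "g = {}"
proof (rule ccontr)
  assume "g \<noteq> {}"
  then obtain i0 where i0: "i0 \<in> g" by blast
  interpret V: vec_space "TYPE(bit)" n .
  obtain v where v: "v \<in> carrier_vec m" "char_matrix n m lam *\<^sub>v v = 0\<^sub>v n" "g = vec_support v"
    using g kernel_iff by (auto simp: kernel_sets_def)
  have gm: "g \<subseteq> {1..m}" using v by (auto simp: vec_support_def)
  have fing: "finite g" using gm finite_subset by blast
  have ind: "lin_indpt_family n lam \<sigma>" using indpt \<sigma>(1) by (rule bspec)
  have inj: "inj_on lam g"
    by (rule inj_on_subset[OF conjunct1[OF ind[unfolded lin_indpt_family_def]] \<sigma>(2)])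
  have li: "\<not> V.lin_dep (lam ` \<sigma>)" by (rule conjunct2[OF ind[unfolded lin_indpt_family_def]])
  have car: "lam ` g \<subseteq> carrier_vec n" using lam gm by blast
  have "V.lincomb (\<lambda>_. 1 :: bit) (lam ` g) = 0\<^sub>v n"
  proof (rule eq_vecI)
    fix j assume "j < dim_vec (0\<^sub>v n :: bit vec)"
    then have j: "j < n" by simp
    have "vec_index (V.lincomb (\<lambda>_. 1 :: bit) (lam ` g)) j = (\<Sum>w\<in>lam ` g. vec_index w j)"
      unfolding V.lincomb_index[OF j car] by (simp only: mult_1_left)
    also have "\<dots> = (\<Sum>i\<in>g. vec_index (lam i) j)" unfolding sum.reindex[OF inj] comp_def by (rule refl)
    also have "\<dots> = (\<Sum>i\<in>{1..m}. vec_index (lam i) j * vec_index v (i - 1))"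
    proof (rule sum.mono_neutral_cong_left)
      have one: "x \<noteq> 0 \<Longrightarrow> x = 1" for x :: bit by (cases x) auto
      show "vec_index (lam i) j = vec_index (lam i) j * vec_index v (i - 1)" if "i \<in> g" for i
        using that one[of "vec_index v (i - 1)"] v(3) by (simp add: vec_support_def)
    qed (use gm v in \<open>auto simp: vec_support_def\<close>)
    also have "\<dots> = (\<Sum>i\<in>{0..<m}. char_matrix n m lam $$ (j, i) * vec_index v i)"
      by (rule sum.reindex_bij_witness[of _ Suc "\<lambda>i. i - 1"]) (auto simp: char_matrix_index[OF j])
    also have "\<dots> = vec_index (char_matrix n m lam *\<^sub>v v) j"
      using j carrier_vecD[OF v(1)] carrier_matD[OF char_matrix_carrier] by (simp add: scalar_prod_def)
    finally show "vec_index (V.lincomb (\<lambda>_. 1 :: bit) (lam ` g)) j = vec_index (0\<^sub>v n) j" using v(2) by simp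
  qed (use V.lincomb_dim[OF _ car] fing in auto)
  moreover have "lam ` g \<subseteq> lam ` \<sigma>" using \<sigma>(2) by blast
  ultimately have "V.lin_dep (lam ` \<sigma>)"
    unfolding V.lin_dep_def using fing i0
    by (intro exI[of _ "lam ` g"] exI[of _ "\<lambda>_. 1 :: bit"] exI[of _ "lam i0"]) auto
  then show False using li by blast
qed

text \<open>Row vectors pair evenly with the kernel because the transpose is adjoint to the matrix.
  Conversely, the supports of the row space are their own double annihilator, so a set outside them
  pairs oddly with some g in the annihilator; such a g is orthogonal to every single row, that is,
  it supports a kernel vector.\<close>

lemma dual_reflection_group_kernel:
  "dual_reflection_group m K kernel_sets (row_subsets n m lam)"
proof
  let ?A = "char_matrix n m lam"
  let ?R = "row_subsets n m lam"
  note cA = char_matrix_carrier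
  show "K \<subseteq> Pow {1..m}" "\<And>\<sigma> \<tau>. \<sigma> \<in> K \<Longrightarrow> \<tau> \<subseteq> \<sigma> \<Longrightarrow> \<tau> \<in> K"
    using K by (auto simp: simplicial_complex_on_def)
  show "kernel_sets \<subseteq> Pow {1..m}"
    using kernel_iff by (auto simp: kernel_sets_def vec_support_def)
  have "0\<^sub>v m \<in> mat_kernel ?A" using cA by (auto simp: kernel_iff)
  moreover have "vec_support (0\<^sub>v m) = {}" by (auto simp: vec_support_def)
  ultimately show "{} \<in> kernel_sets" unfolding kernel_sets_def by (metis imageI)
  show "sym_diff g h \<in> kernel_sets" if gh: "g \<in> kernel_sets" "h \<in> kernel_sets" for g h
  proof -
    obtain u v where uv: "u \<in> mat_kernel ?A" "g = vec_support u" "v \<in> mat_kernel ?A" "h = vec_support v"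
      using gh by (auto simp: kernel_sets_def)
    then have "u + v \<in> mat_kernel ?A"
      unfolding kernel_iff using cA by (auto simp: mult_add_distrib_mat_vec[OF cA])
    moreover have "vec_support (u + v) = sym_diff g h"
      using uv vec_support_add[of u m v] by (auto simp: kernel_iff)
    ultimately show ?thesis unfolding kernel_sets_def by (metis imageI)
  qed
  show "g = {}" if "g \<in> kernel_sets" "\<sigma> \<in> K" "g \<subseteq> \<sigma>" for g \<sigma>
    by (rule kernel_sets_free[OF that])
  show Rs: "?R \<subseteq> Pow {1..m}" by (auto simp: row_subsets_def)
  show "even (card (\<omega> \<inter> g))" if \<omega>: "\<omega> \<in> ?R" and g: "g \<in> kernel_sets" for \<omega> g
  proof -
    obtain y where y: "y \<in> carrier_vec n" "\<omega> = vec_support (?A\<^sup>T *\<^sub>v y)"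
      using \<omega> unfolding row_subsets_iff_transpose by blast
    obtain v where v: "v \<in> carrier_vec m" "?A *\<^sub>v v = 0\<^sub>v n" "g = vec_support v"
      using g kernel_iff by (auto simp: kernel_sets_def)
    have cT: "?A\<^sup>T \<in> carrier_mat m n" using cA by simp
    have w: "?A\<^sup>T *\<^sub>v y \<in> carrier_vec m" by (rule mult_mat_vec_carrier[OF cT y(1)])
    have "(?A\<^sup>T *\<^sub>v y) \<bullet> v = y \<bullet> (?A *\<^sub>v v)"
      using transpose_vec_mult_scalar[OF cA v(1) y(1)] by simp
    also have "\<dots> = 0" using v(2) y(1) by simp
    finally show ?thesis
      using scalar_prod_bit[OF w v(1)] y(2) v(3) by (simp add: of_nat_bit_eq_0_iff)
  qed
  show "\<exists>g\<in>kernel_sets. odd (card (\<omega> \<inter> g))" if \<omega>: "\<omega> \<subseteq> {1..m}" "\<omega> \<notin> ?R" for \<omega>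
  proof -
    have "?A\<^sup>T *\<^sub>v 0\<^sub>v n = 0\<^sub>v m" using cA by auto
    then have "{} \<in> ?R"
      unfolding row_subsets_iff_transpose by (intro bexI[of _ "0\<^sub>v n"]) (simp_all add: vec_support_def)
    moreover have "sym_diff r s \<in> ?R" if rs: "r \<in> ?R" "s \<in> ?R" for r s
    proof -
      obtain y z where yz: "y \<in> carrier_vec n" "r = vec_support (?A\<^sup>T *\<^sub>v y)" "z \<in> carrier_vec n" "s = vec_support (?A\<^sup>T *\<^sub>v z)"
        using rs unfolding row_subsets_iff_transpose by blast
      have cT: "?A\<^sup>T \<in> carrier_mat m n" using cA by simp
      have "?A\<^sup>T *\<^sub>v (y + z) = ?A\<^sup>T *\<^sub>v y + ?A\<^sup>T *\<^sub>v z" by (rule mult_add_distrib_mat_vec[OF cT yz(1,3)])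
      then have "vec_support (?A\<^sup>T *\<^sub>v (y + z)) = sym_diff r s"
        using vec_support_add[OF mult_mat_vec_carrier[OF cT yz(1)] mult_mat_vec_carrier[OF cT yz(3)]] yz(2,4) by simp
      moreover have "y + z \<in> carrier_vec n" using yz by simp
      ultimately show ?thesis
        unfolding row_subsets_iff_transpose by (intro bexI[of _ "y + z"]) simp_all
    qed
    ultimately have "annihilator {1..m} (annihilator {1..m} ?R) = ?R"
      using Rs by (intro annihilator_annihilator) auto
    then have "\<omega> \<notin> annihilator {1..m} (annihilator {1..m} ?R)" using \<omega>(2) by simp
    then obtain g where g: "g \<in> annihilator {1..m} ?R" "odd (card (g \<inter> \<omega>))"
      using \<omega>(1) unfolding annihilator_def[of _ "annihilator {1..m} ?R"] by blast
    then have "g \<in> vec_support ` carrier_vec m"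
      using bij_betw_vec_support[of m] by (auto simp: bij_betw_def annihilator_def)
    then obtain v where v: "v \<in> carrier_vec m" "g = vec_support v" by blast
    have "?A *\<^sub>v v = 0\<^sub>v n"
    proof (rule eq_vecI)
      fix j assume "j < dim_vec (0\<^sub>v n :: bit vec)"
      then have j: "j < n" by simp
      \<comment> \<open>Writing the row as the image of a unit vector under the transpose exhibits
        it as an element of the row space.\<close>
      have row: "row ?A j = ?A\<^sup>T *\<^sub>v unit_vec n j"
        using cA j by (intro eq_vecI) auto
      then have "vec_support (row ?A j) \<in> ?R"
        unfolding row_subsets_iff_transpose by (intro bexI[OF _ unit_vec_carrier]) simp
      then have "even (card (vec_support (row ?A j) \<inter> g))" using g(1) by (auto simp: annihilator_def)
      moreover have "row ?A j \<in> carrier_vec m" using cA j by (auto simp: row_carrier_vec)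
      ultimately have "row ?A j \<bullet> v = 0"
        using scalar_prod_bit[OF _ v(1)] v(2) by (simp add: of_nat_bit_eq_0_iff)
      then show "vec_index (?A *\<^sub>v v) j = vec_index (0\<^sub>v n) j" using cA j by simp
    qed (use cA in auto)
    then have "g \<in> kernel_sets" unfolding kernel_sets_def kernel_iff using v by blast
    then show ?thesis using g(2) by (auto simp: Int_commute)
  qed
qed

lemma real_toric_manifold_eq: "real_toric_manifold n m K lam = free_reflection_group.M m K kernel_sets"
proof -
  interpret dual_reflection_group m K kernel_sets "row_subsets n m lam" by (rule dual_reflection_group_kernel)
  have "reflect m v x = refl (vec_support v) x" for v x by (simp add: reflect_def refl_def)
  then have "orbit (kernel_group n m lam) (reflect m) x = orbit_map x" for x
    unfolding orbit_map_def by (auto simp: orbit_def kernel_group_def kernel_sets_def)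
  then have "orbit (kernel_group n m lam) (reflect m) = orbit_map" by (rule ext)
  then show ?thesis by (simp add: real_toric_manifold_def M_def)
qed

lemma cohomology_real_toric_manifold:
  assumes "uniquely_two_divisible G"
  shows "singular_cohomology p (real_toric_manifold n m K lam) G
    \<cong> sum_group (row_subsets n m lam) (\<lambda>\<omega>. reduced_simplicial_cohomology (p - 1) (full_subcomplex K \<omega>) G)"
proof -
  interpret dual_reflection_group_coefficients m K kernel_sets "row_subsets n m lam" G
    using dual_reflection_group_kernel assms by (rule dual_reflection_group_coefficients.intro)
  show ?thesis unfolding real_toric_manifold_eq by (rule singular_cohomology_M)
qed

end

theorem theorem4p6:
  fixes n m :: nat and K :: "nat set set" and lam :: "nat \<Rightarrow> bit vec"
  assumes "simplicial_sphere n m K"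
    and "star_shaped n m K"
    and "\<forall>i\<in>{1..m}. lam i \<in> carrier_vec n"
    and "\<forall>\<sigma>\<in>K. lin_indpt_family n lam \<sigma>"
  shows "(\<forall>p :: int.
      singular_cohomology p (real_toric_manifold n m K lam) rat_group
      \<cong> sum_group (row_subsets n m lam)
          (\<lambda>\<omega>. reduced_simplicial_cohomology (p - 1) (full_subcomplex K \<omega>) rat_group)) \<and>
    (\<forall>q :: nat. odd q \<longrightarrow> (\<forall>p :: int.
      singular_cohomology p (real_toric_manifold n m K lam) (integer_mod_group q)
      \<cong> sum_group (row_subsets n m lam)
          (\<lambda>\<omega>. reduced_simplicial_cohomology (p - 1) (full_subcomplex K \<omega>) (integer_mod_group q))))"
proof -
  have K: "simplicial_complex_on m K" using assms(1) by (simp add: simplicial_sphere_def)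
  note iso = cohomology_real_toric_manifold[OF K assms(3,4)]
  show ?thesis
    using iso[OF uniquely_two_divisible_rat_group] iso[OF uniquely_two_divisible_integer_mod_group] by blast
qed

end
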